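(* Let $m,n\ge 1$ be integers. For any $\epsilon>0$, there exists $\delta>0$ such that $$\dim_H \mathbf{Bad}(\epsilon)<mn+m-\delta .$$
   Context: $M_{m,n}(\mathbb{R})$ is the set of $m\times n$ real matrices, and $\widetilde{M}_{m,n}(\mathbb{R}):=M_{m,n}(\mathbb{R})\times\mathbb{R}^m$, identified with $\mathbb{R}^{mn+m}$; $\|\cdot\|$ is the Euclidean norm; $\dim_H$ is Hausdorff dimension. For $v\in\mathbb{R}^m$, $\langle v\rangle:=\inf_{p\in\mathbb{Z}^m}\|v-p\|$. For $\epsilon>0$, a matrix $A\in M_{m,n}(\mathbb{R})$ is called $\epsilon$-bad for $b\in\mathbb{R}^m$ if $$\liminf_{q\in\mathbb{Z}^n,\ \|q\|\to\infty}\|q\|^{n/m}\langle Aq-b\rangle\ge\epsilon .$$ $\mathbf{Bad}(\epsilon):=\{(A,b)\in\widetilde{M}_{m,n}(\mathbb{R}): A \text{ is } \epsilon\text{-bad for } b\}$. *)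

theory Defs
  imports "HOL-Analysis.Analysis"
begin

text \<open>The library's \<open>diameter\<close> is a real number, meaningful only for bounded sets, so the covering
  sets below are required to be bounded. The first two cases of the weight implement the usual
  conventions for \<open>s = 0\<close>, where \<open>powr\<close> would give \<open>0 powr 0 = 0\<close>: a nonempty set has weight 1
  and the empty set has weight 0.\<close>

definition hausdorff_weight :: "real \<Rightarrow> 'a::metric_space set \<Rightarrow> ennreal" where
  "hausdorff_weight s U =
     (if U = {} then 0 else if s = 0 then 1 else ennreal (diameter U powr s))"

definition hausdorff_premeasure :: "real \<Rightarrow> real \<Rightarrow> 'a::metric_space set \<Rightarrow> ennreal" where
  "hausdorff_premeasure s r S =
     (INF U \<in> {U :: nat \<Rightarrow> 'a set. S \<subseteq> (\<Union>i. U i) \<and> (\<forall>i. bounded (U i) \<and> diameter (U i) \<le> r)}.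
        \<Sum>i. hausdorff_weight s (U i))"

definition hausdorff_measure :: "real \<Rightarrow> 'a::metric_space set \<Rightarrow> ennreal" where
  "hausdorff_measure s S = (SUP r \<in> {0<..}. hausdorff_premeasure s r S)"

definition hausdorff_dim :: "'a::metric_space set \<Rightarrow> ereal" where
  "hausdorff_dim S = (INF s \<in> {s. 0 \<le> s \<and> hausdorff_measure s S = 0}. ereal s)"

definition int_vectors :: "(real ^ 'k) set" where
  "int_vectors = {v. \<forall>i. v $ i \<in> \<int>}"

definition dist_to_int :: "real ^ 'k \<Rightarrow> real" where
  "dist_to_int v = (INF p \<in> int_vectors. norm (v - p))"

text \<open>The lower limit is taken in the extended reals because it can be infinite
  (for instance for \<open>A = 0\<close> and \<open>b\<close> not an integer vector).\<close>

definition eps_bad :: "real \<Rightarrow> real ^ 'n ^ 'm \<Rightarrow> real ^ 'm \<Rightarrow> bool" where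
  "eps_bad \<epsilon> A b \<longleftrightarrow>
     Liminf (inf at_infinity (principal int_vectors))
       (\<lambda>q. ereal (norm q powr (real CARD('n) / real CARD('m)) * dist_to_int (A *v q - b)))
     \<ge> ereal \<epsilon>"

text \<open>The norms on \<open>real ^ 'n ^ 'm\<close> and on products are the square roots of the sums of the squared
  component norms, so the metric on this product space is the Euclidean metric of \<open>mn + m\<close>
  real coordinates.\<close>

definition Bad :: "real \<Rightarrow> ((real ^ 'n ^ 'm) \<times> (real ^ 'm)) set" where
  "Bad \<epsilon> = {(A, b). eps_bad \<epsilon> A b}"

end

theory Submission
  imports Defs
begin

text \<open>
Write \<open>m\<close> and \<open>n\<close> for the numbers of rows and columns of \<open>A\<close>. The proof is a box count. Up to integer
translations, \<open>Bad \<epsilon>\<close> is a countable union of the sets \<open>uniformly_bad\<close>, where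
\<open>norm q powr (n / m) * dist_to_int (A q - b) \<ge> \<epsilon> / 2\<close> holds for all integer vectors \<open>q\<close> with \<open>norm q \<ge> N\<close>. It
suffices to cover each of them, for all \<open>k\<close>, by at most \<open>C (\<mu> M ^ (m n + m)) ^ k\<close> balls of radius of order
\<open>M ^ (- k)\<close>, with \<open>\<mu> < 1\<close> independent of \<open>N\<close>.

Fix an integer \<open>W\<close> and put \<open>M = W ^ (m + n)\<close>. At level \<open>i\<close>, matrices are known up to \<open>M ^ (- i)\<close>, targets
\<open>b\<close> up to \<open>W ^ (- n i)\<close>, and the relevant \<open>q\<close> have size about \<open>W ^ (m i)\<close>. A matrix is good at level \<open>i\<close> if
its lattice, the set of vectors \<open>(A q - p, q)\<close> renormalised to that level, has at most \<open>K\<close> vectors in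
the unit cube.

At a good level the points \<open>A q - p\<close> are well spread (\<open>inhomogeneous_covering\<close>, a pigeonhole argument), so
every box of targets contains a smaller box of comparable size that consists of well approximable targets
(\<open>dead_subbox\<close>). Hence over a matrix with many good levels few boxes of targets survive (\<open>slice_decay\<close>).

Matrices with few good levels are rare because the number of short vectors is a Lyapunov function on
the tree of \<open>M\<close>-adic boxes: as soon as it exceeds \<open>K\<close>, its average over the children of a box is at most half
its value (\<open>drift_inequality\<close>). The reason is that a lattice with very many short vectors has all its
vectors of moderate length in a hyperplane (\<open>hyperplane_of_many_short\<close>), so it has fewer vectors that could become
short than the general bound allows. The resulting supermartingale (\<open>supermartingale_bound\<close>) shows that
the matrices with few good levels form an exponentially small proportion (\<open>few_good_levels_rare\<close>), and the two
estimates combine in \<open>uniformly_bad_covers\<close>.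
\<close>

section \<open>Counting in finite sets and determinants\<close>

lemma ex_max_coord:
  fixes f :: "'k::finite \<Rightarrow> real"
  shows "\<exists>c0. \<forall>c. f c \<le> f c0"
proof -
  have "Max (range f) \<in> range f" by (rule Max_in) auto
  then obtain c0 where "Max (range f) = f c0" by (rule rangeE)
  then show ?thesis using Max_ge[of "range f"] by (metis finite finite_imageI rangeI)
qed

lemma floor_eq_abs_diff:
  fixes a b :: real
  shows "\<lfloor>a\<rfloor> = \<lfloor>b\<rfloor> \<Longrightarrow> \<bar>a - b\<bar> \<le> 1"
  by linarith

lemma mult_of_nat_le:
  fixes R :: real
  assumes "a \<le> b * c" "real b \<le> R"
  shows "real a \<le> R * real c"
proof -
  have "real a \<le> real b * real c" using assms(1) by (metis of_nat_le_iff of_nat_mult)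
  also have "\<dots> \<le> R * real c" using assms(2) by (rule mult_right_mono) simp
  finally show ?thesis .
qed

text \<open>The preimage under \<open>u\<close> of the closed ball of radius \<open>r\<close> about \<open>0\<close> in the maximum norm. For a
parametrised lattice this is the set of (coordinates of) lattice vectors of length at most \<open>r\<close>.\<close>

definition sup_ball :: "('z \<Rightarrow> real ^ 'd) \<Rightarrow> real \<Rightarrow> 'z set" where
  "sup_ball u r = {z. \<forall>c. \<bar>u z $ c\<bar> \<le> r}"

lemma card_le_fibres:
  assumes "finite A" "f ` A \<subseteq> B" "finite B"
    and fib: "\<And>b. b \<in> B \<Longrightarrow> real (card {x \<in> A. f x = b}) \<le> k"
  shows "real (card A) \<le> real (card B) * k"
proof -
  have "A = (\<Union>b\<in>B. {x \<in> A. f x = b})"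
    using assms(2) by auto
  then have "card A \<le> (\<Sum>b\<in>B. card {x \<in> A. f x = b})"
    using card_UN_le[OF assms(3), of "\<lambda>b. {x \<in> A. f x = b}"] by simp
  then have "real (card A) \<le> (\<Sum>b\<in>B. real (card {x \<in> A. f x = b}))"
    by (simp flip: of_nat_sum)
  also have "\<dots> \<le> (\<Sum>b\<in>B. k)"
    by (rule sum_mono) (rule fib)
  finally show ?thesis by simp
qed

lemma card_vec_set:
  fixes S :: "'k::finite \<Rightarrow> 'a set"
  shows "card {v :: 'a ^ 'k. \<forall>i. v $ i \<in> S i} = (\<Prod>i\<in>UNIV. card (S i))"
proof -
  have "{v :: 'a ^ 'k. \<forall>i. v $ i \<in> S i} = vec_lambda ` (Pi\<^sub>E UNIV S)"
  proof (intro set_eqI iffI)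
    fix v :: "'a ^ 'k" assume "v \<in> {v. \<forall>i. v $ i \<in> S i}"
    then have "v = vec_lambda (($) v)" "($) v \<in> Pi\<^sub>E UNIV S" by auto
    then show "v \<in> vec_lambda ` (Pi\<^sub>E UNIV S)" by blast
  qed (auto simp: PiE_iff)
  moreover have "inj_on (vec_lambda :: ('k \<Rightarrow> 'a) \<Rightarrow> 'a ^ 'k) (Pi\<^sub>E UNIV S)"
    by (auto simp: inj_on_def vec_lambda_inject)
  ultimately show ?thesis
    by (simp add: card_image card_PiE)
qed

lemma finite_vec_set:
  fixes S :: "'k::finite \<Rightarrow> 'a set"
  assumes "\<And>i. finite (S i)"
  shows "finite {v :: 'a ^ 'k. \<forall>i. v $ i \<in> S i}"
proof -
  have "{v :: 'a ^ 'k. \<forall>i. v $ i \<in> S i} \<subseteq> vec_lambda ` (Pi\<^sub>E UNIV S)"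
  proof
    fix v :: "'a ^ 'k" assume "v \<in> {v. \<forall>i. v $ i \<in> S i}"
    then have "v = vec_lambda (($) v)" "($) v \<in> Pi\<^sub>E UNIV S" by auto
    then show "v \<in> vec_lambda ` (Pi\<^sub>E UNIV S)" by blast
  qed
  then show ?thesis
    using assms by (meson finite finite_PiE finite_imageI finite_subset)
qed

lemma card_floor_range:
  fixes r :: real
  assumes "1 \<le> r"
  shows "real (card {\<lfloor>- r\<rfloor>..\<lfloor>r\<rfloor>}) \<le> 4 * r"
proof -
  have "real (card {\<lfloor>- r\<rfloor>..\<lfloor>r\<rfloor>}) = of_int (\<lfloor>r\<rfloor> + 1 - \<lfloor>- r\<rfloor>)"
    using floor_mono[of "-r" r] assms by (simp)
  then show ?thesis using assms by linarith
qed

lemma abs_det_le: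
  fixes B :: "real ^ 'k ^ 'k"
  assumes "\<And>i j. \<bar>B $ i $ j\<bar> \<le> r"
  shows "\<bar>det B\<bar> \<le> fact CARD('k) * r ^ CARD('k)"
proof -
  have "\<bar>det B\<bar> \<le> (\<Sum>p | p permutes (UNIV::'k set). \<bar>of_int (sign p) * (\<Prod>i\<in>UNIV. B $ i $ p i)\<bar>)"
    unfolding det_def by (rule sum_abs)
  also have "\<dots> \<le> (\<Sum>p | p permutes (UNIV::'k set). r ^ CARD('k))"
  proof (rule sum_mono)
    fix p :: "'k \<Rightarrow> 'k"
    have "(\<Prod>i\<in>UNIV. \<bar>B $ i $ p i\<bar>) \<le> (\<Prod>i\<in>(UNIV::'k set). r)"
      by (rule prod_mono) (use assms in auto)
    then show "\<bar>of_int (sign p) * (\<Prod>i\<in>UNIV. B $ i $ p i)\<bar> \<le> r ^ CARD('k)"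
      by (simp add: abs_mult abs_prod sign_def)
  qed
  also have "\<dots> = fact CARD('k) * r ^ CARD('k)"
    by (simp add: card_permutations)
  finally show ?thesis .
qed

section \<open>Short vectors of a lattice\<close>

text \<open>An additive injection \<open>u\<close> of an abelian group onto a discrete subgroup of \<open>real ^ 'd\<close>, all of whose
\<open>d\<close>-fold determinants are integers. Of unimodularity only this lower bound on covolumes of full-rank
sublattices is needed. Four facts about the number of lattice vectors in a cube follow: two
comparisons of \<open>cube r\<close> with \<open>cube 1\<close> for large \<open>r\<close>, one for small \<open>r\<close>, and the statement that a
lattice with very many vectors in \<open>cube 1\<close> has all its vectors of moderate length in one hyperplane.\<close>

locale unimodular_lattice =
  fixes u :: "'z::ab_group_add \<Rightarrow> real ^ 'd"
  assumes diff: "u (x - y) = u x - u y"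
    and inj: "u x = 0 \<Longrightarrow> x = 0"
    and finite_cube [simp]: "finite (sup_ball u r)"
    and det_int: "det (\<chi> i j. u (Z j) $ i) \<in> \<int>"
begin

abbreviation cube :: "real \<Rightarrow> 'z set" where
  "cube r \<equiv> sup_ball u r"

lemma u_zero [simp]: "u 0 = 0"
  using diff[of 0 0] by simp

lemma u_minus: "u (- x) = - u x"
  using diff[of 0 x] by simp

lemma u_add: "u (x + y) = u x + u y"
  using diff[of x "- y"] by (simp add: u_minus)

lemma u_inj: "u x = u y \<Longrightarrow> x = y"
  using inj[of "x - y"] diff[of x y] by simp

lemma zero_in_cube: "0 \<le> r \<Longrightarrow> 0 \<in> cube r"
  by (simp add: sup_ball_def)

lemma cube_mono: "r \<le> s \<Longrightarrow> cube r \<subseteq> cube s"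
  unfolding sup_ball_def using order_trans by blast

lemma card_cube_ge_1: "0 \<le> r \<Longrightarrow> 1 \<le> card (cube r)"
  using zero_in_cube[of r] by (metis One_nat_def Suc_leI card_gt_0_iff empty_iff finite_cube)

lemma card_cube_by_key:
  assumes key: "\<And>x y. x \<in> cube r \<Longrightarrow> y \<in> cube r \<Longrightarrow> f x = f y \<Longrightarrow> x - y \<in> cube 1"
    and ran: "f ` cube r \<subseteq> B" "finite B"
  shows "card (cube r) \<le> card B * card (cube 1)"
proof -
  have "real (card (cube r)) \<le> card B * real (card (cube 1))"
  proof (rule card_le_fibres[OF _ ran])
    fix b
    show "real (card {x \<in> cube r. f x = b}) \<le> real (card (cube 1))"
    proof (cases "{x \<in> cube r. f x = b} = {}")
      case False
      then obtain x0 where x0: "x0 \<in> cube r" "f x0 = b" by auto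
      have "(\<lambda>x. x - x0) ` {x \<in> cube r. f x = b} \<subseteq> cube 1"
        using key x0 by auto
      moreover have "inj_on (\<lambda>x. x - x0) {x \<in> cube r. f x = b}"
        by (auto simp: inj_on_def)
      ultimately have "card {x \<in> cube r. f x = b} \<le> card (cube 1)"
        by (intro card_inj_on_le) auto
      then show ?thesis by simp
    next
      case True
      then show ?thesis by (simp only: card.empty)
    qed
  qed simp
  then show ?thesis by (simp flip: of_nat_mult)
qed

lemma card_cube_le:
  assumes "1 \<le> r"
  shows "real (card (cube r)) \<le> (4 * r) ^ CARD('d) * real (card (cube 1))"
proof -
  let ?B = "{v :: int ^ 'd. \<forall>c. v $ c \<in> {\<lfloor>- r\<rfloor>..\<lfloor>r\<rfloor>}}"
  let ?f = "\<lambda>z. (\<chi> c. \<lfloor>u z $ c\<rfloor>) :: int ^ 'd"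
  have "card (cube r) \<le> card ?B * card (cube 1)"
  proof (rule card_cube_by_key[where f = ?f])
    fix x y assume "?f x = ?f y"
    then have "\<lfloor>u x $ c\<rfloor> = \<lfloor>u y $ c\<rfloor>" for c by (simp add: vec_eq_iff)
    then have "\<bar>u x $ c - u y $ c\<bar> \<le> 1" for c by (intro floor_eq_abs_diff)
    then show "x - y \<in> cube 1" by (simp add: sup_ball_def diff)
  next
    show "?f ` cube r \<subseteq> ?B"
    proof clarify
      fix x c assume "x \<in> cube r"
      then have "\<bar>u x $ c\<bar> \<le> r" by (simp add: sup_ball_def)
      then show "?f x $ c \<in> {\<lfloor>- r\<rfloor>..\<lfloor>r\<rfloor>}" by (auto intro!: floor_mono)
    qed
    show "finite ?B" by (rule finite_vec_set) auto
  qed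
  moreover have "real (card ?B) \<le> (4 * r) ^ CARD('d)"
    unfolding card_vec_set using card_floor_range[OF assms] by (simp only: prod_constant of_nat_power power_mono of_nat_0_le_iff)
  ultimately show ?thesis by (rule mult_of_nat_le)
qed

text \<open>When the lattice vectors of length at most \<open>r\<close> lie in a hyperplane, the doubling exponent of
\<open>card_cube_le\<close> drops by one: the coordinate in which the normal vector is largest is controlled by
the remaining ones. This gain of one power of \<open>r\<close> is what produces the contraction below.\<close>

lemma card_cube_le_hyperplane:
  assumes r: "1 \<le> r" and \<phi>: "\<phi> \<noteq> 0" and hyp: "\<And>z. z \<in> cube r \<Longrightarrow> (\<Sum>c\<in>UNIV. \<phi> $ c * u z $ c) = 0"
  shows "real (card (cube r)) \<le> (4 * real CARD('d) * r) ^ (CARD('d) - 1) * real (card (cube 1))"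
proof -
  define d where "d = real CARD('d)"
  have d1: "d \<ge> 1" unfolding d_def by (simp add: Suc_leI)
  obtain c0 where c0: "\<And>c. \<bar>\<phi> $ c\<bar> \<le> \<bar>\<phi> $ c0\<bar>"
    using ex_max_coord[of "\<lambda>c. \<bar>\<phi> $ c\<bar>"] by blast
  have c0pos: "\<bar>\<phi> $ c0\<bar> > 0"
  proof (rule ccontr)
    assume "\<not> \<bar>\<phi> $ c0\<bar> > 0"
    then have "\<phi> $ c = 0" for c using c0[of c] by simp
    then show False using \<phi> by (simp add: vec_eq_iff)
  qed
  define S where "S c = (if c = c0 then {0} else {\<lfloor>- (d * r)\<rfloor>..\<lfloor>d * r\<rfloor>})" for c
  let ?B = "{v :: int ^ 'd. \<forall>c. v $ c \<in> S c}"
  let ?f = "\<lambda>z. (\<chi> c. if c = c0 then 0 else \<lfloor>d * u z $ c\<rfloor>) :: int ^ 'd"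
  have dr: "1 \<le> d * r" using d1 r by (simp add: mult_ge1_I)
  have "card (cube r) \<le> card ?B * card (cube 1)"
  proof (rule card_cube_by_key[where f = ?f])
    fix x y assume xy: "x \<in> cube r" "y \<in> cube r" and eq: "?f x = ?f y"
    have e: "\<bar>u x $ c - u y $ c\<bar> \<le> 1 / d" if "c \<noteq> c0" for c
    proof -
      have "\<lfloor>d * u x $ c\<rfloor> = \<lfloor>d * u y $ c\<rfloor>"
        using arg_cong[OF eq, of "\<lambda>v. v $ c"] that by simp
      then have "\<bar>d * u x $ c - d * u y $ c\<bar> \<le> 1" by (rule floor_eq_abs_diff)
      then have "d * \<bar>u x $ c - u y $ c\<bar> \<le> 1"
        using d1 by (simp flip: right_diff_distrib add: abs_mult)
      then show ?thesis using d1 by (simp add: field_simps)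
    qed
    have "(\<Sum>c\<in>UNIV. \<phi> $ c * (u x $ c - u y $ c)) = 0"
      using hyp[OF xy(1)] hyp[OF xy(2)] by (simp add: right_diff_distrib sum_subtractf)
    moreover have "(\<Sum>c\<in>UNIV. \<phi> $ c * (u x $ c - u y $ c))
        = \<phi> $ c0 * (u x $ c0 - u y $ c0) + (\<Sum>c\<in>UNIV - {c0}. \<phi> $ c * (u x $ c - u y $ c))"
      by (rule sum.remove) auto
    ultimately have "\<phi> $ c0 * (u x $ c0 - u y $ c0) = - (\<Sum>c\<in>UNIV - {c0}. \<phi> $ c * (u x $ c - u y $ c))"
      by linarith
    then have "\<bar>\<phi> $ c0\<bar> * \<bar>u x $ c0 - u y $ c0\<bar> = \<bar>\<Sum>c\<in>UNIV - {c0}. \<phi> $ c * (u x $ c - u y $ c)\<bar>"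
      unfolding abs_mult[symmetric] by (simp only: abs_minus_cancel)
    also have "\<dots> \<le> (\<Sum>c\<in>UNIV - {c0}. \<bar>\<phi> $ c * (u x $ c - u y $ c)\<bar>)"
      by (rule sum_abs)
    also have "\<dots> \<le> (\<Sum>c\<in>UNIV - {c0}. \<bar>\<phi> $ c0\<bar> * (1 / d))"
      unfolding abs_mult by (intro sum_mono mult_mono c0 e) auto
    also have "\<dots> = \<bar>\<phi> $ c0\<bar> * ((d - 1) / d)"
      using d1 by (simp add: d_def card_Diff_singleton of_nat_diff Suc_leI)
    also have "\<dots> \<le> \<bar>\<phi> $ c0\<bar> * 1"
      using d1 by (intro mult_left_mono) auto
    finally have "\<bar>u x $ c0 - u y $ c0\<bar> \<le> 1" using c0pos by simp
    moreover have "1 / d \<le> 1" using d1 by simp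
    ultimately have "\<bar>u x $ c - u y $ c\<bar> \<le> 1" for c
      using e[of c] by (cases "c = c0") auto
    then show "x - y \<in> cube 1" by (simp add: sup_ball_def diff)
  next
    show "?f ` cube r \<subseteq> ?B"
    proof clarify
      fix x c assume "x \<in> cube r"
      then have "\<bar>u x $ c\<bar> \<le> r" by (simp add: sup_ball_def)
      then have "d * u x $ c \<le> d * r" "d * (- r) \<le> d * u x $ c"
        using d1 by (intro mult_left_mono; simp add: abs_le_iff)+
      then show "?f x $ c \<in> S c" by (auto simp: S_def intro!: floor_mono)
    qed
    show "finite ?B" by (rule finite_vec_set) (auto simp: S_def)
  qed
  moreover have "real (card ?B) \<le> (4 * d * r) ^ (CARD('d) - 1)"
  proof -
    have "real (card ?B) = (\<Prod>c\<in>UNIV. real (card (S c)))"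
      by (simp add: card_vec_set)
    also have "\<dots> = (\<Prod>c\<in>UNIV - {c0}. real (card (S c)))"
    proof -
      have "(\<Prod>c\<in>UNIV. real (card (S c))) = real (card (S c0)) * (\<Prod>c\<in>UNIV - {c0}. real (card (S c)))"
        by (rule prod.remove) auto
      then show ?thesis by (simp add: S_def)
    qed
    also have "\<dots> \<le> (\<Prod>c\<in>UNIV - {c0}. 4 * d * r)"
      using card_floor_range[OF dr] by (intro prod_mono) (auto simp: S_def)
    also have "\<dots> = (4 * d * r) ^ (CARD('d) - 1)"
      by (simp add: card_Diff_singleton)
    finally show ?thesis .
  qed
  ultimately show ?thesis unfolding d_def by (rule mult_of_nat_le)
qed

lemma u_of_nat_mult: "\<exists>y. u y = of_nat k *\<^sub>R u x"
proof (induction k)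
  case 0 show ?case by (rule exI[of _ 0]) simp
next
  case (Suc k)
  then obtain y where "u y = of_nat k *\<^sub>R u x" by blast
  then have "u (y + x) = of_nat (Suc k) *\<^sub>R u x" by (simp add: u_add algebra_simps)
  then show ?case by blast
qed

text \<open>Shrinking the cube: a nonzero vector in \<open>cube \<theta>\<close> has a multiple \<open>x\<close> of length between \<open>2\<theta>\<close> and
\<open>3\<theta>\<close>, and the translates of \<open>cube \<theta>\<close> by multiples of \<open>x\<close> are disjoint, with about \<open>1 / (3\<theta>)\<close> of
them inside \<open>cube 1\<close>.\<close>

lemma card_cube_small:
  assumes \<theta>: "0 < \<theta>" "\<theta> \<le> 1 / 4"
  shows "real (card (cube \<theta>)) \<le> 1 + 4 * \<theta> * real (card (cube 1))"
proof (cases "cube \<theta> \<subseteq> {0}")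
  case True
  then have "card (cube \<theta>) \<le> 1" by (metis card.empty card_insert_disjoint card_mono empty_iff finite.intros One_nat_def)
  then show ?thesis using \<theta> by (simp add: add_increasing2)
next
  case False
  then obtain v where v: "v \<in> cube \<theta>" "v \<noteq> 0" by auto
  obtain c0 where c0: "\<And>c. \<bar>u v $ c\<bar> \<le> \<bar>u v $ c0\<bar>"
    using ex_max_coord[of "\<lambda>c. \<bar>u v $ c\<bar>"] by blast
  define t where "t = \<bar>u v $ c0\<bar>"
  have t: "t > 0"
  proof (rule ccontr)
    assume "\<not> t > 0"
    then have "u v $ c = 0" for c using c0[of c] by (simp add: t_def)
    then show False using inj[of v] v(2) by (simp add: vec_eq_iff)
  qed
  have t\<theta>: "t \<le> \<theta>" using v by (simp add: t_def sup_ball_def)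
  define k where "k = nat \<lfloor>2 * \<theta> / t\<rfloor> + 1"
  have "real k = of_int \<lfloor>2 * \<theta> / t\<rfloor> + 1" using \<theta> t by (simp add: k_def)
  then have "2 * \<theta> / t < real k" "real k \<le> 2 * \<theta> / t + 1" by linarith+
  then have k: "2 * \<theta> < real k * t" "real k * t \<le> 3 * \<theta>"
    using t t\<theta> by (auto simp: field_simps)
  obtain x where x: "u x = of_nat k *\<^sub>R u v" using u_of_nat_mult by blast
  have xb: "\<bar>u x $ c\<bar> \<le> 3 * \<theta>" for c
  proof -
    have "\<bar>u x $ c\<bar> = real k * \<bar>u v $ c\<bar>" by (simp add: x abs_mult)
    also have "\<dots> \<le> real k * t" using c0[of c] by (simp add: t_def mult_left_mono)
    finally show ?thesis using k by simp
  qed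
  have x0: "2 * \<theta> < \<bar>u x $ c0\<bar>" using k by (simp add: x abs_mult t_def)
  define J where "J = nat \<lfloor>(1 - \<theta>) / (3 * \<theta>)\<rfloor>"
  have "real J = of_int \<lfloor>(1 - \<theta>) / (3 * \<theta>)\<rfloor>" using \<theta> by (simp add: J_def)
  then have J1: "real J \<le> (1 - \<theta>) / (3 * \<theta>)" and J2: "(1 - \<theta>) / (3 * \<theta>) \<le> real J + 1" by linarith+
  have J3: "\<theta> + real J * (3 * \<theta>) \<le> 1" using J1 \<theta> by (simp add: field_simps)
  have J4: "1 \<le> 4 * \<theta> * (real J + 1)" using J2 \<theta> by (simp add: field_simps)
  have "\<forall>j. \<exists>y. u y = of_nat j *\<^sub>R u x" using u_of_nat_mult by blast
  then obtain g where g: "\<And>j. u (g j) = of_nat j *\<^sub>R u x" by metis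
  have "inj_on (\<lambda>(s, j). s + g j) (cube \<theta> \<times> {..J})"
  proof (rule inj_onI, clarify)
    fix s j s' j'
    assume s: "s \<in> cube \<theta>" "s' \<in> cube \<theta>" and eq: "s + g j = s' + g j'"
    have "u s + u (g j) = u s' + u (g j')" using eq by (metis u_add)
    then have eq2: "(real j - real j') * (u x $ c0) = u s' $ c0 - u s $ c0"
      by (simp add: g vec_eq_iff algebra_simps)
    have "\<bar>real j - real j'\<bar> * \<bar>u x $ c0\<bar> \<le> 2 * \<theta>"
    proof -
      have "\<bar>u s $ c0\<bar> \<le> \<theta>" "\<bar>u s' $ c0\<bar> \<le> \<theta>" using s by (auto simp: sup_ball_def)
      then have "\<bar>u s' $ c0 - u s $ c0\<bar> \<le> 2 * \<theta>" by linarith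
      then show ?thesis using eq2 by (metis abs_mult)
    qed
    have "j = j'"
    proof (rule ccontr)
      assume "j \<noteq> j'"
      then have "1 \<le> \<bar>real j - real j'\<bar>" by linarith
      then have "1 * \<bar>u x $ c0\<bar> \<le> \<bar>real j - real j'\<bar> * \<bar>u x $ c0\<bar>" by (intro mult_right_mono) auto
      then show False using \<open>\<bar>real j - real j'\<bar> * \<bar>u x $ c0\<bar> \<le> 2 * \<theta>\<close> x0 by simp
    qed
    then show "s = s' \<and> j = j'" using eq by simp
  qed
  moreover have "(\<lambda>(s, j). s + g j) ` (cube \<theta> \<times> {..J}) \<subseteq> cube 1"
  proof clarify
    fix s j assume s: "s \<in> cube \<theta>" "j \<le> J"
    have "\<bar>u (s + g j) $ c\<bar> \<le> 1" for c
    proof -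
      have "\<bar>u (s + g j) $ c\<bar> \<le> \<bar>u s $ c\<bar> + real j * \<bar>u x $ c\<bar>"
        using abs_triangle_ineq[of "u s $ c" "real j * u x $ c"] by (simp add: u_add g abs_mult)
      also have "\<dots> \<le> \<theta> + real J * (3 * \<theta>)"
        using s xb[of c] by (intro add_mono mult_mono) (auto simp: sup_ball_def)
      finally show ?thesis using J3 by simp
    qed
    then show "s + g j \<in> cube 1" by (simp add: sup_ball_def)
  qed
  ultimately have "card (cube \<theta> \<times> {..J}) \<le> card (cube 1)"
    by (metis card_inj_on_le finite_cube)
  then have "real (card (cube \<theta>)) * (real J + 1) \<le> real (card (cube 1))"
  proof -
    assume "card (cube \<theta> \<times> {..J}) \<le> card (cube 1)"
    then have "real (card (cube \<theta>) * Suc J) \<le> real (card (cube 1))"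
      by (simp only: card_cartesian_product card_atMost of_nat_le_iff)
    then show ?thesis by (simp add: algebra_simps)
  qed
  then have "4 * \<theta> * (real (card (cube \<theta>)) * (real J + 1)) \<le> 4 * \<theta> * real (card (cube 1))"
    using \<theta> by (intro mult_left_mono) auto
  moreover have "real (card (cube \<theta>)) * 1 \<le> real (card (cube \<theta>)) * (4 * \<theta> * (real J + 1))"
    using J4 by (intro mult_left_mono) auto
  ultimately show ?thesis by (simp add: algebra_simps)
qed

text \<open>If the vectors in \<open>cube r\<close> spanned, then by Cramer's rule a vector in \<open>cube 1\<close> would be determined by
\<open>d\<close> determinants, which are integers of bounded size; so \<open>cube 1\<close> would be small.\<close>

lemma hyperplane_of_many_short:
  assumes r: "1 \<le> r"
    and many: "(2 * (fact CARD('d) * r ^ CARD('d)) + 1) ^ CARD('d) < real (card (cube 1))"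
  obtains \<phi> :: "real ^ 'd" where "\<phi> \<noteq> 0" "\<And>z. z \<in> cube r \<Longrightarrow> (\<Sum>c\<in>UNIV. \<phi> $ c * u z $ c) = 0"
proof -
  have "span (u ` cube r) \<noteq> UNIV"
  proof
    assume span: "span (u ` cube r) = UNIV"
    obtain B where B: "B \<subseteq> u ` cube r" "independent B" "span B = UNIV"
      using maximal_independent_subset[of "u ` cube r"] span
      by (metis span_mono span_span top.extremum_uniqueI)
    have cardB: "card B = CARD('d)"
      using B dim_eq_card[of B UNIV] by (simp add: dim_UNIV)
    have finB: "finite B" using B(2) independent_imp_finite by blast
    obtain e where e: "bij_betw e (UNIV :: 'd set) B"
      using finite_same_card_bij[of "UNIV :: 'd set" B] finB cardB by auto
    have "\<forall>j. \<exists>z. z \<in> cube r \<and> u z = e j"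
      using e B(1) by (metis bij_betw_apply UNIV_I imageE subsetD)
    then obtain Z where Z: "\<And>j. Z j \<in> cube r" "\<And>j. u (Z j) = e j" by metis
    define E :: "real ^ 'd ^ 'd" where "E = (\<chi> i j. u (Z j) $ i)"
    have "columns E = B"
    proof -
      have "column j E = e j" for j by (simp add: column_def E_def Z vec_eq_iff)
      then show ?thesis using e by (auto simp: columns_def bij_betw_def)
    qed
    then have "span (columns E) = UNIV" using B(3) by simp
    then have detE: "det E \<noteq> 0"
      using matrix_right_invertible_span_columns[of E] invertible_right_inverse[of E] invertible_det_nz[of E]
      by (simp add: span_vec_eq)
    define F where "F x k = det (\<chi> i j. if j = k then u x $ i else E $ i $ j)" for x k
    have F_eq: "F x k = det (\<chi> i j. u ((Z(k := x)) j) $ i)" for x k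
      unfolding F_def E_def by (rule arg_cong[of _ _ det]) (simp add: vec_eq_iff)
    have F_int: "F x k \<in> \<int>" for x k unfolding F_eq by (rule det_int)
    define R where "R = fact CARD('d) * r ^ CARD('d)"
    have R0: "R \<ge> 0" using r by (simp add: R_def)
    have F_le: "\<bar>F x k\<bar> \<le> R" if "x \<in> cube 1" for x k
      unfolding F_eq R_def
    proof (rule abs_det_le)
      fix i j
      show "\<bar>(\<chi> i j. u ((Z(k := x)) j) $ i) $ i $ j\<bar> \<le> r"
        using that Z(1)[of j] r by (auto simp: sup_ball_def intro: order_trans)
    qed
    define S where "S = {\<lceil>- R\<rceil>..\<lfloor>R\<rfloor>}"
    define f where "f x = (\<chi> k. \<lfloor>F x k\<rfloor>)" for x
    have inj_f: "inj_on f (cube 1)"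
    proof (rule inj_onI)
      fix x y assume "f x = f y"
      then have "\<lfloor>F x k\<rfloor> = \<lfloor>F y k\<rfloor>" for k by (simp add: f_def vec_eq_iff)
      then have FF: "F x k = F y k" for k
        using F_int[of x k] F_int[of y k] by (metis Ints_cases floor_of_int)
      have "E *v (\<chi> k. F x k / det E) = u x"
        using cramer[OF detE, of "\<chi> k. F x k / det E" "u x"] by (simp add: F_def)
      moreover have "E *v (\<chi> k. F y k / det E) = u y"
        using cramer[OF detE, of "\<chi> k. F y k / det E" "u y"] by (simp add: F_def)
      ultimately have "u x = u y" using FF by simp
      then show "x = y" by (rule u_inj)
    qed
    have "f ` cube 1 \<subseteq> {v :: int ^ 'd. \<forall>k. v $ k \<in> S}"
    proof clarify
      fix x k assume "x \<in> cube 1"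
      then have "\<bar>F x k\<bar> \<le> R" by (rule F_le)
      moreover have "F x k = of_int \<lfloor>F x k\<rfloor>" using F_int[of x k] by (metis Ints_cases floor_of_int)
      ultimately show "f x $ k \<in> S" by (auto simp: S_def f_def floor_mono ceiling_le_iff)
    qed
    then have "card (cube 1) \<le> card {v :: int ^ 'd. \<forall>k. v $ k \<in> S}"
      by (intro card_inj_on_le[OF inj_f] finite_vec_set) (auto simp: S_def)
    then have "real (card (cube 1)) \<le> real (card S) ^ CARD('d)"
      by (simp add: card_vec_set flip: of_nat_power)
    also have "\<dots> \<le> (2 * R + 1) ^ CARD('d)"
      using R0 by (intro power_mono) (auto simp: S_def, linarith)
    finally show False using many by (simp add: R_def)
  qed
  then obtain a where a: "a \<noteq> 0" "\<forall>x\<in>span (u ` cube r). a \<bullet> x = 0"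
    using span_not_UNIV_orthogonal by blast
  show ?thesis
  proof (rule that[OF a(1)])
    fix z assume "z \<in> cube r"
    then have "a \<bullet> u z = 0" using a(2) by (meson imageI span_base)
    then show "(\<Sum>c\<in>UNIV. a $ c * u z $ c) = 0" by (simp only: inner_vec_def inner_real_def)
  qed
qed

end

section \<open>The lattice of a matrix\<close>

text \<open>The embedding of integer vectors into real vectors.\<close>

definition rvec :: "int ^ 'k \<Rightarrow> real ^ 'k" where
  "rvec q = (\<chi> j. of_int (q $ j))"

lemma rvec_nth [simp]: "rvec q $ j = of_int (q $ j)"
  by (simp add: rvec_def)

lemma rvec_diff: "rvec (x - y) = rvec x - rvec y"
  by (simp add: vec_eq_iff)

lemma rvec_add: "rvec (x + y) = rvec x + rvec y"
  by (simp add: vec_eq_iff)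

text \<open>The lattice attached to the matrix \<open>A\<close> at level \<open>i\<close>, parametrised by \<open>z = (p, q)\<close>: the vector
\<open>(A q - p, q)\<close> with its first block expanded by \<open>W ^ (n i)\<close> and its second block contracted by
\<open>W ^ (m i)\<close>, where \<open>m\<close> and \<open>n\<close> are the numbers of rows and columns. The two scalings have
determinant \<open>1\<close>. Short vectors at level \<open>i\<close> are the \<open>q\<close> of size at most \<open>W ^ (m i)\<close> for which \<open>A q\<close> is within
\<open>W ^ (- n i)\<close> of an integer vector.\<close>

definition lat :: "nat \<Rightarrow> nat \<Rightarrow> real ^ 'n ^ 'm \<Rightarrow> (int ^ 'm) \<times> (int ^ 'n) \<Rightarrow> real ^ ('m + 'n)" where
  "lat W i A z = (\<chi> c. case c of
       Inl a \<Rightarrow> real W ^ (CARD('n) * i) * ((A *v rvec (snd z)) $ a - of_int (fst z $ a))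
     | Inr b \<Rightarrow> of_int (snd z $ b) / real W ^ (CARD('m) * i))"

lemma in_lat_ball_iff:
  fixes A :: "real ^ 'n ^ 'm"
  assumes "W > 0"
  shows "z \<in> sup_ball (lat W i A) r \<longleftrightarrow>
    (\<forall>a. real W ^ (CARD('n) * i) * \<bar>(A *v rvec (snd z)) $ a - of_int (fst z $ a)\<bar> \<le> r) \<and>
    (\<forall>b. \<bar>of_int (snd z $ b)\<bar> \<le> r * real W ^ (CARD('m) * i))"
proof -
  have "z \<in> sup_ball (lat W i A) r \<longleftrightarrow>
     (\<forall>a. \<bar>lat W i A z $ Inl a\<bar> \<le> r) \<and> (\<forall>b. \<bar>lat W i A z $ Inr b\<bar> \<le> r)"
    unfolding sup_ball_def by (auto simp: split_sum_all)
  then show ?thesis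
    using assms by (simp add: lat_def abs_mult pos_divide_le_eq)
qed

lemma finite_lat_ball:
  fixes A :: "real ^ 'n ^ 'm"
  assumes W: "W > 0"
  shows "finite (sup_ball (lat W i A) r)"
proof -
  define R where "R = r * real W ^ (CARD('m) * i)"
  define K where "K a = \<bar>r\<bar> + (\<Sum>b\<in>UNIV. \<bar>A $ a $ b\<bar> * R)" for a
  let ?P = "{p :: int ^ 'm. \<forall>a. p $ a \<in> {\<lceil>- K a\<rceil>..\<lfloor>K a\<rfloor>}}"
  let ?Q = "{q :: int ^ 'n. \<forall>b. q $ b \<in> {\<lceil>- R\<rceil>..\<lfloor>R\<rfloor>}}"
  have "sup_ball (lat W i A) r \<subseteq> ?P \<times> ?Q"
  proof
    fix z assume z: "z \<in> sup_ball (lat W i A) r"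
    have q: "\<bar>of_int (snd z $ b)\<bar> \<le> R" for b
      using z W by (simp add: in_lat_ball_iff R_def)
    have p: "\<bar>of_int (fst z $ a)\<bar> \<le> K a" for a
    proof -
      let ?t = "(A *v rvec (snd z)) $ a"
      have "1 * \<bar>?t - of_int (fst z $ a)\<bar> \<le> real W ^ (CARD('n) * i) * \<bar>?t - of_int (fst z $ a)\<bar>"
        using W by (intro mult_right_mono one_le_power) auto
      also have "\<dots> \<le> r" using z W by (simp add: in_lat_ball_iff)
      finally have "\<bar>?t - of_int (fst z $ a)\<bar> \<le> \<bar>r\<bar>" by simp
      moreover have "\<bar>?t\<bar> \<le> (\<Sum>b\<in>UNIV. \<bar>A $ a $ b\<bar> * R)"
      proof -
        have "\<bar>?t\<bar> \<le> (\<Sum>b\<in>UNIV. \<bar>A $ a $ b * of_int (snd z $ b)\<bar>)"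
          by (simp add: matrix_vector_mult_def sum_abs)
        also have "\<dots> \<le> (\<Sum>b\<in>UNIV. \<bar>A $ a $ b\<bar> * R)"
          unfolding abs_mult by (intro sum_mono mult_left_mono q) auto
        finally show ?thesis .
      qed
      ultimately show ?thesis unfolding K_def by linarith
    qed
    have "fst z $ a \<in> {\<lceil>- K a\<rceil>..\<lfloor>K a\<rfloor>}" for a
      using p[of a] by (simp add: le_floor_iff ceiling_le_iff abs_le_iff minus_le_iff)
    moreover have "snd z $ b \<in> {\<lceil>- R\<rceil>..\<lfloor>R\<rfloor>}" for b
      using q[of b] by (simp add: le_floor_iff ceiling_le_iff abs_le_iff minus_le_iff)
    ultimately show "z \<in> ?P \<times> ?Q" by (auto simp: mem_Times_iff)
  qed
  moreover have "finite (?P \<times> ?Q)"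
    by (intro finite_cartesian_product finite_vec_set) auto
  ultimately show ?thesis by (rule finite_subset)
qed

lemma prod_UNIV_sum:
  fixes f :: "'a::finite + 'b::finite \<Rightarrow> real"
  shows "(\<Prod>c\<in>UNIV. f c) = (\<Prod>a\<in>UNIV. f (Inl a)) * (\<Prod>b\<in>UNIV. f (Inr b))"
proof -
  have "(\<Prod>c\<in>UNIV. f c) = (\<Prod>c\<in>UNIV <+> UNIV. f c)" by simp
  also have "\<dots> = (\<Prod>a\<in>UNIV. f (Inl a)) * (\<Prod>b\<in>UNIV. f (Inr b))"
    by (subst prod.Plus) (auto simp: o_def)
  finally show ?thesis .
qed

lemma sum_UNIV_sum:
  fixes f :: "'a::finite + 'b::finite \<Rightarrow> real"
  shows "(\<Sum>c\<in>UNIV. f c) = (\<Sum>a\<in>UNIV. f (Inl a)) + (\<Sum>b\<in>UNIV. f (Inr b))"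
proof -
  have "(\<Sum>c\<in>UNIV. f c) = (\<Sum>c\<in>UNIV <+> UNIV. f c)" by simp
  also have "\<dots> = (\<Sum>a\<in>UNIV. f (Inl a)) + (\<Sum>b\<in>UNIV. f (Inr b))"
    by (subst sum.Plus) (auto simp: o_def)
  finally show ?thesis .
qed

text \<open>The lattice is the image of the integer vectors under a diagonal matrix of determinant \<open>1\<close> composed
with the map sending \<open>(p, q)\<close> to \<open>(A q - p, q)\<close>. The sign makes the latter an involution, so its
determinant is \<open>1\<close> or \<open>-1\<close>.\<close>

lemma det_lat_int:
  fixes A :: "real ^ 'n ^ 'm"
  assumes W: "W > 0"
  shows "det (\<chi> i' j. lat W i A (Z j) $ i') \<in> \<int>"
proof -
  define D :: "real ^ ('m + 'n) ^ ('m + 'n)" where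
    "D = (\<chi> c e. if c = e then case c of Inl a \<Rightarrow> real W ^ (CARD('n) * i) | Inr b \<Rightarrow> 1 / real W ^ (CARD('m) * i) else 0)"
  define U :: "real ^ ('m + 'n) ^ ('m + 'n)" where
    "U = (\<chi> c e. case c of Inl a \<Rightarrow> (case e of Inl a' \<Rightarrow> if a' = a then -1 else 0 | Inr b \<Rightarrow> A $ a $ b)
                   | Inr b \<Rightarrow> (case e of Inl a \<Rightarrow> 0 | Inr b' \<Rightarrow> if b' = b then 1 else 0))"
  define V :: "real ^ ('m + 'n) ^ ('m + 'n)" where
    "V = (\<chi> c j. case c of Inl a \<Rightarrow> of_int (fst (Z j) $ a) | Inr b \<Rightarrow> of_int (snd (Z j) $ b))"
  have detD: "det D = 1"
  proof -
    have "det D = (\<Prod>c\<in>UNIV. D $ c $ c)"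
      by (rule det_diagonal) (simp add: D_def)
    also have "\<dots> = (real W ^ (CARD('n) * i)) ^ CARD('m) * (1 / real W ^ (CARD('m) * i)) ^ CARD('n)"
      by (simp add: prod_UNIV_sum D_def)
    also have "\<dots> = 1"
      using W by (simp add: power_one_over power_mult[symmetric] mult.assoc mult.commute mult.left_commute)
    finally show ?thesis .
  qed
  have UU: "U ** U = mat 1"
  proof -
    have "(U ** U) $ c $ e = (mat 1 :: real ^ ('m + 'n) ^ ('m + 'n)) $ c $ e" for c e
      by (cases c; cases e)
         (simp_all add: matrix_matrix_mult_def U_def mat_def sum_UNIV_sum if_distrib if_distribR
            sum.delta' cong: if_cong)
    then show ?thesis by (simp add: vec_eq_iff)
  qed
  have detU: "det U \<in> \<int>"
  proof -
    have "det U * det U = 1" using UU by (metis det_I det_mul)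
    then have "det U = 1 \<or> det U = -1" by (simp add: square_eq_1_iff)
    then show ?thesis by auto
  qed
  have detV: "det V \<in> \<int>"
    unfolding det_def by (intro Ints_sum Ints_mult Ints_prod Ints_of_int) (auto simp: V_def split: sum.split)
  have "(\<chi> i' j. lat W i A (Z j) $ i') = D ** (U ** V)"
  proof -
    have UV: "(U ** V) $ c $ j = (case c of Inl a \<Rightarrow> (A *v rvec (snd (Z j))) $ a - of_int (fst (Z j) $ a)
          | Inr b \<Rightarrow> of_int (snd (Z j) $ b))" for c j
      by (cases c)
         (simp_all add: matrix_matrix_mult_def U_def V_def sum_UNIV_sum matrix_vector_mult_def if_distrib if_distribR
            sum.delta' cong: if_cong)
    have "(D ** (U ** V)) $ c $ j = D $ c $ c * (U ** V) $ c $ j" for c j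
    proof -
      have "(D ** (U ** V)) $ c $ j = (\<Sum>k\<in>UNIV. D $ c $ k * (U ** V) $ k $ j)"
        by (simp add: matrix_matrix_mult_def)
      also have "\<dots> = (\<Sum>k\<in>UNIV. if k = c then D $ c $ c * (U ** V) $ c $ j else 0)"
        by (intro sum.cong) (auto simp: D_def)
      finally show ?thesis by simp
    qed
    then show ?thesis
      unfolding vec_eq_iff by (auto simp: UV lat_def D_def split: sum.split)
  qed
  then show ?thesis using detD detU detV by (simp add: det_mul Ints_mult)
qed

lemma unimodular_lattice_lat:
  fixes A :: "real ^ 'n ^ 'm"
  assumes W: "W > 0"
  shows "unimodular_lattice (lat W i A)"
proof
  fix x y :: "(int ^ 'm) \<times> (int ^ 'n)"
  show "lat W i A (x - y) = lat W i A x - lat W i A y"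
    by (simp add: lat_def vec_eq_iff rvec_diff matrix_vector_mult_diff_distrib right_diff_distrib diff_divide_distrib split: sum.split)
next
  fix x :: "(int ^ 'm) \<times> (int ^ 'n)"
  assume "lat W i A x = 0"
  then have *: "lat W i A x $ c = 0" for c by simp
  have "snd x $ b = 0" for b using *[of "Inr b"] W by (simp add: lat_def)
  then have q: "snd x = 0" by (simp add: vec_eq_iff)
  then have "rvec (snd x) = 0" by (simp add: vec_eq_iff)
  then have "fst x $ a = 0" for a using *[of "Inl a"] W by (simp add: lat_def)
  then have "fst x = 0" by (simp add: vec_eq_iff)
  with q show "x = 0" by (simp add: prod_eq_iff)
qed (simp_all add: W finite_lat_ball det_lat_int)

text \<open>Integer vectors with all entries in \<open>{0..<L}\<close>.\<close>

definition int_box :: "nat \<Rightarrow> (int ^ 'k) set" where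
  "int_box L = {v. \<forall>i. v $ i \<in> {0..<int L}}"

text \<open>Integer matrices with all entries in \<open>{0..<L}\<close>.\<close>

definition mat_box :: "nat \<Rightarrow> (int ^ 'n ^ 'm) set" where
  "mat_box L = {D. \<forall>a. D $ a \<in> int_box L}"

lemma finite_int_box [simp]: "finite (int_box L)"
  unfolding int_box_def by (rule finite_vec_set) auto

lemma card_int_box: "card (int_box L :: (int ^ 'k) set) = L ^ CARD('k)"
  unfolding int_box_def card_vec_set by simp

lemma finite_mat_box [simp]: "finite (mat_box L)"
  unfolding mat_box_def by (rule finite_vec_set) auto

lemma card_mat_box: "card (mat_box L :: (int ^ 'n ^ 'm) set) = L ^ (CARD('m) * CARD('n))"
  unfolding mat_box_def card_vec_set by (simp add: card_int_box power_mult[symmetric] mult.commute)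

lemma card_linear_window:
  fixes c x R :: real
  assumes x: "x \<noteq> 0" and R: "0 \<le> R"
  shows "finite {t :: int. \<bar>c + of_int t * x\<bar> \<le> R}" (is "finite ?S")
    and "real (card {t :: int. \<bar>c + of_int t * x\<bar> \<le> R}) \<le> 2 * R / \<bar>x\<bar> + 1"
proof -
  define y where "y = - c / x"
  define s where "s = R / \<bar>x\<bar>"
  have s: "s \<ge> 0" using R by (simp add: s_def)
  have "?S \<subseteq> {\<lceil>y - s\<rceil>..\<lfloor>y + s\<rfloor>}"
  proof clarify
    fix t :: int assume t: "\<bar>c + of_int t * x\<bar> \<le> R"
    have "c + of_int t * x = (of_int t - y) * x" using x by (simp add: y_def field_simps)
    then have "\<bar>of_int t - y\<bar> * \<bar>x\<bar> \<le> R" using t by (simp add: abs_mult)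
    then have "\<bar>of_int t - y\<bar> \<le> s" using x by (simp add: s_def pos_le_divide_eq)
    then show "t \<in> {\<lceil>y - s\<rceil>..\<lfloor>y + s\<rfloor>}" by (auto simp: le_floor_iff ceiling_le_iff)
  qed
  then show "finite ?S" by (rule finite_subset) simp
  have "card ?S \<le> card {\<lceil>y - s\<rceil>..\<lfloor>y + s\<rfloor>}"
    by (intro card_mono) (use \<open>?S \<subseteq> _\<close> in auto)
  moreover have "real (card {\<lceil>y - s\<rceil>..\<lfloor>y + s\<rfloor>}) \<le> 2 * s + 1"
    using s by simp linarith
  ultimately show "real (card ?S) \<le> 2 * R / \<bar>x\<bar> + 1" by (simp add: s_def)
qed

text \<open>Among the rows \<open>r\<close> with entries in \<open>{0..<M}\<close>, the condition that \<open>r \<bullet> q\<close> lie in a given interval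
leaves few choices for the entry at \<open>b0\<close> once all other entries are fixed.\<close>

lemma card_row_window:
  fixes q :: "int ^ 'n"
  assumes q: "q $ b0 \<noteq> 0" and R: "0 \<le> R"
  shows "real (card {r \<in> (int_box M :: (int ^ 'n) set). \<bar>c + (\<Sum>b\<in>UNIV. of_int (r $ b) * of_int (q $ b))\<bar> \<le> R})
     \<le> real M ^ (CARD('n) - 1) * (2 * R / \<bar>of_int (q $ b0)\<bar> + 1)"
    (is "real (card ?A) \<le> _")
proof -
  let ?f = "\<lambda>r. (\<chi> b. if b = b0 then 0 else r $ b) :: int ^ 'n"
  let ?B = "{v :: int ^ 'n. \<forall>b. v $ b \<in> (if b = b0 then {0} else {0..<int M})}"
  have cB: "real (card ?B) = real M ^ (CARD('n) - 1)"
  proof -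
    have "card ?B = (\<Prod>b\<in>UNIV. card (if b = b0 then {0} else {0..<int M}))"
      by (rule card_vec_set)
    also have "\<dots> = card (if b0 = b0 then {0} else {0..<int M}) * (\<Prod>b\<in>UNIV - {b0}. card (if b = b0 then {0} else {0..<int M}))"
      by (rule prod.remove) auto
    also have "\<dots> = (\<Prod>b\<in>UNIV - {b0}. M)"
    proof -
      have "(\<Prod>b\<in>UNIV - {b0}. card (if b = b0 then {0} else {0..<int M})) = (\<Prod>b\<in>UNIV - {b0}. M)"
        by (rule prod.cong) auto
      then show ?thesis by (simp del: prod_constant)
    qed
    also have "\<dots> = M ^ (CARD('n) - 1)" by (simp add: card_Diff_singleton)
    finally show ?thesis by simp
  qed
  have "real (card ?A) \<le> real (card ?B) * (2 * R / \<bar>of_int (q $ b0)\<bar> + 1)"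
  proof (rule card_le_fibres[where f = ?f])
    show "finite ?A" by simp
    show "finite ?B" by (rule finite_vec_set) auto
    show "?f ` ?A \<subseteq> ?B" by (auto simp: int_box_def)
    fix v
    define c' where "c' = c + (\<Sum>b\<in>UNIV - {b0}. of_int (v $ b) * of_int (q $ b) :: real)"
    let ?T = "{t :: int. \<bar>c' + of_int t * of_int (q $ b0)\<bar> \<le> R}"
    have "card {x \<in> ?A. ?f x = v} \<le> card ?T"
    proof (rule card_inj_on_le[where f = "\<lambda>r. r $ b0"])
      show "finite ?T" using card_linear_window(1)[of "of_int (q $ b0)" R c'] q R by simp
      show "inj_on (\<lambda>r. r $ b0) {x \<in> ?A. ?f x = v}"
      proof (rule inj_onI)
        fix x y assume *: "x \<in> {x \<in> ?A. ?f x = v}" "y \<in> {x \<in> ?A. ?f x = v}" "x $ b0 = y $ b0"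
        then have "?f x = ?f y" by simp
        have "x $ b = y $ b" if "b \<noteq> b0" for b
          using arg_cong[OF \<open>?f x = ?f y\<close>, of "\<lambda>u. u $ b"] that by simp
        then show "x = y" using *(3) by (metis vec_eq_iff)
      qed
      show "(\<lambda>r. r $ b0) ` {x \<in> ?A. ?f x = v} \<subseteq> ?T"
      proof (rule image_subsetI)
        fix x assume x: "x \<in> {x \<in> ?A. ?f x = v}"
        then have v: "?f x = v" and le: "\<bar>c + (\<Sum>b\<in>UNIV. of_int (x $ b) * of_int (q $ b))\<bar> \<le> R"
          by auto
        have "(\<Sum>b\<in>UNIV. of_int (x $ b) * of_int (q $ b) :: real)
           = of_int (x $ b0) * of_int (q $ b0) + (\<Sum>b\<in>UNIV - {b0}. of_int (x $ b) * of_int (q $ b))"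
          by (rule sum.remove) auto
        also have "(\<Sum>b\<in>UNIV - {b0}. of_int (x $ b) * of_int (q $ b) :: real)
           = (\<Sum>b\<in>UNIV - {b0}. of_int (v $ b) * of_int (q $ b))"
          by (rule sum.cong) (auto simp flip: v)
        finally show "x $ b0 \<in> ?T" using le by (simp add: c'_def algebra_simps)
      qed
    qed
    then show "real (card {x \<in> ?A. ?f x = v}) \<le> 2 * R / \<bar>of_int (q $ b0)\<bar> + 1"
      using card_linear_window(2)[of "of_int (q $ b0)" R c'] q R by linarith
  qed
  then show ?thesis by (simp only: cB)
qed

section \<open>Short vectors of the children of a matrix\<close>

text \<open>The matrix \<open>A\<close> with the digits \<open>D\<close> added in the \<open>j\<close>-th place of the base-\<open>M\<close> expansion of its entries.
Throughout, \<open>M = W ^ (m + n)\<close>, and the perturbed matrices with \<open>D\<close> in \<open>mat_box M\<close> and \<open>j = i + 1\<close> are the children at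
level \<open>i + 1\<close> of a matrix \<open>A\<close> at level \<open>i\<close>.\<close>

definition perturb :: "nat \<Rightarrow> nat \<Rightarrow> real ^ 'n ^ 'm \<Rightarrow> int ^ 'n ^ 'm \<Rightarrow> real ^ 'n ^ 'm" where
  "perturb M j A D = (\<chi> a b. A $ a $ b + of_int (D $ a $ b) / real M ^ j)"

lemma perturb_mult_vec:
  "(perturb M j A D *v rvec q) $ a
     = (A *v rvec q) $ a + (\<Sum>b\<in>UNIV. of_int (D $ a $ b) * of_int (q $ b)) / real M ^ j"
  by (simp add: matrix_vector_mult_def perturb_def distrib_right sum.distrib sum_divide_distrib)

text \<open>A vector that is short for a child at level \<open>i + 1\<close> is not long at level \<open>i\<close>, and the bound is
governed by its \<open>q\<close>-part.\<close>

lemma sup_ball_parent: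
  fixes A :: "real ^ 'n ^ 'm"
  assumes W: "W > 0" and M: "M = W ^ (CARD('m) + CARD('n))"
    and D: "D \<in> mat_box M"
    and z: "z \<in> sup_ball (lat W (Suc i) (perturb M (Suc i) A D)) 1"
    and Y: "1 / real W ^ CARD('n) \<le> Y" "\<And>b. \<bar>of_int (snd z $ b)\<bar> \<le> Y * real W ^ (CARD('m) * i)"
  shows "z \<in> sup_ball (lat W i A) ((real CARD('n) + 1) * Y)"
proof -
  define n where "n = CARD('n)"
  define m where "m = CARD('m)"
  define w where "w = real W"
  have w0: "w > 0" using W by (simp add: w_def)
  have Mw: "real M = w ^ m * w ^ n" by (simp add: M w_def m_def n_def power_add)
  have Y0: "Y \<ge> 0" using Y(1) by (rule order_trans[rotated]) simp
  show ?thesis unfolding in_lat_ball_iff[OF W]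
  proof (intro conjI allI)
    fix b
    have "Y * w ^ (m * i) \<le> ((real CARD('n) + 1) * Y) * w ^ (m * i)"
      using Y0 w0 by (intro mult_right_mono) (auto simp: algebra_simps)
    then show "\<bar>of_int (snd z $ b)\<bar> \<le> (real CARD('n) + 1) * Y * real W ^ (CARD('m) * i)"
      using Y(2)[of b] by (simp add: w_def m_def)
  next
    fix a
    let ?e = "(A *v rvec (snd z)) $ a - of_int (fst z $ a)"
    let ?s = "(\<Sum>b\<in>UNIV. of_int (D $ a $ b) * of_int (snd z $ b)) :: real"
    have 1: "w ^ (n * Suc i) * \<bar>?e + ?s / real M ^ Suc i\<bar> \<le> 1"
      using z unfolding in_lat_ball_iff[OF W] by (simp add: perturb_mult_vec w_def n_def add_diff_eq diff_add_eq)
    have 2: "\<bar>?s\<bar> \<le> real n * (real M * (Y * w ^ (m * i)))"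
    proof -
      have "\<bar>?s\<bar> \<le> (\<Sum>b\<in>UNIV. \<bar>of_int (D $ a $ b) * of_int (snd z $ b)\<bar>)" by (rule sum_abs)
      also have "\<dots> \<le> (\<Sum>b\<in>(UNIV::'n set). real M * (Y * w ^ (m * i)))"
        unfolding abs_mult
      proof (intro sum_mono mult_mono)
        fix b
        have "0 \<le> D $ a $ b" "D $ a $ b < int M" using D by (auto simp: mat_box_def int_box_def)
        then show "\<bar>real_of_int (D $ a $ b)\<bar> \<le> real M" by linarith
        show "\<bar>real_of_int (snd z $ b)\<bar> \<le> Y * w ^ (m * i)" using Y(2) by (simp add: w_def m_def)
      qed auto
      finally show ?thesis by (simp add: n_def)
    qed
    have 3: "w ^ (n * i) * \<bar>?s / real M ^ Suc i\<bar> \<le> real n * Y"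
    proof -
      have "w ^ (n * i) * \<bar>?s / real M ^ Suc i\<bar> = w ^ (n * i) * \<bar>?s\<bar> / real M ^ Suc i"
        by (simp add: abs_mult)
      also have "\<dots> \<le> w ^ (n * i) * (real n * (real M * (Y * w ^ (m * i)))) / real M ^ Suc i"
        using 2 w0 by (intro divide_right_mono mult_left_mono) auto
      also have "\<dots> = real n * Y"
        using w0 unfolding Mw by (simp add: field_simps power_mult_distrib flip: power_mult)
      finally show ?thesis .
    qed
    have 4: "w ^ (n * i) * \<bar>?e + ?s / real M ^ Suc i\<bar> \<le> Y"
    proof -
      have "w ^ n * (w ^ (n * i) * \<bar>?e + ?s / real M ^ Suc i\<bar>) \<le> 1"
        using 1 by (simp add: power_add mult.assoc)
      then have "w ^ (n * i) * \<bar>?e + ?s / real M ^ Suc i\<bar> \<le> 1 / w ^ n"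
        using w0 by (simp add: pos_le_divide_eq mult.commute)
      then show ?thesis using Y(1) by (simp add: w_def n_def)
    qed
    have "\<bar>?e\<bar> \<le> \<bar>?e + ?s / real M ^ Suc i\<bar> + \<bar>?s / real M ^ Suc i\<bar>"
      using abs_triangle_ineq4[of "?e + ?s / real M ^ Suc i" "?s / real M ^ Suc i"] by simp
    then have "w ^ (n * i) * \<bar>?e\<bar> \<le> w ^ (n * i) * (\<bar>?e + ?s / real M ^ Suc i\<bar> + \<bar>?s / real M ^ Suc i\<bar>)"
      using w0 by (intro mult_left_mono) auto
    also have "\<dots> \<le> Y + real n * Y" using 3 4 by (simp add: distrib_left)
    finally show "real W ^ (CARD('n) * i) * \<bar>?e\<bar> \<le> (real CARD('n) + 1) * Y"
      by (simp add: w_def n_def algebra_simps)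
  qed
qed

text \<open>The proportion of children for which a given vector \<open>z\<close> is short is at most \<open>(3 / (W ^ n y)) ^ m\<close>,
where \<open>y\<close> is the size of an entry of the \<open>q\<close>-part at level \<open>i\<close>; the rows of the digit matrix act independently.\<close>

lemma card_children_hitting:
  fixes A :: "real ^ 'n ^ 'm" and z :: "(int ^ 'm) \<times> (int ^ 'n)"
  assumes W: "W > 0" and M: "M = W ^ (CARD('m) + CARD('n))"
    and b0: "snd z $ b0 \<noteq> 0" "\<bar>of_int (snd z $ b0)\<bar> \<le> real W ^ (CARD('m) * Suc i)"
  shows "real (card {D \<in> mat_box M. z \<in> sup_ball (lat W (Suc i) (perturb M (Suc i) A D)) 1})
    \<le> real M ^ (CARD('m) * CARD('n)) *
       (3 * real W ^ (CARD('m) * i) / (real W ^ CARD('n) * \<bar>of_int (snd z $ b0)\<bar>)) ^ CARD('m)"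
proof -
  define n where "n = CARD('n)"
  define m where "m = CARD('m)"
  define w where "w = real W"
  have w0: "w > 0" using W by (simp add: w_def)
  have n0: "n > 0" by (simp add: n_def)
  have Mw: "real M = w ^ m * w ^ n" by (simp add: M w_def m_def n_def power_add)
  have M0: "real M > 0" using w0 by (simp add: Mw)
  define x where "x = \<bar>real_of_int (snd z $ b0)\<bar>"
  have x0: "x > 0" using b0(1) by (simp add: x_def)
  define R where "R = w ^ (m * Suc i)"
  have xR: "x \<le> R" using b0(2) by (simp add: x_def R_def w_def m_def)
  define c where "c a = real M ^ Suc i * ((A *v rvec (snd z)) $ a - of_int (fst z $ a))" for a
  define S where "S a = {r \<in> (int_box M :: (int ^ 'n) set). \<bar>c a + (\<Sum>b\<in>UNIV. of_int (r $ b) * of_int (snd z $ b))\<bar> \<le> R}" for a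
  have "{D \<in> mat_box M. z \<in> sup_ball (lat W (Suc i) (perturb M (Suc i) A D)) 1} \<subseteq> {D. \<forall>a. D $ a \<in> S a}"
  proof clarify
    fix D a assume D: "D \<in> mat_box M" and z: "z \<in> sup_ball (lat W (Suc i) (perturb M (Suc i) A D)) 1"
    let ?e = "(A *v rvec (snd z)) $ a - of_int (fst z $ a)"
    let ?s = "(\<Sum>b\<in>UNIV. of_int (D $ a $ b) * of_int (snd z $ b)) :: real"
    have "w ^ (n * Suc i) * \<bar>?e + ?s / real M ^ Suc i\<bar> \<le> 1"
      using z unfolding in_lat_ball_iff[OF W] by (simp add: perturb_mult_vec w_def n_def add_diff_eq diff_add_eq)
    moreover have "?e + ?s / real M ^ Suc i = (c a + ?s) / real M ^ Suc i"
      using M0 by (simp add: c_def field_simps)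
    ultimately have "w ^ (n * Suc i) * \<bar>c a + ?s\<bar> \<le> real M ^ Suc i"
      using M0 by (simp add: abs_divide pos_divide_le_eq)
    also have "real M ^ Suc i = w ^ (n * Suc i) * R"
      unfolding R_def Mw power_mult_distrib power_mult[symmetric] by simp
    finally have "\<bar>c a + ?s\<bar> \<le> R" using w0 by simp
    then show "D $ a \<in> S a" using D by (simp add: S_def mat_box_def)
  qed
  moreover have "finite {D :: int ^ 'n ^ 'm. \<forall>a. D $ a \<in> S a}"
    by (rule finite_vec_set) (simp add: S_def)
  ultimately have "card {D \<in> mat_box M. z \<in> sup_ball (lat W (Suc i) (perturb M (Suc i) A D)) 1}
       \<le> card {D :: int ^ 'n ^ 'm. \<forall>a. D $ a \<in> S a}"
    by (intro card_mono)
  also have "\<dots> = (\<Prod>a\<in>UNIV. card (S a))" by (rule card_vec_set)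
  finally have "real (card {D \<in> mat_box M. z \<in> sup_ball (lat W (Suc i) (perturb M (Suc i) A D)) 1})
       \<le> (\<Prod>a\<in>UNIV. real (card (S a)))" by (simp flip: of_nat_prod)
  also have "\<dots> \<le> (\<Prod>a\<in>(UNIV::'m set). real M ^ n * (3 * w ^ (m * i) / (w ^ n * x)))"
  proof (intro prod_mono conjI)
    fix a
    have "real (card (S a)) \<le> real M ^ (n - 1) * (2 * R / x + 1)"
      using card_row_window[of "snd z" b0 R M "c a"] b0(1) w0 unfolding S_def x_def n_def R_def by simp
    also have "\<dots> \<le> real M ^ (n - 1) * (3 * R / x)"
      using xR x0 M0 by (intro mult_left_mono) (auto simp: field_simps)
    also have "\<dots> = real M ^ (n - 1) * (real M * (3 * w ^ (m * i) / (w ^ n * x)))"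
      using w0 unfolding Mw R_def by (simp add: field_simps power_add)
    also have "\<dots> = real M ^ n * (3 * w ^ (m * i) / (w ^ n * x))"
      using n0 by (cases n) auto
    finally show "real (card (S a)) \<le> real M ^ n * (3 * w ^ (m * i) / (w ^ n * x))" .
  qed auto
  also have "\<dots> = real M ^ (m * n) * (3 * w ^ (m * i) / (w ^ n * x)) ^ m"
    by (simp only: prod_constant m_def[symmetric] power_mult_distrib[of "real M ^ n"] power_mult[symmetric] mult.commute[of n m])
  finally show ?thesis unfolding n_def m_def w_def x_def by simp
qed

lemma sum_UN_le:
  fixes h :: "'a \<Rightarrow> real"
  assumes "finite I" "\<And>i. i \<in> I \<Longrightarrow> finite (E i)" "\<And>x. h x \<ge> 0"
  shows "(\<Sum>x\<in>(\<Union>i\<in>I. E i). h x) \<le> (\<Sum>i\<in>I. \<Sum>x\<in>E i. h x)"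
  using assms(1,2)
proof (induction I)
  case (insert a I)
  have "(\<Sum>x\<in>(\<Union>i\<in>insert a I. E i). h x) \<le> (\<Sum>x\<in>E a. h x) + (\<Sum>x\<in>(\<Union>i\<in>I. E i). h x)"
    using insert assms(3)
    by (simp add: sum_Un sum_nonneg)
  then show ?case using insert by simp
qed simp

text \<open>The contraction for lattices with many short vectors. The number of vectors short for a random child
is summed over their candidates at level \<open>i\<close>, sorted by the size \<open>y\<close> of the \<open>q\<close>-part. Those with \<open>y \<le> 1 / w\<close> lie
in a tiny cube and are few by \<open>card_cube_small\<close>. Those with \<open>w ^ (l - 1) < y \<le> w ^ l\<close> lie in a cube
of side of order \<open>w ^ l\<close>, hence number at most a constant times \<open>w ^ (l (m + n - 1))\<close> times the number of short
vectors, because they lie in a hyperplane; each is short for a proportion of order \<open>(w / (w ^ l w ^ (2 n))) ^ m\<close> of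
the children. All \<open>2 m + 1\<close> products, for \<open>0 \<le> l \<le> 2 m\<close>, are of order at most \<open>1 / w\<close>. The base \<open>W = w ^ 2\<close> is a square so that there
are only these finitely many ranges while one step \<open>w\<close> of the ranges costs less than what is gained.\<close>

lemma drift_inequality:
  fixes A :: "real ^ 'n ^ 'm"
  assumes w: "w > 0" and W: "W = w ^ 2" and M: "M = W ^ (CARD('m) + CARD('n))"
    and small: "real CARD('n) + 1 \<le> real w / 4"
    and C: "C = 3 ^ CARD('m) * (4 * real (CARD('m) + CARD('n)) * (real CARD('n) + 1)) ^ (CARD('m) + CARD('n) - 1)"
    and \<rho>: "\<rho> = (real CARD('n) + 1) * real W ^ CARD('m)"
    and many: "(2 * (fact (CARD('m) + CARD('n)) * \<rho> ^ (CARD('m) + CARD('n))) + 1) ^ (CARD('m) + CARD('n))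
       < real (card (sup_ball (lat W i A) 1))"
  shows "(\<Sum>D\<in>mat_box M. real (card (sup_ball (lat W (Suc i) (perturb M (Suc i) A D)) 1)))
    \<le> real M ^ (CARD('m) * CARD('n)) *
      (1 + (4 * (real CARD('n) + 1) + real (2 * CARD('m) + 1) * C) / real w * real (card (sup_ball (lat W i A) 1)))"
proof -
  define n where "n = CARD('n)"
  define m where "m = CARD('m)"
  define d where "d = m + n"
  define v where "v = real w"
  define T where "T = real M ^ (m * n)"
  define X where "X = real (card (sup_ball (lat W i A) 1))"
  define k where "k = real n + 1"
  have n0: "n > 0" and m0: "m > 0" by (auto simp: n_def m_def)
  have dC: "CARD('m + 'n) = d" by (simp add: d_def m_def n_def)
  have W0: "W > 0" using w W by simp
  have v0: "v > 0" using w by (simp add: v_def)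
  have k1: "k \<ge> 1" by (simp add: k_def)
  have v4: "v \<ge> 4 * k" using small by (simp add: v_def k_def n_def)
  have v1: "v \<ge> 1" using v4 k1 by simp
  have Wv: "real W = v ^ 2" by (simp add: W v_def)
  have T0: "T \<ge> 0" by (simp add: T_def)
  interpret L: unimodular_lattice "lat W i A" by (rule unimodular_lattice_lat[OF W0])
  have \<rho>v: "\<rho> = k * v ^ (2 * m)" by (simp add: \<rho> k_def n_def m_def Wv power_mult)
  have \<rho>1: "\<rho> \<ge> 1" unfolding \<rho>v using k1 v1 by (intro order_trans[OF _ mult_mono[of 1 k 1]]) auto
  have cardT: "real (card (mat_box M :: (int ^ 'n ^ 'm) set)) = T" by (simp add: card_mat_box T_def m_def n_def)
  obtain \<phi> where \<phi>: "\<phi> \<noteq> 0" "\<And>z. z \<in> L.cube \<rho> \<Longrightarrow> (\<Sum>c\<in>UNIV. \<phi> $ c * lat W i A z $ c) = 0"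
    using L.hyperplane_of_many_short[of \<rho>] \<rho>1 many dC by (auto simp: d_def m_def n_def)
  have few: "real (card (L.cube r)) \<le> (4 * real d * r) ^ (d - 1) * X" if r: "1 \<le> r" "r \<le> \<rho>" for r
  proof -
    have "(\<Sum>c\<in>UNIV. \<phi> $ c * lat W i A z $ c) = 0" if "z \<in> L.cube r" for z
      using that L.cube_mono[OF r(2)] \<phi>(2) by blast
    from L.card_cube_le_hyperplane[OF r(1) \<phi>(1) this] show ?thesis
      by (simp add: X_def d_def m_def n_def)
  qed
  define P where "P D = sup_ball (lat W (Suc i) (perturb M (Suc i) A D)) 1" for D :: "int ^ 'n ^ 'm"
  have finP: "finite (P D)" for D unfolding P_def by (rule finite_lat_ball[OF W0])
  define h where "h z = real (card {D \<in> mat_box M. z \<in> P D})" for z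
  have hT: "h z \<le> T" for z unfolding h_def cardT[symmetric] by (intro of_nat_mono card_mono) auto
  have h0: "h z \<ge> 0" for z by (simp add: h_def)
  define E0 where "E0 = L.cube (k / v)"
  define g where "g l = (3 * v / (v ^ l * v ^ (2 * n))) ^ m" for l :: nat
  have g0: "g l \<ge> 0" for l unfolding g_def using v0 by simp
  define E where "E l = {z \<in> L.cube (k * v ^ l). h z \<le> T * g l}" for l :: nat
  define F where "F = E0 \<union> (\<Union>l\<in>{..2 * m}. E l)"
  have finF: "finite F" by (simp add: F_def E0_def E_def)
  have PF: "P D \<subseteq> F" if D: "D \<in> mat_box M" for D
  proof
    fix z assume z: "z \<in> P D"
    have qQ: "\<bar>of_int (snd z $ b)\<bar> \<le> real W ^ (m * Suc i)" for b
      using z by (simp add: P_def in_lat_ball_iff[OF W0] m_def)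
    obtain b0 where b0: "\<And>b. \<bar>real_of_int (snd z $ b)\<bar> \<le> \<bar>real_of_int (snd z $ b0)\<bar>"
      using ex_max_coord[of "\<lambda>b. \<bar>real_of_int (snd z $ b)\<bar>"] by blast
    define Q where "Q = real W ^ (m * i)"
    have Q0: "Q > 0" using W0 by (simp add: Q_def)
    define y where "y = \<bar>real_of_int (snd z $ b0)\<bar> / Q"
    have y0: "\<bar>real_of_int (snd z $ b0)\<bar> = y * Q" using Q0 by (simp add: y_def)
    have parent: "z \<in> L.cube (k * Y)" if "1 / real W ^ n \<le> Y" "y \<le> Y" for Y
      unfolding k_def n_def
    proof (rule sup_ball_parent[OF W0 M D z[unfolded P_def]])
      show "1 / real W ^ CARD('n) \<le> Y" using that by (simp add: n_def)
      fix b
      have "\<bar>real_of_int (snd z $ b)\<bar> \<le> y * Q" using b0[of b] y0 by simp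
      also have "\<dots> \<le> Y * Q" using that Q0 by (intro mult_right_mono) auto
      finally show "\<bar>real_of_int (snd z $ b)\<bar> \<le> Y * real W ^ (CARD('m) * i)" by (simp add: Q_def m_def)
    qed
    have Wn: "1 / real W ^ n \<le> 1 / v"
    proof -
      have "v ^ 1 \<le> v ^ (2 * n)" using v1 n0 by (intro power_increasing) auto
      then show ?thesis using v0 unfolding Wv power_mult[symmetric] by (intro divide_left_mono) auto
    qed
    show "z \<in> F"
    proof (cases "y \<le> 1 / v")
      case True
      then have "z \<in> L.cube (k * (1 / v))" using Wn by (intro parent)
      then show ?thesis by (simp add: F_def E0_def)
    next
      case False
      have ex: "y \<le> v ^ (2 * m)"
      proof -
        have "y * Q \<le> v ^ (2 * m) * Q"
        proof -
          have "real W ^ (m * Suc i) = v ^ (2 * m) * Q"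
            by (simp only: Q_def Wv mult_Suc_right power_add power_mult[symmetric] mult.assoc)
          then show ?thesis using qQ[of b0] y0 by simp
        qed
        then show ?thesis using Q0 by simp
      qed
      define l where "l = (LEAST l. y \<le> v ^ l)"
      have l1: "y \<le> v ^ l" unfolding l_def by (rule LeastI[of "\<lambda>l. y \<le> v ^ l"]) (rule ex)
      have l2: "l \<le> 2 * m" unfolding l_def by (rule Least_le) (rule ex)
      have l3: "v ^ l / v \<le> y"
      proof (cases l)
        case 0
        then show ?thesis using False by simp
      next
        case (Suc l')
        then have "\<not> y \<le> v ^ l'" using not_less_Least[of l' "\<lambda>l. y \<le> v ^ l"] by (simp add: l_def)
        then show ?thesis using v0 Suc by simp
      qed
      have ypos: "y > 0" using False v0 by (smt (verit) divide_pos_pos)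
      have "1 / v \<le> v ^ l" using False l1 by linarith
      then have zc: "z \<in> L.cube (k * v ^ l)" using Wn l1 by (intro parent) auto
      have "h z \<le> T * (3 * real W ^ (m * i) / (real W ^ n * \<bar>of_int (snd z $ b0)\<bar>)) ^ m"
        unfolding h_def P_def T_def m_def n_def
        using qQ[of b0] ypos Q0 y0 by (intro card_children_hitting[OF W0 M]) (auto simp: m_def)
      also have "3 * real W ^ (m * i) / (real W ^ n * \<bar>of_int (snd z $ b0)\<bar>) = 3 / (v ^ (2 * n) * y)"
        unfolding y0 Q_def[symmetric] using Q0 by (simp add: Wv power_mult)
      also have "T * (3 / (v ^ (2 * n) * y)) ^ m \<le> T * g l"
        unfolding g_def
      proof (intro mult_left_mono power_mono T0)
        have "3 / (v ^ (2 * n) * y) \<le> 3 / (v ^ (2 * n) * (v ^ l / v))"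
          using l3 v0 ypos by (intro divide_left_mono mult_left_mono) auto
        then show "3 / (v ^ (2 * n) * y) \<le> 3 * v / (v ^ l * v ^ (2 * n))"
          by (simp add: mult.commute)
        show "0 \<le> 3 / (v ^ (2 * n) * y)" using v0 ypos by simp
      qed
      finally have "z \<in> E l" using zc by (simp add: E_def)
      then show ?thesis using l2 by (auto simp: F_def)
    qed
  qed
  have "(\<Sum>D\<in>mat_box M. real (card (P D))) = (\<Sum>D\<in>mat_box M. \<Sum>z\<in>F. of_bool (z \<in> P D))"
  proof (rule sum.cong[OF refl])
    fix D :: "int ^ 'n ^ 'm" assume "D \<in> mat_box M"
    then have "P D = F \<inter> {z. z \<in> P D}" using PF by blast
    then show "real (card (P D)) = (\<Sum>z\<in>F. of_bool (z \<in> P D))"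
      using finF by (simp add: sum.If_cases flip: sum.inter_filter)
  qed
  also have "\<dots> = (\<Sum>z\<in>F. \<Sum>D\<in>mat_box M. of_bool (z \<in> P D))" by (rule sum.swap)
  also have "\<dots> = (\<Sum>z\<in>F. h z)"
    by (rule sum.cong) (simp_all add: h_def Int_def)
  also have "\<dots> \<le> (\<Sum>z\<in>E0. h z) + (\<Sum>z\<in>(\<Union>l\<in>{..2 * m}. E l). h z)"
    unfolding F_def using h0 by (subst sum.union_inter[symmetric]) (auto simp: E0_def E_def intro!: sum_nonneg)
  also have "(\<Sum>z\<in>E0. h z) \<le> (\<Sum>z\<in>E0. T)" by (intro sum_mono hT)
  also have "\<dots> = T * real (card E0)" by simp
  also have "(\<Sum>z\<in>(\<Union>l\<in>{..2 * m}. E l). h z) \<le> (\<Sum>l\<le>2 * m. \<Sum>z\<in>E l. h z)"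
    by (rule sum_UN_le) (auto simp: E_def h0)
  also have "\<dots> \<le> (\<Sum>l\<le>2 * m. T * (C / v * X))"
  proof (rule sum_mono)
    fix l assume l: "l \<in> {..2 * m}"
    have "(\<Sum>z\<in>E l. h z) \<le> (\<Sum>z\<in>E l. T * g l)" by (rule sum_mono) (simp add: E_def)
    also have "\<dots> = T * (g l * real (card (E l)))" by simp
    also have "real (card (E l)) \<le> real (card (L.cube (k * v ^ l)))"
      by (intro of_nat_mono card_mono) (auto simp: E_def)
    also have "\<dots> \<le> (4 * real d * (k * v ^ l)) ^ (d - 1) * X"
    proof (rule few)
      have "1 * 1 \<le> k * v ^ l" using k1 v1 by (intro mult_mono one_le_power) auto
      then show "1 \<le> k * v ^ l" by simp
      show "k * v ^ l \<le> \<rho>" unfolding \<rho>v using l k1 v1 by (intro mult_left_mono power_increasing) auto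
    qed
    also have "g l * ((4 * real d * (k * v ^ l)) ^ (d - 1) * X) \<le> C / v * X"
    proof -
      have "v ^ (l * (d - 1)) * v ^ m * v \<le> v ^ (l * m) * v ^ (2 * n * m)"
      proof -
        have "l * (d - 1) + m + 1 \<le> l * m + 2 * n * m"
        proof -
          obtain n' where n': "n = Suc n'" using n0 gr0_implies_Suc by blast
          have "l * n' \<le> 2 * m * n'" using l by simp
          moreover have "l * (d - 1) = l * m + l * n'" by (simp add: d_def n' algebra_simps)
          moreover have "2 * n * m = 2 * m * n' + 2 * m" by (simp add: n' algebra_simps)
          ultimately show ?thesis using m0 by linarith
        qed
        then have "v ^ (l * (d - 1) + m + 1) \<le> v ^ (l * m + 2 * n * m)"
          using v1 by (rule power_increasing)
        then show ?thesis by (simp add: power_add mult_ac)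
      qed
      then have key: "v ^ (l * (d - 1)) * v ^ m / (v ^ (l * m) * v ^ (2 * n * m)) \<le> 1 / v"
        using v0 by (simp add: field_simps)
      have "g l = 3 ^ m * v ^ m / (v ^ (l * m) * v ^ (2 * n * m))"
        by (simp only: g_def power_mult_distrib power_divide power_mult[symmetric])
      moreover have "(4 * real d * (k * v ^ l)) ^ (d - 1) = (4 * real d * k) ^ (d - 1) * v ^ (l * (d - 1))"
        by (simp only: power_mult mult.assoc[symmetric] power_mult_distrib)
      moreover have "C = 3 ^ m * (4 * real d * k) ^ (d - 1)"
        by (simp only: C m_def n_def d_def k_def)
      ultimately have "g l * (4 * real d * (k * v ^ l)) ^ (d - 1)
         = C * (v ^ (l * (d - 1)) * v ^ m / (v ^ (l * m) * v ^ (2 * n * m)))"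
        by simp
      also have "\<dots> \<le> C * (1 / v)" using key by (intro mult_left_mono) (auto simp: C)
      finally have "g l * (4 * real d * (k * v ^ l)) ^ (d - 1) * X \<le> C * (1 / v) * X"
        by (rule mult_right_mono) (simp add: X_def)
      then show ?thesis by (simp only: mult.assoc times_divide_eq_right mult_1_right times_divide_eq_left)
    qed
    finally show "(\<Sum>z\<in>E l. h z) \<le> T * (C / v * X)" using T0 g0 by (simp add: mult_left_mono)
  qed
  also have "real (card E0) \<le> 1 + 4 * (k / v) * X"
    unfolding E0_def X_def using k1 v0 v4 by (intro L.card_cube_small) (auto simp: field_simps)
  also have "T * (1 + 4 * (k / v) * X) + (\<Sum>l\<le>2 * m. T * (C / v * X))
      = T * (1 + (4 * k + real (2 * m + 1) * C) / v * X)"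
    using v0 by (simp add: field_simps)
  finally show ?thesis
    using T0 by (simp add: P_def T_def k_def m_def n_def v_def X_def mult_left_mono)
qed

section \<open>Rarity of matrices with few good levels\<close>

text \<open>The number of short vectors of the lattice of \<open>A\<close> at level \<open>i\<close>, the zero vector included.\<close>

definition short_count :: "nat \<Rightarrow> nat \<Rightarrow> real ^ 'n ^ 'm \<Rightarrow> real" where
  "short_count W i A = real (card (sup_ball (lat W i A) 1))"

lemma short_count_ge_1:
  assumes "W > 0"
  shows "1 \<le> short_count W i A"
proof -
  interpret L: unimodular_lattice "lat W i A" by (rule unimodular_lattice_lat[OF assms])
  show ?thesis using L.card_cube_ge_1[of 1] by (simp add: short_count_def)
qed

text \<open>For a suitable base \<open>W\<close>, the average of \<open>short_count\<close> over the children is at most half the value at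
the parent as soon as the latter exceeds \<open>K\<close>, and no child exceeds its parent by more than a factor \<open>D\<close>.\<close>

lemma drift_constants:
  "\<exists>W K D. 2 \<le> W \<and> 1 \<le> D \<and>
    (\<forall>i (A :: real ^ 'n ^ 'm). K < short_count W i A \<longrightarrow>
       (\<Sum>E\<in>mat_box (W ^ (CARD('m) + CARD('n))).
          short_count W (Suc i) (perturb (W ^ (CARD('m) + CARD('n))) (Suc i) A E))
       \<le> real (W ^ (CARD('m) + CARD('n))) ^ (CARD('m) * CARD('n)) * (short_count W i A / 2)) \<and>
    (\<forall>i (A :: real ^ 'n ^ 'm). \<forall>E\<in>mat_box (W ^ (CARD('m) + CARD('n))).
       short_count W (Suc i) (perturb (W ^ (CARD('m) + CARD('n))) (Suc i) A E) \<le> D * short_count W i A)"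
proof -
  define n where "n = CARD('n)"
  define m where "m = CARD('m)"
  define C :: real where "C = 3 ^ m * (4 * real (m + n) * (real n + 1)) ^ (m + n - 1)"
  define c where "c = 4 * (real n + 1) + real (2 * m + 1) * C"
  have C0: "C \<ge> 0" by (simp add: C_def)
  define w where "w = nat \<lceil>4 * c\<rceil>"
  have c4: "c \<ge> 4 * (real n + 1)" using C0 by (simp add: c_def)
  have n1: "n \<ge> 1" by (simp add: n_def Suc_le_eq)
  have wc: "4 * c \<le> real w" unfolding w_def using c4 by linarith
  have w16: "16 \<le> real w" using wc c4 n1 by simp
  have w0: "w > 0" using w16 by simp
  define W where "W = w ^ 2"
  have W2: "2 \<le> W"
  proof -
    have "2 \<le> w" using w16 by linarith
    then have "2 * 1 \<le> w * w" by (intro mult_mono) auto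
    then show ?thesis by (simp add: W_def power2_eq_square)
  qed
  then have W0: "W > 0" by simp
  define M where "M = W ^ (m + n)"
  define \<rho> where "\<rho> = (real n + 1) * real W ^ m"
  have \<rho>1: "1 \<le> \<rho>"
  proof -
    have "1 * 1 \<le> (real n + 1) * real W ^ m" using W0 by (intro mult_mono one_le_power) auto
    then show ?thesis by (simp add: \<rho>_def)
  qed
  define K where "K = max 4 ((2 * (fact (m + n) * \<rho> ^ (m + n)) + 1) ^ (m + n))"
  define D where "D = (4 * \<rho>) ^ (m + n)"
  have D1: "1 \<le> D" unfolding D_def using \<rho>1 by (intro one_le_power) simp
  have 1: "(\<Sum>E\<in>mat_box M. short_count W (Suc i) (perturb M (Suc i) A E))
       \<le> real M ^ (m * n) * (short_count W i A / 2)"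
    if K: "K < short_count W i A" for i and A :: "real ^ 'n ^ 'm"
  proof -
    have "(\<Sum>E\<in>mat_box M. short_count W (Suc i) (perturb M (Suc i) A E))
       \<le> real M ^ (m * n) * (1 + c / real w * short_count W i A)"
      unfolding short_count_def c_def m_def n_def
    proof (rule drift_inequality[OF w0 W_def])
      show "M = W ^ (CARD('m) + CARD('n))" by (simp add: M_def m_def n_def)
      show "real CARD('n) + 1 \<le> real w / 4" using wc c4 by (simp add: n_def)
      show "C = 3 ^ CARD('m) * (4 * real (CARD('m) + CARD('n)) * (real CARD('n) + 1)) ^ (CARD('m) + CARD('n) - 1)"
        by (simp only: C_def m_def n_def)
      show "\<rho> = (real CARD('n) + 1) * real W ^ CARD('m)" by (simp only: \<rho>_def m_def n_def)
      show "(2 * (fact (CARD('m) + CARD('n)) * \<rho> ^ (CARD('m) + CARD('n))) + 1) ^ (CARD('m) + CARD('n))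
       < real (card (sup_ball (lat W i A) 1))"
        using K by (simp add: K_def m_def n_def short_count_def)
    qed
    also have "\<dots> \<le> real M ^ (m * n) * (short_count W i A / 2)"
    proof (rule mult_left_mono)
      have "4 < short_count W i A" using K by (simp add: K_def)
      moreover have "c / real w \<le> 1 / 4" using wc w16 by (simp add: field_simps)
      then have "c / real w * short_count W i A \<le> 1 / 4 * short_count W i A"
        by (rule mult_right_mono) (simp add: short_count_def)
      ultimately show "1 + c / real w * short_count W i A \<le> short_count W i A / 2" by linarith
    qed simp
    finally show ?thesis .
  qed
  have 2: "short_count W (Suc i) (perturb M (Suc i) A E) \<le> D * short_count W i A"
    if E: "E \<in> mat_box M" for i and A :: "real ^ 'n ^ 'm" and E
  proof -
    interpret L: unimodular_lattice "lat W i A" by (rule unimodular_lattice_lat[OF W0])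
    have "sup_ball (lat W (Suc i) (perturb M (Suc i) A E)) 1 \<subseteq> L.cube \<rho>"
    proof
      fix z assume z: "z \<in> sup_ball (lat W (Suc i) (perturb M (Suc i) A E)) 1"
      show "z \<in> L.cube \<rho>" unfolding \<rho>_def n_def
      proof (rule sup_ball_parent[OF W0 _ E z])
        show "M = W ^ (CARD('m) + CARD('n))" by (simp add: M_def m_def n_def)
        have "1 / real W ^ CARD('n) \<le> 1" using W0 by simp
        also have "1 \<le> real W ^ m" using W0 by (intro one_le_power) simp
        finally show "1 / real W ^ CARD('n) \<le> real W ^ m" .
        fix b
        have "\<bar>real_of_int (snd z $ b)\<bar> \<le> real W ^ (CARD('m) * Suc i)"
          using z unfolding in_lat_ball_iff[OF W0] by simp
        then show "\<bar>real_of_int (snd z $ b)\<bar> \<le> real W ^ m * real W ^ (CARD('m) * i)"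
          by (simp add: m_def power_add)
      qed
    qed
    then have "card (sup_ball (lat W (Suc i) (perturb M (Suc i) A E)) 1) \<le> card (L.cube \<rho>)"
      by (intro card_mono) auto
    also have "real (card (L.cube \<rho>)) \<le> (4 * \<rho>) ^ CARD('m + 'n) * real (card (L.cube 1))"
      by (rule L.card_cube_le[OF \<rho>1])
    finally show ?thesis by (simp add: short_count_def D_def m_def n_def)
  qed
  show ?thesis
    using W2 D1 1 2 unfolding M_def m_def n_def by blast
qed

text \<open>The matrix with entries \<open>Z / M ^ i\<close>: the lower corner of the \<open>M\<close>-adic box of level \<open>i\<close> indexed by \<open>Z\<close>.\<close>

definition grid :: "nat \<Rightarrow> nat \<Rightarrow> int ^ 'n ^ 'm \<Rightarrow> real ^ 'n ^ 'm" where
  "grid M i Z = (\<chi> a b. of_int (Z $ a $ b) / real M ^ i)"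

text \<open>The index of the box obtained from \<open>Z\<close> by appending the digits \<open>D\<close>.\<close>

definition child :: "nat \<Rightarrow> int ^ 'n ^ 'm \<Rightarrow> int ^ 'n ^ 'm \<Rightarrow> int ^ 'n ^ 'm" where
  "child M Z D = (\<chi> a b. int M * Z $ a $ b + D $ a $ b)"

text \<open>The index of the \<open>M\<close>-adic box of the previous level containing the box indexed by \<open>Z\<close>.\<close>

definition parent :: "nat \<Rightarrow> int ^ 'n ^ 'm \<Rightarrow> int ^ 'n ^ 'm" where
  "parent M Z = (\<chi> a b. Z $ a $ b div int M)"

lemma mem_mat_box: "D \<in> mat_box L \<longleftrightarrow> (\<forall>a b. 0 \<le> D $ a $ b \<and> D $ a $ b < int L)"
  by (auto simp: mat_box_def int_box_def)

lemma grid_child: "M > 0 \<Longrightarrow> grid M (Suc i) (child M Z D) = perturb M (Suc i) (grid M i Z) D"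
  by (simp add: grid_def child_def perturb_def vec_eq_iff add_divide_distrib)

lemma parent_child: "M > 0 \<Longrightarrow> D \<in> mat_box M \<Longrightarrow> parent M (child M Z D) = Z"
  by (simp add: parent_def child_def vec_eq_iff mem_mat_box)

lemma sum_mat_box_Suc:
  fixes f :: "int ^ 'n ^ 'm \<Rightarrow> real"
  assumes M: "M > 0"
  shows "(\<Sum>Z\<in>mat_box (M ^ Suc k). f Z) = (\<Sum>Z\<in>mat_box (M ^ k). \<Sum>D\<in>mat_box M. f (child M Z D))"
proof -
  let ?g = "\<lambda>Z :: int ^ 'n ^ 'm. (parent M Z, \<chi> a b. Z $ a $ b mod int M)"
  have "(\<Sum>Z\<in>mat_box (M ^ k). \<Sum>D\<in>mat_box M. f (child M Z D))
     = (\<Sum>(Z, D)\<in>mat_box (M ^ k) \<times> mat_box M. f (child M Z D))"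
    by (simp add: sum.cartesian_product)
  also have "\<dots> = (\<Sum>Z\<in>mat_box (M ^ Suc k). f Z)"
  proof (rule sum.reindex_bij_witness[where i = ?g and j = "\<lambda>(Z, D). child M Z D"])
    fix p :: "(int ^ 'n ^ 'm) \<times> (int ^ 'n ^ 'm)"
    assume p: "p \<in> mat_box (M ^ k) \<times> mat_box M"
    with M show "?g (case p of (Z, D) \<Rightarrow> child M Z D) = p"
      by (auto simp: parent_def child_def vec_eq_iff mem_mat_box split: prod.split)
    show "(case p of (Z, D) \<Rightarrow> child M Z D) \<in> mat_box (M ^ Suc k)"
    proof -
      obtain Z D where ZD: "p = (Z, D)" by (cases p)
      have "0 \<le> int M * Z $ a $ b + D $ a $ b \<and> int M * Z $ a $ b + D $ a $ b < int (M ^ Suc k)" for a b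
      proof -
        have Z: "0 \<le> Z $ a $ b" "Z $ a $ b < int (M ^ k)" and D: "0 \<le> D $ a $ b" "D $ a $ b < int M"
          using p by (auto simp: ZD mem_mat_box)
        have "int M * (Z $ a $ b + 1) \<le> int M * int (M ^ k)"
          using Z by (intro mult_left_mono) auto
        then show ?thesis using Z D by (simp add: algebra_simps)
      qed
      then show ?thesis by (simp add: ZD mem_mat_box child_def)
    qed
    show "f (case p of (Z, D) \<Rightarrow> child M Z D) = (case p of (Z, D) \<Rightarrow> f (child M Z D))"
      by (simp split: prod.split)
  next
    fix Z :: "int ^ 'n ^ 'm" assume Z: "Z \<in> mat_box (M ^ Suc k)"
    show "(case ?g Z of (Z, D) \<Rightarrow> child M Z D) = Z"
      by (simp add: parent_def child_def vec_eq_iff)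
    have "0 \<le> Z $ a $ b div int M \<and> Z $ a $ b div int M < int (M ^ k)" for a b
    proof -
      have z: "0 \<le> Z $ a $ b" "Z $ a $ b < int M * int (M ^ k)" using Z by (auto simp: mem_mat_box)
      have "int M * (Z $ a $ b div int M) \<le> Z $ a $ b"
        using M by (simp add: mult.commute div_times_less_eq_dividend minus_mod_eq_mult_div[symmetric])
      then have "int M * (Z $ a $ b div int M) < int M * int (M ^ k)" using z by simp
      then show ?thesis using M z by (simp only: pos_imp_zdiv_nonneg_iff mult_less_cancel_left_pos of_nat_0_less_iff)
    qed
    then show "?g Z \<in> mat_box (M ^ k) \<times> mat_box M"
      using M by (auto simp: mem_mat_box parent_def)
  qed
  finally show ?thesis ..
qed

text \<open>The levels \<open>i < k\<close> at which the ancestor of the box \<open>Z\<close> of level \<open>k\<close> has at most \<open>K\<close> short vectors.\<close>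

definition good_levels :: "nat \<Rightarrow> nat \<Rightarrow> real \<Rightarrow> nat \<Rightarrow> int ^ 'n ^ 'm \<Rightarrow> nat set" where
  "good_levels W M K k Z = {i. i < k \<and> short_count W i (grid M i ((parent M ^^ (k - i)) Z)) \<le> K}"

lemma finite_good_levels [simp]: "finite (good_levels W M K k Z)"
  by (rule finite_subset[of _ "{..<k}"]) (auto simp: good_levels_def)

lemma card_good_levels_Suc:
  "card (good_levels W M K (Suc k) Z) = card (good_levels W M K k (parent M Z))
     + (if short_count W k (grid M k (parent M Z)) \<le> K then 1 else 0)"
proof -
  have "(parent M ^^ (Suc k - i)) Z = (parent M ^^ (k - i)) (parent M Z)" if "i \<le> k" for i
    using that by (simp add: Suc_diff_le funpow_swap1)
  then have "good_levels W M K (Suc k) Z = good_levels W M K k (parent M Z)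
      \<union> (if short_count W k (grid M k (parent M Z)) \<le> K then {k} else {})"
    by (auto simp: good_levels_def less_Suc_eq)
  moreover have "k \<notin> good_levels W M K k (parent M Z)" by (simp add: good_levels_def)
  ultimately show ?thesis by simp
qed

text \<open>Weighting \<open>short_count\<close> with a factor \<open>1 / D\<close> for every good level and \<open>2\<close> for every other level
gives a nonnegative supermartingale along the tree of boxes. As \<open>short_count\<close> is at least \<open>1\<close>, boxes with
few good levels must be rare.\<close>

lemma supermartingale_bound:
  fixes K D :: real and W M :: nat
  defines "T \<equiv> real M ^ (CARD('m) * CARD('n))"
  defines "S \<equiv> (\<Sum>Z\<in>(mat_box 1 :: (int ^ 'n ^ 'm) set). short_count W 0 (grid M 0 Z))"
  assumes M: "M > 0" and D: "1 \<le> D"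
    and cusp: "\<And>i (A :: real ^ 'n ^ 'm). K < short_count W i A \<Longrightarrow>
       (\<Sum>E\<in>mat_box M. short_count W (Suc i) (perturb M (Suc i) A E)) \<le> T * (short_count W i A / 2)"
    and thick: "\<And>i (A :: real ^ 'n ^ 'm) E. E \<in> mat_box M \<Longrightarrow>
       short_count W (Suc i) (perturb M (Suc i) A E) \<le> D * short_count W i A"
  shows "(\<Sum>Z\<in>(mat_box (M ^ k) :: (int ^ 'n ^ 'm) set).
           short_count W k (grid M k Z) * (2 ^ k * (1 / (2 * D)) ^ card (good_levels W M K k Z))) \<le> T ^ k * S"
proof (induction k)
  case 0
  have "good_levels W M K 0 Z = {}" for Z :: "int ^ 'n ^ 'm" by (simp add: good_levels_def)
  then show ?case by (simp add: S_def)
next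
  case (Suc k)
  define wt where "wt k Z = (2 ^ k * (1 / (2 * D)) ^ card (good_levels W M K k Z))" for k and Z :: "int ^ 'n ^ 'm"
  have wt0: "wt k Z \<ge> 0" for k Z using D by (simp add: wt_def)
  have "(\<Sum>Z\<in>(mat_box (M ^ Suc k) :: (int ^ 'n ^ 'm) set). short_count W (Suc k) (grid M (Suc k) Z) * wt (Suc k) Z)
     = (\<Sum>Z\<in>mat_box (M ^ k). \<Sum>E\<in>mat_box M. short_count W (Suc k) (perturb M (Suc k) (grid M k Z) E) * wt (Suc k) (child M Z E))"
    by (simp only: sum_mat_box_Suc[OF M] grid_child[OF M])
  also have "\<dots> \<le> (\<Sum>Z\<in>mat_box (M ^ k). T * (short_count W k (grid M k Z) * wt k Z))"
  proof (rule sum_mono)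
    fix Z :: "int ^ 'n ^ 'm"
    let ?X = "short_count W k (grid M k Z)"
    define c where "c = (if ?X \<le> K then 1 / D else 2)"
    have wt: "wt (Suc k) (child M Z E) = wt k Z * c" if "E \<in> mat_box M" for E
      using parent_child[OF M that, of Z] D by (simp add: wt_def card_good_levels_Suc c_def)
    have "(\<Sum>E\<in>mat_box M. short_count W (Suc k) (perturb M (Suc k) (grid M k Z) E) * wt (Suc k) (child M Z E))
       = (\<Sum>E\<in>mat_box M. short_count W (Suc k) (perturb M (Suc k) (grid M k Z) E)) * (wt k Z * c)"
      by (simp add: wt sum_distrib_right)
    also have "\<dots> = ((\<Sum>E\<in>mat_box M. short_count W (Suc k) (perturb M (Suc k) (grid M k Z) E)) * c) * wt k Z"
      by (simp add: mult_ac)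
    also have "\<dots> \<le> (T * ?X) * wt k Z"
    proof (rule mult_right_mono[OF _ wt0])
      show "(\<Sum>E\<in>mat_box M. short_count W (Suc k) (perturb M (Suc k) (grid M k Z) E)) * c \<le> T * ?X"
      proof (cases "?X \<le> K")
        case True
        have "(\<Sum>E\<in>mat_box M. short_count W (Suc k) (perturb M (Suc k) (grid M k Z) E))
            \<le> (\<Sum>E\<in>(mat_box M :: (int ^ 'n ^ 'm) set). D * ?X)"
          by (rule sum_mono) (rule thick)
        also have "\<dots> = T * (D * ?X)" by (simp add: card_mat_box T_def)
        finally show ?thesis using True D by (simp add: c_def field_simps)
      next
        case False
        then show ?thesis using cusp[of k "grid M k Z"] by (simp add: c_def)
      qed
    qed
    finally show "(\<Sum>E\<in>mat_box M. short_count W (Suc k) (perturb M (Suc k) (grid M k Z) E) * wt (Suc k) (child M Z E))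
       \<le> T * (?X * wt k Z)" by (simp add: mult_ac)
  qed
  also have "\<dots> = T * (\<Sum>Z\<in>mat_box (M ^ k). short_count W k (grid M k Z) * wt k Z)"
    by (simp add: sum_distrib_left)
  also have "\<dots> \<le> T * (T ^ k * S)"
    using Suc.IH by (intro mult_left_mono) (auto simp: T_def wt_def)
  finally show ?case by (simp add: wt_def mult_ac)
qed

text \<open>Consequently the average of \<open>\<tau>\<close> to the number of good levels decays exponentially, for every
\<open>\<tau> < 1\<close>.\<close>

lemma few_good_levels_rare:
  fixes K D \<tau> :: real and W M :: nat
  assumes W: "W > 0" and M: "M > 0" and D: "1 \<le> D" and \<tau>: "0 < \<tau>" "\<tau> < 1"
    and cusp: "\<And>i (A :: real ^ 'n ^ 'm). K < short_count W i A \<Longrightarrow>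
       (\<Sum>E\<in>mat_box M. short_count W (Suc i) (perturb M (Suc i) A E))
         \<le> real M ^ (CARD('m) * CARD('n)) * (short_count W i A / 2)"
    and thick: "\<And>i (A :: real ^ 'n ^ 'm) E. E \<in> mat_box M \<Longrightarrow>
       short_count W (Suc i) (perturb M (Suc i) A E) \<le> D * short_count W i A"
  shows "\<exists>\<mu> C. 0 < \<mu> \<and> \<mu> < 1 \<and> 0 \<le> C \<and>
     (\<forall>k. (\<Sum>Z\<in>(mat_box (M ^ k) :: (int ^ 'n ^ 'm) set). \<tau> ^ card (good_levels W M K k Z))
        \<le> C * \<mu> ^ k * (real M ^ (CARD('m) * CARD('n))) ^ k)"
proof -
  define T where "T = real M ^ (CARD('m) * CARD('n))"
  define S where "S = (\<Sum>Z\<in>(mat_box 1 :: (int ^ 'n ^ 'm) set). short_count W 0 (grid M 0 Z))"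
  define \<kappa> where "\<kappa> = 1 / (2 * D)"
  have \<kappa>: "0 < \<kappa>" "\<kappa> < 1" using D by (auto simp: \<kappa>_def)
  define \<sigma> where "\<sigma> = min 1 (ln \<tau> / ln \<kappa>)"
  have \<sigma>: "0 < \<sigma>" "\<sigma> \<le> 1" using \<kappa> \<tau> by (auto simp: \<sigma>_def divide_neg_neg)
  have \<tau>\<kappa>: "\<tau> \<le> \<kappa> powr \<sigma>"
  proof -
    have "\<sigma> * ln \<kappa> \<ge> ln \<tau> / ln \<kappa> * ln \<kappa>"
      using \<kappa> by (intro mult_right_mono_neg) (auto simp: \<sigma>_def)
    then have "ln \<tau> \<le> \<sigma> * ln \<kappa>" using \<kappa> by simp
    then show ?thesis using \<kappa> \<tau> by (simp add: powr_def ln_ge_iff[symmetric] mult.commute flip: exp_le_cancel_iff[of "ln \<tau>"])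
  qed
  define \<mu> where "\<mu> = 2 powr (- \<sigma>)"
  have \<mu>: "0 < \<mu>" "\<mu> < 1" using \<sigma> by (auto simp: \<mu>_def powr_minus inverse_eq_divide)
  have S0: "S \<ge> 0" by (simp add: S_def short_count_def sum_nonneg)
  have sm: "(\<Sum>Z\<in>(mat_box (M ^ k) :: (int ^ 'n ^ 'm) set).
           short_count W k (grid M k Z) * (2 ^ k * \<kappa> ^ card (good_levels W M K k Z))) \<le> T ^ k * S" for k
    unfolding \<kappa>_def T_def S_def by (rule supermartingale_bound[OF M D cusp thick])
  have "(\<Sum>Z\<in>(mat_box (M ^ k) :: (int ^ 'n ^ 'm) set). \<tau> ^ card (good_levels W M K k Z))
        \<le> (1 + S) * \<mu> ^ k * T ^ k" for k
  proof -
    have "(\<Sum>Z\<in>(mat_box (M ^ k) :: (int ^ 'n ^ 'm) set). \<tau> ^ card (good_levels W M K k Z))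
       \<le> (\<Sum>Z\<in>(mat_box (M ^ k) :: (int ^ 'n ^ 'm) set).
            \<mu> ^ k * (1 + short_count W k (grid M k Z) * (2 ^ k * \<kappa> ^ card (good_levels W M K k Z))))"
    proof (rule sum_mono)
      fix Z :: "int ^ 'n ^ 'm"
      define c where "c = card (good_levels W M K k Z)"
      define x where "x = 2 ^ k * \<kappa> ^ c"
      have x0: "x > 0" using \<kappa> by (simp add: x_def)
      have "\<tau> ^ c \<le> (\<kappa> powr \<sigma>) ^ c" using \<tau>\<kappa> \<tau> by (intro power_mono) auto
      also have "\<dots> = (\<kappa> ^ c) powr \<sigma>" using \<kappa> by (simp add: powr_power powr_realpow[symmetric] powr_powr mult.commute)
      also have "\<dots> = (x * (1/2) ^ k) powr \<sigma>" by (simp add: x_def power_one_over)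
      also have "\<dots> = x powr \<sigma> * \<mu> ^ k"
        using x0 by (simp add: powr_mult \<mu>_def powr_power power_one_over powr_minus powr_divide powr_realpow[symmetric] powr_powr mult.commute inverse_eq_divide)
      also have "\<dots> \<le> (1 + x) * \<mu> ^ k"
      proof (rule mult_right_mono)
        show "x powr \<sigma> \<le> 1 + x"
        proof (cases "x \<le> 1")
          case True
          then have "x powr \<sigma> \<le> 1 powr \<sigma>" using x0 \<sigma> by (intro powr_mono2) auto
          then show ?thesis using x0 by simp
        next
          case False
          then have "x powr \<sigma> \<le> x powr 1" using \<sigma> by (intro powr_mono) auto
          then show ?thesis using x0 by simp
        qed
        show "0 \<le> \<mu> ^ k" using \<mu> by simp
      qed
      also have "\<dots> \<le> (1 + short_count W k (grid M k Z) * x) * \<mu> ^ k"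
      proof -
        have "1 * x \<le> short_count W k (grid M k Z) * x"
          using short_count_ge_1[OF W] x0 by (intro mult_right_mono) auto
        then show ?thesis using \<mu> by (intro mult_right_mono) auto
      qed
      finally show "\<tau> ^ card (good_levels W M K k Z) \<le>
            \<mu> ^ k * (1 + short_count W k (grid M k Z) * (2 ^ k * \<kappa> ^ card (good_levels W M K k Z)))"
        by (simp add: c_def x_def mult.commute)
    qed
    also have "\<dots> = \<mu> ^ k * (T ^ k + (\<Sum>Z\<in>(mat_box (M ^ k) :: (int ^ 'n ^ 'm) set).
            short_count W k (grid M k Z) * (2 ^ k * \<kappa> ^ card (good_levels W M K k Z))))"
      by (simp add: sum_distrib_left[symmetric] sum.distrib card_mat_box T_def power_mult[symmetric] mult.commute)
    also have "\<dots> \<le> \<mu> ^ k * (T ^ k + T ^ k * S)"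
      using sm[of k] \<mu> by (intro mult_left_mono add_left_mono) auto
    finally show ?thesis by (simp add: algebra_simps)
  qed
  then show ?thesis using \<mu> S0 unfolding T_def by (intro exI[of _ \<mu>] exI[of _ "1 + S"]) auto
qed

section \<open>Inhomogeneous approximation at good levels\<close>

text \<open>If there are at most \<open>K\<close> short vectors at level \<open>i\<close>, then every \<open>y\<close> is approximated by some
\<open>A q - p\<close> at the scale of that level, up to the factor \<open>2 K + 1\<close>. Call \<open>r\<close> a reach of \<open>x\<close> if some
\<open>A q - p\<close> with \<open>q\<close> of size at most \<open>r W ^ (m i)\<close> is within \<open>r W ^ (- n i)\<close> of \<open>x\<close>, and let the rank be the least
reach. Along the segment from \<open>0\<close> to a point \<open>y\<close> of rank above \<open>2 K + 1\<close> the rank grows by at most one per step, so there are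
points \<open>\<xi> 0, \<dots>, \<xi> K\<close> of ranks \<open>0, 2, \<dots>, 2 K\<close>. The translates by them of the points
\<open>A q\<close>, for \<open>q\<close> in a box of side \<open>W ^ (m i)\<close>, are \<open>K + 1\<close> times as many as there are cells of side
\<open>W ^ (- n i)\<close> modulo \<open>1\<close>. So a cell contains more than \<open>K\<close> of them; these cannot
come from different \<open>\<xi> t\<close>, whose ranks differ by at least \<open>2\<close>, and their differences give more than \<open>K\<close> short vectors.\<close>

lemma inhomogeneous_covering:
  fixes A :: "real ^ 'n ^ 'm" and y :: "real ^ 'm"
  assumes W: "W > 0" and K: "short_count W i A \<le> real K"
  shows "\<exists>z. (\<forall>b. \<bar>of_int (snd z $ b)\<bar> \<le> (2 * real K + 1) * real W ^ (CARD('m) * i)) \<and>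
     (\<forall>a. \<bar>(A *v rvec (snd z) - rvec (fst z) - y) $ a\<bar> \<le> (2 * real K + 1) / real W ^ (CARD('n) * i))"
proof (rule ccontr)
  assume contra: "\<not> ?thesis"
  define Q where "Q = W ^ (CARD('m) * i)"
  define L where "L = W ^ (CARD('n) * i)"
  have Q0: "Q > 0" and L0: "L > 0" using W by (auto simp: Q_def L_def)
  define G where "G z = A *v rvec (snd z) - rvec (fst z)" for z :: "(int ^ 'm) \<times> (int ^ 'n)"
  have G_diff: "G (z - z') = G z - G z'" for z z'
    by (simp add: G_def rvec_diff matrix_vector_mult_diff_distrib)
  have G_minus: "G (- z) = - G z" for z
    using G_diff[of 0 z] G_diff[of 0 0] by simp
  have G_add: "G (z + z') = G z + G z'" for z z'
    using G_diff[of z "- z'"] by (simp add: G_minus)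
  define reach where "reach r x \<longleftrightarrow> (\<exists>z. (\<forall>b. \<bar>real_of_int (snd z $ b)\<bar> \<le> real r * real Q) \<and>
      (\<forall>a. \<bar>(G z - x) $ a\<bar> \<le> real r / real L))" for r and x
  have not_reach: "\<not> reach (2 * K + 1) y"
  proof -
    have "real (2 * K + 1) = 2 * real K + 1" by simp
    then show ?thesis using contra unfolding reach_def G_def Q_def L_def by (simp only: of_nat_power not_False_eq_True)
  qed
  have reach_add: "reach (r + s) (x + x')" if r: "reach r x" and s: "reach s x'" for r s x x'
  proof -
    obtain z where z: "\<And>b. \<bar>real_of_int (snd z $ b)\<bar> \<le> real r * real Q" "\<And>a. \<bar>(G z - x) $ a\<bar> \<le> real r / real L"
      using r unfolding reach_def by blast
    obtain z' where z': "\<And>b. \<bar>real_of_int (snd z' $ b)\<bar> \<le> real s * real Q" "\<And>a. \<bar>(G z' - x') $ a\<bar> \<le> real s / real L"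
      using s unfolding reach_def by blast
    show ?thesis unfolding reach_def
    proof (intro exI[of _ "z + z'"] conjI allI)
      fix b show "\<bar>real_of_int (snd (z + z') $ b)\<bar> \<le> real (r + s) * real Q"
        using z(1)[of b] z'(1)[of b] by (simp add: distrib_right)
    next
      fix a show "\<bar>(G (z + z') - (x + x')) $ a\<bar> \<le> real (r + s) / real L"
        using z(2)[of a] z'(2)[of a] by (simp add: G_add add_divide_distrib)
    qed
  qed
  have reach_minus: "reach r (- x)" if r: "reach r x" for r x
  proof -
    obtain z where z: "\<And>b. \<bar>real_of_int (snd z $ b)\<bar> \<le> real r * real Q" "\<And>a. \<bar>(G z - x) $ a\<bar> \<le> real r / real L"
      using r unfolding reach_def by blast
    show ?thesis unfolding reach_def
    proof (intro exI[of _ "- z"] conjI allI)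
      fix b show "\<bar>real_of_int (snd (- z) $ b)\<bar> \<le> real r * real Q" using z(1)[of b] by simp
    next
      fix a show "\<bar>(G (- z) - (- x)) $ a\<bar> \<le> real r / real L" using z(2)[of a] by (simp add: G_minus)
    qed
  qed
  have reach_trivial: "reach r x" if "\<And>a. \<bar>x $ a\<bar> \<le> real r / real L" for r x
    unfolding reach_def using that Q0
    by (intro exI[of _ 0]) (auto simp: G_def matrix_vector_mult_def)
  have reach_ex: "\<exists>r. reach r x" for x
  proof -
    obtain a0 where a0: "\<And>a. \<bar>x $ a\<bar> \<le> \<bar>x $ a0\<bar>" using ex_max_coord[of "\<lambda>a. \<bar>x $ a\<bar>"] by blast
    define r where "r = nat \<lceil>\<bar>x $ a0\<bar> * real L\<rceil>"
    have "\<bar>x $ a0\<bar> * real L \<le> real r" unfolding r_def by linarith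
    then have "\<bar>x $ a0\<bar> \<le> real r / real L" using L0 by (simp add: pos_le_divide_eq)
    then have "reach r x" by - (rule reach_trivial, rule order_trans[OF a0])
    then show ?thesis ..
  qed
  define rank where "rank x = (LEAST r. reach r x)" for x
  have reach_rank: "reach (rank x) x" for x unfolding rank_def using reach_ex[of x] by (rule LeastI_ex)
  have rank_le: "rank x \<le> r" if "reach r x" for x r unfolding rank_def using that by (rule Least_le)
  have reach_mono: "reach r x" if "reach s x" "s \<le> r" for r s x
  proof -
    have "reach (r - s) 0" by (rule reach_trivial) simp
    from reach_add[OF this that(1)] show ?thesis using that(2) by simp
  qed
  have rank_y: "2 * K + 1 < rank y"
    using not_reach reach_mono[OF reach_rank[of y]] by (meson not_le)
  obtain N where N: "N > 0" "\<And>a. \<bar>y $ a\<bar> * real L \<le> real N"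
  proof -
    obtain a0 where a0: "\<And>a. \<bar>y $ a\<bar> \<le> \<bar>y $ a0\<bar>" using ex_max_coord[of "\<lambda>a. \<bar>y $ a\<bar>"] by blast
    show ?thesis
    proof (rule that[of "Suc (nat \<lceil>\<bar>y $ a0\<bar> * real L\<rceil>)"])
      fix a
      have "\<bar>y $ a\<bar> * real L \<le> \<bar>y $ a0\<bar> * real L" using a0 by (intro mult_right_mono) auto
      then show "\<bar>y $ a\<bar> * real L \<le> real (Suc (nat \<lceil>\<bar>y $ a0\<bar> * real L\<rceil>))" by linarith
    qed simp
  qed
  define x where "x s = (real s / real N) *\<^sub>R y" for s
  have rank_step: "rank (x (Suc s)) \<le> rank (x s) + 1" for s
  proof -
    have "reach 1 ((1 / real N) *\<^sub>R y)"
      using N L0 by (intro reach_trivial) (simp add: abs_mult field_simps)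
    from reach_add[OF reach_rank[of "x s"] this] have "reach (rank (x s) + 1) (x (Suc s))"
      by (simp add: x_def add_divide_distrib scaleR_add_left add.commute)
    then show ?thesis by (rule rank_le)
  qed
  have rank_x0: "rank (x 0) = 0"
  proof -
    have "reach 0 (x 0)" by (rule reach_trivial) (simp add: x_def)
    from rank_le[OF this] show ?thesis by simp
  qed
  have "\<exists>s. rank (x s) = 2 * t" if t: "t \<le> K" for t
  proof -
    have ex: "2 * t \<le> rank (x N)" using rank_y N(1) t by (simp add: x_def)
    define s where "s = (LEAST s. 2 * t \<le> rank (x s))"
    have s1: "2 * t \<le> rank (x s)" unfolding s_def by (rule LeastI[of "\<lambda>s. 2 * t \<le> rank (x s)", OF ex])
    have "rank (x s) \<le> 2 * t"
    proof (cases s)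
      case 0 then show ?thesis using rank_x0 by simp
    next
      case (Suc s')
      then have "\<not> 2 * t \<le> rank (x s')" using not_less_Least[of s' "\<lambda>s. 2 * t \<le> rank (x s)"] by (simp add: s_def)
      then show ?thesis using rank_step[of s'] Suc by simp
    qed
    with s1 show ?thesis by (metis le_antisym)
  qed
  then obtain \<xi>0 where \<xi>0: "\<And>t. t \<le> K \<Longrightarrow> rank (x (\<xi>0 t)) = 2 * t" by metis
  define \<xi> where "\<xi> t = x (\<xi>0 t)" for t
  have \<xi>: "rank (\<xi> t) = 2 * t" if "t \<le> K" for t using \<xi>0 that by (simp add: \<xi>_def)
  define V where "V t q a = (A *v rvec q) $ a + \<xi> t $ a" for t and q :: "int ^ 'n" and a
  define f where "f = (\<lambda>(t, q). (\<chi> a. \<lfloor>real L * frac (V t q a)\<rfloor>) :: int ^ 'm)"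
  let ?Dom = "{..K} \<times> (int_box Q :: (int ^ 'n) set)"
  have same: "\<exists>p. (\<forall>b. \<bar>real_of_int ((q - q') $ b)\<bar> \<le> real Q) \<and>
       (\<forall>a. \<bar>(G (p, q - q') - (\<xi> t' - \<xi> t)) $ a\<bar> \<le> 1 / real L)"
    if q: "q \<in> int_box Q" "q' \<in> int_box Q" and eq: "f (t, q) = f (t', q')" for t t' q q'
  proof -
    define p :: "int ^ 'm" where "p = (\<chi> a. \<lfloor>V t q a\<rfloor> - \<lfloor>V t' q' a\<rfloor>)"
    have "\<bar>(G (p, q - q') - (\<xi> t' - \<xi> t)) $ a\<bar> \<le> 1 / real L" for a
    proof -
      have "\<lfloor>real L * frac (V t q a)\<rfloor> = \<lfloor>real L * frac (V t' q' a)\<rfloor>"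
        using arg_cong[OF eq, of "\<lambda>v. v $ a"] by (simp add: f_def)
      then have "\<bar>real L * frac (V t q a) - real L * frac (V t' q' a)\<bar> \<le> 1" by (rule floor_eq_abs_diff)
      then have "real L * \<bar>frac (V t q a) - frac (V t' q' a)\<bar> \<le> 1"
        by (simp add: abs_mult flip: right_diff_distrib)
      then have "\<bar>frac (V t q a) - frac (V t' q' a)\<bar> \<le> 1 / real L" using L0 by (simp add: field_simps)
      moreover have "(G (p, q - q') - (\<xi> t' - \<xi> t)) $ a = frac (V t q a) - frac (V t' q' a)"
        by (simp add: G_def p_def frac_def V_def rvec_diff matrix_vector_mult_diff_distrib)
      ultimately show ?thesis by simp
    qed
    moreover have "\<bar>real_of_int ((q - q') $ b)\<bar> \<le> real Q" for b
    proof -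
      have "0 \<le> q $ b" "q $ b < int Q" "0 \<le> q' $ b" "q' $ b < int Q" using q by (auto simp: int_box_def)
      then have "\<bar>(q - q') $ b\<bar> \<le> int Q" by simp
      then show ?thesis by (metis of_int_abs of_int_le_iff of_int_of_nat_eq)
    qed
    ultimately show ?thesis by blast
  qed
  have t_eq: "t = t'"
    if q: "q \<in> int_box Q" "q' \<in> int_box Q" and eq: "f (t, q) = f (t', q')" and t: "t \<le> K" "t' \<le> K" for t t' q q'
  proof -
    obtain p where p: "\<And>b. \<bar>real_of_int ((q - q') $ b)\<bar> \<le> real Q"
        "\<And>a. \<bar>(G (p, q - q') - (\<xi> t' - \<xi> t)) $ a\<bar> \<le> 1 / real L"
      using same[OF q eq] by blast
    have r1: "reach 1 (\<xi> t' - \<xi> t)"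
      unfolding reach_def using p by (intro exI[of _ "(p, q - q')"]) simp
    have "reach (2 * t + 1) (\<xi> t')" using reach_add[OF reach_rank[of "\<xi> t"] r1] \<xi>[OF t(1)] by simp
    then have "2 * t' \<le> 2 * t + 1" using rank_le[of "2 * t + 1" "\<xi> t'"] \<xi>[OF t(2)] by simp
    moreover have "reach (2 * t' + 1) (\<xi> t)"
      using reach_add[OF reach_rank[of "\<xi> t'"] reach_minus[OF r1]] \<xi>[OF t(2)] by simp
    then have "2 * t \<le> 2 * t' + 1" using rank_le[of "2 * t' + 1" "\<xi> t"] \<xi>[OF t(1)] by simp
    ultimately show ?thesis by linarith
  qed
  have "real (card ?Dom) \<le> real (card (int_box L :: (int ^ 'm) set)) * real K"
  proof (rule card_le_fibres[where f = f])
    show "f ` ?Dom \<subseteq> int_box L"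
    proof (rule image_subsetI)
      fix u assume "u \<in> ?Dom"
      obtain t q where u: "u = (t, q)" by (cases u)
      have "\<lfloor>real L * frac (V t q a)\<rfloor> < int L" "0 \<le> \<lfloor>real L * frac (V t q a)\<rfloor>" for a
        using L0 frac_lt_1[of "V t q a"] frac_ge_0[of "V t q a"] by (auto simp: floor_less_iff)
      then show "f u \<in> int_box L" by (auto simp: f_def u int_box_def)
    qed
    fix v
    let ?F = "{u \<in> ?Dom. f u = v}"
    show "real (card ?F) \<le> real K"
    proof (cases "?F = {}")
      case True then show ?thesis by (simp only: card.empty)
    next
      case False
      then obtain t0 q0 where t0: "t0 \<le> K" "q0 \<in> int_box Q" "f (t0, q0) = v" by auto
      have ex: "\<exists>p. (p, snd u - q0) \<in> sup_ball (lat W i A) 1 \<and> fst u = t0" if True: "u \<in> ?F" for u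
      proof -
        obtain t q where u: "u = (t, q)" by (cases u)
        have tq: "t \<le> K" "q \<in> int_box Q" "f (t, q) = f (t0, q0)" using True t0 by (auto simp: u)
        have t: "t = t0" using t_eq[OF tq(2) t0(2) tq(3) tq(1) t0(1)] .
        obtain p where p: "\<And>b. \<bar>real_of_int ((q - q0) $ b)\<bar> \<le> real Q"
            "\<And>a. \<bar>(G (p, q - q0) - (\<xi> t0 - \<xi> t)) $ a\<bar> \<le> 1 / real L"
          using same[OF tq(2) t0(2) tq(3)] by blast
        have "(p, q - q0) \<in> sup_ball (lat W i A) 1"
          unfolding in_lat_ball_iff[OF W]
        proof (intro conjI allI)
          fix a
          have "\<bar>G (p, q - q0) $ a\<bar> \<le> 1 / real L" using p(2)[of a] t by simp
          then have "real L * \<bar>G (p, q - q0) $ a\<bar> \<le> 1" using L0 by (simp add: field_simps)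
          then show "real W ^ (CARD('n) * i) * \<bar>(A *v rvec (snd (p, q - q0))) $ a - of_int (fst (p, q - q0) $ a)\<bar> \<le> 1"
            by (simp add: G_def L_def)
        next
          fix b show "\<bar>of_int (snd (p, q - q0) $ b)\<bar> \<le> 1 * real W ^ (CARD('m) * i)"
            using p(1)[of b] by (simp add: Q_def)
        qed
        then show ?thesis using t u by auto
      qed
      define P where "P u = (SOME p. (p, snd u - q0) \<in> sup_ball (lat W i A) 1 \<and> fst u = t0)" for u
      have P: "(P u, snd u - q0) \<in> sup_ball (lat W i A) 1 \<and> fst u = t0" if "u \<in> ?F" for u
        unfolding P_def by (rule someI_ex) (rule ex[OF that])
      have "card ?F \<le> card (sup_ball (lat W i A) 1)"
      proof (rule card_inj_on_le[where f = "\<lambda>u. (P u, snd u - q0)"])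
        show "inj_on (\<lambda>u. (P u, snd u - q0)) ?F"
        proof (rule inj_onI)
          fix u u' assume u: "u \<in> ?F" "u' \<in> ?F" and eq: "(P u, snd u - q0) = (P u', snd u' - q0)"
          have "fst u = fst u'" using P[OF u(1)] P[OF u(2)] by simp
          moreover have "snd u = snd u'" using eq by simp
          ultimately show "u = u'" by (rule prod_eqI)
        qed
        show "(\<lambda>u. (P u, snd u - q0)) ` ?F \<subseteq> sup_ball (lat W i A) 1" using P by (intro image_subsetI) simp
        show "finite (sup_ball (lat W i A) 1)" by (rule finite_lat_ball[OF W])
      qed
      then show ?thesis using K by (simp add: short_count_def)
    qed
  qed auto
  then have le: "(real K + 1) * real (card (int_box Q :: (int ^ 'n) set)) \<le> real (card (int_box L :: (int ^ 'm) set)) * real K"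
    by (simp only: card_cartesian_product card_atMost of_nat_mult of_nat_Suc add.commute)
  have "CARD('n) * i * CARD('m) = CARD('m) * i * CARD('n)" by (simp only: mult.commute mult.left_commute)
  then have "card (int_box L :: (int ^ 'm) set) = card (int_box Q :: (int ^ 'n) set)"
    by (simp only: card_int_box L_def Q_def power_mult[symmetric])
  then have "(real K + 1) * real (card (int_box Q :: (int ^ 'n) set)) \<le> real (card (int_box Q :: (int ^ 'n) set)) * real K"
    using le by (simp only:)
  moreover have "card (int_box Q :: (int ^ 'n) set) > 0" using Q0 by (simp add: card_int_box)
  ultimately show False by (simp only: distrib_right) (simp add: mult.commute)
qed

lemma rvec_in_int_vectors: "rvec p \<in> int_vectors"
  by (simp add: int_vectors_def)

lemma dist_to_int_le: "dist_to_int v \<le> norm (v - rvec p)"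
  unfolding dist_to_int_def
  by (rule cINF_lower[OF _ rvec_in_int_vectors]) (auto intro!: bdd_belowI[of _ 0])

lemma dist_to_int_nonneg: "0 \<le> dist_to_int v"
  unfolding dist_to_int_def
  by (rule cINF_greatest) (use rvec_in_int_vectors in auto)

lemma norm_le_card_mult:
  fixes v :: "real ^ 'k"
  assumes "\<And>a. \<bar>v $ a\<bar> \<le> r"
  shows "norm v \<le> real CARD('k) * r"
proof -
  have "norm v \<le> (\<Sum>a\<in>UNIV. \<bar>v $ a\<bar>)" by (rule norm_le_l1_cart)
  also have "\<dots> \<le> (\<Sum>a\<in>(UNIV::'k set). r)" by (rule sum_mono) (rule assms)
  finally show ?thesis by simp
qed

lemma abs_matrix_vector_diff_le:
  fixes A A' :: "real ^ 'n ^ 'm"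
  assumes "\<And>a b. \<bar>A $ a $ b - A' $ a $ b\<bar> \<le> s" "\<And>b. \<bar>v $ b\<bar> \<le> r" "0 \<le> s"
  shows "\<bar>(A *v v) $ a - (A' *v v) $ a\<bar> \<le> real CARD('n) * (s * r)"
proof -
  have "\<bar>(A *v v) $ a - (A' *v v) $ a\<bar> = \<bar>\<Sum>b\<in>UNIV. (A $ a $ b - A' $ a $ b) * v $ b\<bar>"
    by (simp add: matrix_vector_mult_def left_diff_distrib sum_subtractf)
  also have "\<dots> \<le> (\<Sum>b\<in>UNIV. \<bar>(A $ a $ b - A' $ a $ b) * v $ b\<bar>)" by (rule sum_abs)
  also have "\<dots> \<le> (\<Sum>b\<in>(UNIV::'n set). s * r)"
    unfolding abs_mult using assms by (intro sum_mono mult_mono) auto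
  finally show ?thesis by simp
qed

text \<open>At a good level \<open>i\<close>, every box of targets \<open>b\<close> of level \<open>i - h\<close> contains a box of level \<open>i + h\<close> all of
whose points are approximated too well: some \<open>A q - p\<close> falls well inside the large box, and the
small box containing it is the required one. The matrix \<open>A0\<close> is the corner of the box of level \<open>i\<close>, while \<open>A1\<close> is
the corner of a much smaller box, so that \<open>A1 q - p\<close> locates the small box independently of the choice
of \<open>A\<close> in it. Boxes of level \<open>j\<close> for \<open>b\<close> have side \<open>W ^ (- n j)\<close>.\<close>

lemma dead_subbox:
  fixes \<epsilon> :: real
  assumes W: "2 \<le> W" and M: "M = W ^ (CARD('m) + CARD('n))" and \<epsilon>: "0 < \<epsilon>"
  shows "\<exists>h\<ge>1. \<forall>i (A0 :: real ^ 'n ^ 'm) A1 (B :: int ^ 'm).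
     h \<le> i \<longrightarrow> short_count W i A0 \<le> real K \<longrightarrow>
     (\<forall>a b. \<bar>A1 $ a $ b - A0 $ a $ b\<bar> \<le> 1 / real M ^ i) \<longrightarrow>
     (\<exists>B'. (\<forall>a. B' $ a div int (W ^ (CARD('n) * (2 * h))) = B $ a) \<and>
        (\<forall>A b. (\<forall>a c. \<bar>A $ a $ c - A1 $ a $ c\<bar> \<le> 1 / real M ^ (i + h)) \<longrightarrow>
               (\<forall>a. \<lfloor>real W ^ (CARD('n) * (i + h)) * b $ a\<rfloor> = B' $ a) \<longrightarrow>
            (\<exists>q. real W ^ (CARD('m) * i) \<le> norm (rvec q) \<and>
                 norm (rvec q) powr (real CARD('n) / real CARD('m)) * dist_to_int (A *v rvec q - b) < \<epsilon>)))"
proof -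
  define n where "n = CARD('n)"
  define m where "m = CARD('m)"
  have n0: "n \<ge> 1" and m0: "m \<ge> 1" by (auto simp: n_def m_def Suc_le_eq)
  define w where "w = real W"
  have w2: "w \<ge> 2" using W by (simp add: w_def)
  then have w0: "w > 0" by simp
  have Mw: "real M = w ^ m * w ^ n" by (simp add: M w_def m_def n_def power_add)
  have W0: "W > 0" using W by simp
  define r where "r = 2 * real K + 1"
  have r1: "r \<ge> 1" by (simp add: r_def)
  define s where "s = real n * (2 * r + 1)"
  have s1: "s \<ge> 1"
  proof -
    have "1 * 1 \<le> real n * (2 * r + 1)" using n0 r1 by (intro mult_mono) auto
    then show ?thesis by (simp add: s_def)
  qed
  define c1 where "c1 = s powr (real n / real m) * (real m * (s + 1))"
  have c1: "c1 \<ge> 0" using s1 by (simp add: c1_def)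
  obtain h0 where h0: "4 * (r + s) + c1 / \<epsilon> < 2 ^ h0" using real_arch_pow[of 2] by auto
  define h where "h = max h0 1"
  have hpow: "4 * (r + s) + c1 / \<epsilon> < w ^ (n * h)"
  proof -
    have "(2::real) ^ h0 \<le> 2 ^ h" by (intro power_increasing) (auto simp: h_def)
    also have "\<dots> \<le> w ^ h" using w2 by (intro power_mono) auto
    also have "\<dots> \<le> w ^ (n * h)" using w2 n0 by (intro power_increasing) auto
    finally show ?thesis using h0 by simp
  qed
  have hr: "4 * (r + s) \<le> w ^ (n * h)" using hpow c1 \<epsilon> by (smt (verit) divide_nonneg_pos)
  have h\<epsilon>: "c1 / w ^ (n * h) < \<epsilon>"
  proof -
    have "c1 / \<epsilon> < w ^ (n * h)" using hpow by (rule le_less_trans[rotated]) (use r1 s1 in simp)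
    then show ?thesis using \<epsilon> w0 by (simp add: field_simps)
  qed
  show ?thesis
  proof (intro exI[of _ h] conjI allI impI)
    show "1 \<le> h" by (simp add: h_def)
    fix i and A0 A1 :: "real ^ 'n ^ 'm" and B :: "int ^ 'm"
    assume hi: "h \<le> i" and sc: "short_count W i A0 \<le> real K"
      and A1: "\<forall>a b. \<bar>A1 $ a $ b - A0 $ a $ b\<bar> \<le> 1 / real M ^ i"
    define Q where "Q = w ^ (m * i)"
    define L where "L = w ^ (n * i)"
    have Q0: "Q > 0" and L0: "L > 0" using w0 by (auto simp: Q_def L_def)
    have Mpow: "real M ^ j = w ^ (m * j) * w ^ (n * j)" for j by (simp only: Mw power_mult_distrib power_mult)
    define Li where "Li = w ^ (n * (i - h))"
    have Li0: "Li > 0" using w0 by (simp add: Li_def)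
    have LLi: "L = Li * w ^ (n * h)"
    proof -
      have "n * i = n * (i - h) + n * h" using hi by (simp add: diff_mult_distrib2)
      then show ?thesis by (simp add: L_def Li_def power_add)
    qed
    define c :: "real ^ 'm" where "c = (\<chi> a. (of_int (B $ a) + 1/2) / Li)"
    \<comment> \<open>The target is shifted by \<open>A0 q0\<close> to force all entries of the solution \<open>q\<close> to be large.\<close>
    define q0 :: "int ^ 'n" where "q0 = (\<chi> b. (2 * int K + 2) * int W ^ (m * i))"
    have q0: "real_of_int (q0 $ b) = (r + 1) * Q" for b by (simp add: q0_def r_def Q_def w_def)
    obtain z where z: "\<And>b. \<bar>of_int (snd z $ b)\<bar> \<le> r * Q"
        "\<And>a. \<bar>(A0 *v rvec (snd z) - rvec (fst z) - (c - A0 *v rvec q0)) $ a\<bar> \<le> r / L"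
      using inhomogeneous_covering[OF W0 sc, of "c - A0 *v rvec q0"]
      unfolding r_def Q_def L_def w_def m_def n_def by blast
    define q where "q = snd z + q0"
    define p where "p = fst z"
    have q_lo: "Q \<le> real_of_int (q $ b)" and q_hi: "\<bar>real_of_int (q $ b)\<bar> \<le> (2 * r + 1) * Q" for b
    proof -
      have "0 \<le> r * Q" using r1 Q0 by simp
      then show "Q \<le> real_of_int (q $ b)" and "\<bar>real_of_int (q $ b)\<bar> \<le> (2 * r + 1) * Q"
        using z(1)[of b] q0[of b] Q0 by (simp_all add: q_def distrib_right abs_le_iff) (simp add: mult.commute)
    qed
    have near0: "\<bar>(A0 *v rvec q) $ a - of_int (p $ a) - c $ a\<bar> \<le> r / L" for a
      using z(2)[of a] by (simp add: q_def p_def rvec_add matrix_vector_right_distrib algebra_simps)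
    define Y where "Y a = (A1 *v rvec q) $ a - of_int (p $ a)" for a
    have near1: "\<bar>Y a - c $ a\<bar> \<le> (r + s) / L" for a
    proof -
      have "\<bar>(A1 *v rvec q) $ a - (A0 *v rvec q) $ a\<bar> \<le> real CARD('n) * (1 / real M ^ i * ((2 * r + 1) * Q))"
        using A1 q_hi by (intro abs_matrix_vector_diff_le) auto
      also have "\<dots> = s / L" using Q0 L0 unfolding Mpow by (simp add: s_def n_def Q_def L_def)
      finally show ?thesis using near0[of a] by (simp add: Y_def add_divide_distrib)
    qed
    define B' :: "int ^ 'm" where "B' = (\<chi> a. \<lfloor>w ^ (n * (i + h)) * Y a\<rfloor>)"
    show "\<exists>B'. (\<forall>a. B' $ a div int (W ^ (CARD('n) * (2 * h))) = B $ a) \<and>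
        (\<forall>A b. (\<forall>a c. \<bar>A $ a $ c - A1 $ a $ c\<bar> \<le> 1 / real M ^ (i + h)) \<longrightarrow>
               (\<forall>a. \<lfloor>real W ^ (CARD('n) * (i + h)) * b $ a\<rfloor> = B' $ a) \<longrightarrow>
            (\<exists>q. real W ^ (CARD('m) * i) \<le> norm (rvec q) \<and>
                 norm (rvec q) powr (real CARD('n) / real CARD('m)) * dist_to_int (A *v rvec q - b) < \<epsilon>))"
    proof (intro exI[of _ B'] exI[of _ q] conjI allI impI)
      fix a
      have "\<bar>Li * Y a - (of_int (B $ a) + 1/2)\<bar> \<le> 1 / 4"
      proof -
        have "Li * Y a - (of_int (B $ a) + 1/2) = Li * (Y a - c $ a)" using Li0 by (simp add: c_def field_simps)
        then have "\<bar>Li * Y a - (of_int (B $ a) + 1/2)\<bar> = Li * \<bar>Y a - c $ a\<bar>" using Li0 by (simp add: abs_mult)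
        also have "\<dots> \<le> Li * ((r + s) / L)" using near1 Li0 by (intro mult_left_mono) auto
        also have "\<dots> = (r + s) / w ^ (n * h)" using Li0 by (simp add: LLi)
        also have "\<dots> \<le> 1 / 4" using hr w0 by (simp add: field_simps)
        finally show ?thesis .
      qed
      then have fl: "\<lfloor>Li * Y a\<rfloor> = B $ a" by linarith
      have e1: "w ^ (n * (i + h)) * Y a = (Li * Y a) * w ^ (n * (2 * h))"
      proof -
        have "n * (i + h) = n * (i - h) + n * (2 * h)" using hi by (simp add: algebra_simps diff_mult_distrib2)
        then show ?thesis by (simp add: Li_def power_add)
      qed
      have e2: "real_of_int (int (W ^ (n * (2 * h)))) = w ^ (n * (2 * h))" by (simp add: w_def)
      have "Li * Y a = w ^ (n * (i + h)) * Y a / of_int (int (W ^ (n * (2 * h))))"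
        unfolding e1 e2 using w0 by simp
      then have "\<lfloor>Li * Y a\<rfloor> = \<lfloor>w ^ (n * (i + h)) * Y a\<rfloor> div int (W ^ (n * (2 * h)))"
        by (simp only: floor_divide_real_eq_div of_nat_0_le_iff)
      then show "B' $ a div int (W ^ (CARD('n) * (2 * h))) = B $ a" using fl by (simp add: B'_def n_def)
    next
      fix A b
      have "Q \<le> norm (rvec q)"
        using q_lo[of undefined] component_le_norm_cart[of "rvec q" undefined] by simp
      then show "real W ^ (CARD('m) * i) \<le> norm (rvec q)" by (simp add: Q_def w_def m_def)
    next
      fix A :: "real ^ 'n ^ 'm" and b :: "real ^ 'm"
      assume A: "\<forall>a c. \<bar>A $ a $ c - A1 $ a $ c\<bar> \<le> 1 / real M ^ (i + h)"
        and b: "\<forall>a. \<lfloor>real W ^ (CARD('n) * (i + h)) * b $ a\<rfloor> = B' $ a"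
      have near: "\<bar>(A *v rvec q - b - rvec p) $ a\<bar> \<le> (s + 1) / (L * w ^ (n * h))" for a
      proof -
        have wL: "w ^ (n * (i + h)) = L * w ^ (n * h)" by (simp add: L_def power_add distrib_left)
        have "\<bar>(A *v rvec q) $ a - (A1 *v rvec q) $ a\<bar> \<le> real CARD('n) * (1 / real M ^ (i + h) * ((2 * r + 1) * Q))"
          using A q_hi by (intro abs_matrix_vector_diff_le) auto
        also have "\<dots> = s * (Q / w ^ (m * (i + h))) / (L * w ^ (n * h))"
          using Q0 L0 unfolding Mpow wL by (simp add: s_def n_def)
        also have "\<dots> \<le> s * 1 / (L * w ^ (n * h))"
        proof (intro divide_right_mono mult_left_mono)
          have "Q \<le> w ^ (m * (i + h))" unfolding Q_def using w2 by (intro power_increasing) auto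
          then show "Q / w ^ (m * (i + h)) \<le> 1" using w0 by simp
        qed (use s1 L0 w0 in auto)
        finally have 1: "\<bar>(A *v rvec q) $ a - (A1 *v rvec q) $ a\<bar> \<le> s / (L * w ^ (n * h))" by simp
        have "\<lfloor>w ^ (n * (i + h)) * b $ a\<rfloor> = \<lfloor>w ^ (n * (i + h)) * Y a\<rfloor>"
          using b by (simp add: B'_def w_def n_def)
        then have "\<bar>w ^ (n * (i + h)) * b $ a - w ^ (n * (i + h)) * Y a\<bar> \<le> 1" by (rule floor_eq_abs_diff)
        then have "w ^ (n * (i + h)) * \<bar>b $ a - Y a\<bar> \<le> 1" using w0 by (simp add: abs_mult flip: right_diff_distrib)
        then have "\<bar>b $ a - Y a\<bar> \<le> 1 / w ^ (n * (i + h))" using w0 by (simp add: pos_le_divide_eq mult.commute)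
        then have 2: "\<bar>b $ a - Y a\<bar> \<le> 1 / (L * w ^ (n * h))" by (simp only: wL)
        show ?thesis using 1 2 by (simp add: Y_def add_divide_distrib)
      qed
      have d: "dist_to_int (A *v rvec q - b) \<le> real m * ((s + 1) / (L * w ^ (n * h)))"
        unfolding m_def by (rule order_trans[OF dist_to_int_le norm_le_card_mult]) (rule near)
      have nq: "norm (rvec q) \<le> s * Q"
      proof -
        have "norm (rvec q) \<le> real CARD('n) * ((2 * r + 1) * Q)"
          by (rule norm_le_card_mult) (use q_hi in simp)
        then show ?thesis by (simp add: s_def n_def)
      qed
      have QL: "Q powr (real n / real m) = L"
      proof -
        have "Q powr (real n / real m) = w powr (real (m * i) * (real n / real m))"
          using w0 by (simp add: Q_def powr_powr flip: powr_realpow)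
        also have "real (m * i) * (real n / real m) = real (n * i)" using m0 by simp
        also have "w powr real (n * i) = L" by (simp only: L_def powr_realpow[OF w0])
        finally show ?thesis .
      qed
      have "norm (rvec q) powr (real n / real m) * dist_to_int (A *v rvec q - b)
         \<le> (s * Q) powr (real n / real m) * (real m * ((s + 1) / (L * w ^ (n * h))))"
        using nq d by (intro mult_mono powr_mono2) (auto simp: dist_to_int_nonneg)
      also have "\<dots> = c1 / w ^ (n * h)"
        using s1 Q0 L0 by (simp add: powr_mult QL c1_def)
      also have "\<dots> < \<epsilon>" by (rule h\<epsilon>)
      finally show "norm (rvec q) powr (real CARD('n) / real CARD('m)) * dist_to_int (A *v rvec q - b) < \<epsilon>"
        by (simp add: n_def m_def)
    qed
  qed
qed

text \<open>The drops at different \<open>i\<close> in \<open>G\<close> overlap when the windows from \<open>i - h\<close> to \<open>i + h\<close> do; counting each with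
weight \<open>1 / (2 h)\<close>, that is, writing the drop as \<open>\<tau> ^ (2 h)\<close>, compensates for this.\<close>

lemma decay_of_sequence:
  fixes y :: "nat \<Rightarrow> real" and \<theta> \<tau> :: real
  assumes mono: "\<And>j. j < k \<Longrightarrow> y (Suc j) \<le> y j" and y0: "y 0 \<le> 1" 
    and \<tau>: "0 < \<tau>" "\<tau> < 1" and h: "1 \<le> h"
    and drop: "\<And>i. i \<in> G \<Longrightarrow> i0 \<le> i \<Longrightarrow> h \<le> i \<Longrightarrow> i + h \<le> k \<Longrightarrow> y (i + h) \<le> \<tau> ^ (2 * h) * y (i - h)"
    and G: "G \<subseteq> {..<k}"
  shows "y k \<le> \<tau> powr (real (card G) - real (3 * h + i0))"
proof -
  have finG: "finite G" using G finite_subset by blast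
  define g where "g i = card (G \<inter> {..<i})" for i
  have g_le: "g i \<le> i" for i unfolding g_def using card_mono[of "{..<i}" "G \<inter> {..<i}"] by simp
  have g_Suc: "g (Suc i) = g i + (if i \<in> G then 1 else 0)" for i
  proof -
    have "G \<inter> {..<Suc i} = (if i \<in> G then insert i (G \<inter> {..<i}) else G \<inter> {..<i})"
      by (auto simp: less_Suc_eq)
    then show ?thesis by (simp add: g_def finG)
  qed
  have g_add: "g (i + j) \<le> g i + j" for i j by (induction j) (auto simp: g_Suc)
  have y_le: "y j \<le> 1" if "j \<le> k" for j using that
  proof (induction j)
    case (Suc j) then show ?case using mono[of j] by simp
  qed (use y0 in simp)
  define e where "e = 2 * h + i0"
  have big: "1 \<le> \<tau> powr (real a - real e)" if "a \<le> e" for a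
  proof -
    have "\<tau> powr 0 \<le> \<tau> powr (real a - real e)" using \<tau> that by (intro powr_mono') auto
    then show ?thesis using \<tau> by simp
  qed
  have key: "y (i + h) \<le> \<tau> powr (real (g (Suc i)) - real e)" if "i + h \<le> k" for i
    using that
  proof (induction i rule: less_induct)
    case (less i)
    show ?case
    proof (cases "i < e")
      case True
      then have "g (Suc i) \<le> e" using g_le[of "Suc i"] by simp
      then show ?thesis using big y_le[OF less.prems] order_trans by blast
    next
      case False
      then have i: "2 * h \<le> i" "i0 \<le> i" "1 \<le> i" using h by (auto simp: e_def)
      show ?thesis
      proof (cases "i \<in> G")
        case True
        have "y (i + h) \<le> \<tau> ^ (2 * h) * y (i - h)" using i True less.prems by (intro drop) auto
        also have "y (i - h) \<le> \<tau> powr (real (g (Suc (i - 2 * h))) - real e)"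
          using less.IH[of "i - 2 * h"] i h less.prems by simp
        also have "\<tau> ^ (2 * h) * \<tau> powr (real (g (Suc (i - 2 * h))) - real e)
           = \<tau> powr (real (g (Suc (i - 2 * h))) + real (2 * h) - real e)"
          using \<tau> by (simp add: powr_realpow[symmetric] powr_add[symmetric] algebra_simps del: of_nat_mult)
        also have "\<dots> \<le> \<tau> powr (real (g (Suc i)) - real e)"
        proof -
          have "g (Suc i) \<le> g (Suc (i - 2 * h)) + 2 * h" using g_add[of "Suc (i - 2 * h)" "2 * h"] i by simp
          then show ?thesis using \<tau> by (intro powr_mono') auto
        qed
        finally show ?thesis using \<tau> by simp
      next
        case False
        obtain i' where i': "i = Suc i'" using i by (cases i) auto
        have "y (i + h) \<le> y (i' + h)" using mono[of "i' + h"] less.prems by (simp add: i')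
        also have "\<dots> \<le> \<tau> powr (real (g (Suc i')) - real e)" using less.IH[of i'] less.prems by (simp add: i')
        finally show ?thesis using False g_Suc[of i] by (simp add: i')
      qed
    qed
  qed
  have card: "g k = card G" using G by (simp add: g_def Int_absorb2)
  show ?thesis
  proof (cases "h \<le> k")
    case True
    then have "y k \<le> \<tau> powr (real (g (Suc (k - h))) - real e)" using key[of "k - h"] by simp
    also have "\<dots> \<le> \<tau> powr (real (card G) - real (3 * h + i0))"
    proof -
      have "g k \<le> g (Suc (k - h)) + (h - 1)" using g_add[of "Suc (k - h)" "h - 1"] True h by simp
      then show ?thesis using \<tau> card by (intro powr_mono') (auto simp: e_def)
    qed
    finally show ?thesis .
  next
    case False
    have "y k \<le> 1" by (rule y_le) simp
    also have "1 \<le> \<tau> powr (real (card G) - real (3 * h + i0))"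
    proof -
      have "card G \<le> k" using g_le[of k] card by simp
      then have "\<tau> powr 0 \<le> \<tau> powr (real (card G) - real (3 * h + i0))" using \<tau> False by (intro powr_mono') auto
      then show ?thesis using \<tau> by simp
    qed
    finally show ?thesis .
  qed
qed

section \<open>Counting boxes\<close>

lemma card_subdivision:
  fixes F F' :: "(int ^ 'm) set"
  assumes c: "c > 0" and fin: "finite F" "finite F'"
    and par: "\<And>B. B \<in> F \<Longrightarrow> (\<chi> a. B $ a div int c) \<in> F'"
    and bound: "\<And>B0. B0 \<in> F' \<Longrightarrow> real (card {B \<in> F. (\<chi> a. B $ a div int c) = B0}) \<le> t"
  shows "real (card F) \<le> real (card F') * t"
  using fin par bound by (intro card_le_fibres[where f = "\<lambda>B. \<chi> a. B $ a div int c"]) auto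

lemma card_subboxes:
  fixes B0 :: "int ^ 'm"
  assumes c: "c > 0"
  shows "finite {B :: int ^ 'm. (\<chi> a. B $ a div int c) = B0}"
    and "card {B :: int ^ 'm. (\<chi> a. B $ a div int c) = B0} = c ^ CARD('m)"
proof -
  have "{B :: int ^ 'm. (\<chi> a. B $ a div int c) = B0}
      = {B. \<forall>a. B $ a \<in> {int c * B0 $ a..<int c * B0 $ a + int c}}"
  proof -
    have "x div int c = y \<longleftrightarrow> x \<in> {int c * y..<int c * y + int c}" for x y :: int
    proof
      assume "x div int c = y"
      then have "x = int c * y + x mod int c" by (metis mult_div_mod_eq)
      moreover have "0 \<le> x mod int c" "x mod int c < int c" using c by auto
      ultimately show "x \<in> {int c * y..<int c * y + int c}" by simp
    next
      assume x: "x \<in> {int c * y..<int c * y + int c}"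
      have "x div int c = (int c * y + (x - int c * y)) div int c" by simp
      also have "\<dots> = y + (x - int c * y) div int c" using c by (intro div_mult_self4) simp
      also have "(x - int c * y) div int c = 0" using x by (intro div_pos_pos_trivial) auto
      finally show "x div int c = y" by simp
    qed
    then show ?thesis by (simp add: vec_eq_iff)
  qed
  then show "finite {B :: int ^ 'm. (\<chi> a. B $ a div int c) = B0}"
    and "card {B :: int ^ 'm. (\<chi> a. B $ a div int c) = B0} = c ^ CARD('m)"
    by (simp_all only: card_vec_set finite_vec_set finite_atLeastLessThan_int) simp
qed

text \<open>The pairs in the half-open unit cube for which the lower bound \<open>\<epsilon>\<close> holds for all integer
vectors of norm at least \<open>N\<close>.\<close>

definition uniformly_bad :: "real \<Rightarrow> nat \<Rightarrow> ((real ^ 'n ^ 'm) \<times> (real ^ 'm)) set" where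
  "uniformly_bad \<epsilon> N = {(A, b).
     (\<forall>a c. 0 \<le> A $ a $ c \<and> A $ a $ c < 1) \<and> (\<forall>a. 0 \<le> b $ a \<and> b $ a < 1) \<and>
     (\<forall>q :: int ^ 'n. real N \<le> norm (rvec q) \<longrightarrow>
        \<epsilon> \<le> norm (rvec q) powr (real CARD('n) / real CARD('m)) * dist_to_int (A *v rvec q - b))}"

text \<open>The index of the box of side \<open>1 / L\<close> that contains the matrix \<open>A\<close>.\<close>

definition mat_cell :: "nat \<Rightarrow> real ^ 'n ^ 'm \<Rightarrow> int ^ 'n ^ 'm" where
  "mat_cell L A = (\<chi> a c. \<lfloor>real L * A $ a $ c\<rfloor>)"

text \<open>The index of the box of side \<open>1 / L\<close> that contains the vector \<open>b\<close>.\<close>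

definition vec_cell :: "nat \<Rightarrow> real ^ 'm \<Rightarrow> int ^ 'm" where
  "vec_cell L b = (\<chi> a. \<lfloor>real L * b $ a\<rfloor>)"

text \<open>The boxes of side \<open>1 / L'\<close> for \<open>b\<close> that meet the slice of \<open>uniformly_bad\<close> over the box of side \<open>1 / L\<close> for \<open>A\<close> indexed by \<open>Z\<close>.\<close>

definition alive :: "real \<Rightarrow> nat \<Rightarrow> nat \<Rightarrow> int ^ 'n ^ 'm \<Rightarrow> nat \<Rightarrow> (int ^ 'm) set" where
  "alive \<epsilon> N L Z L' = {B. \<exists>A b. (A, b) \<in> uniformly_bad \<epsilon> N \<and> mat_cell L A = Z \<and> vec_cell L' b = B}"

lemma unit_floor_range:
  fixes x :: real
  assumes "0 \<le> x" "x < 1" "L > 0"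
  shows "0 \<le> \<lfloor>real L * x\<rfloor> \<and> \<lfloor>real L * x\<rfloor> < int L"
  using assms by (auto simp: floor_less_iff)

lemma vec_cell_in_int_box:
  assumes "\<forall>a. 0 \<le> b $ a \<and> b $ a < 1" "L > 0"
  shows "vec_cell L b \<in> int_box L"
  using assms unit_floor_range[of _ L] by (auto simp: vec_cell_def int_box_def)

lemma mat_cell_in_mat_box:
  assumes "\<forall>a c. 0 \<le> A $ a $ c \<and> A $ a $ c < 1" "L > 0"
  shows "mat_cell L A \<in> mat_box L"
  using assms unit_floor_range[of _ L] by (auto simp: mat_cell_def mem_mat_box)

lemma alive_subset: "L' > 0 \<Longrightarrow> alive \<epsilon> N L Z L' \<subseteq> int_box L'"
  by (auto simp: alive_def uniformly_bad_def intro!: vec_cell_in_int_box)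

lemma finite_alive: "L' > 0 \<Longrightarrow> finite (alive \<epsilon> N L Z L')"
  using alive_subset finite_int_box finite_subset by metis

lemma vec_cell_div:
  assumes "c > 0"
  shows "(\<chi> a. vec_cell (L * c) b $ a div int c) = vec_cell L b"
proof -
  have "\<lfloor>real (L * c) * b $ a\<rfloor> div int c = \<lfloor>real L * b $ a\<rfloor>" for a
  proof -
    have "real L * b $ a = real (L * c) * b $ a / of_int (int c)" using assms by simp
    then show ?thesis by (simp only: floor_divide_real_eq_div of_nat_0_le_iff)
  qed
  then show ?thesis by (simp add: vec_cell_def vec_eq_iff)
qed

lemma alive_div:
  assumes "c > 0" "B \<in> alive \<epsilon> N L Z (L' * c)"
  shows "(\<chi> a. B $ a div int c) \<in> alive \<epsilon> N L Z L'"
proof -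
  obtain A b where "(A, b) \<in> uniformly_bad \<epsilon> N" "mat_cell L A = Z" "vec_cell (L' * c) b = B"
    using assms(2) unfolding alive_def by blast
  moreover from this have "vec_cell L' b = (\<chi> a. B $ a div int c)"
    using vec_cell_div[OF assms(1), of L' b] by simp
  ultimately show ?thesis unfolding alive_def by blast
qed

lemma card_alive_refine:
  assumes "c > 0" "L' > 0"
  shows "real (card (alive \<epsilon> N L (Z :: int ^ 'n ^ 'm) (L' * c))) \<le> real (card (alive \<epsilon> N L Z L')) * real (c ^ CARD('m))"
proof (rule card_subdivision[OF assms(1)])
  fix B0 :: "int ^ 'm"
  have "card {B \<in> alive \<epsilon> N L Z (L' * c). (\<chi> a. B $ a div int c) = B0} \<le> card {B :: int ^ 'm. (\<chi> a. B $ a div int c) = B0}"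
    by (intro card_mono card_subboxes assms) auto
  then show "real (card {B \<in> alive \<epsilon> N L Z (L' * c). (\<chi> a. B $ a div int c) = B0}) \<le> real (c ^ CARD('m))"
    by (simp only: card_subboxes(2)[OF assms(1)] of_nat_le_iff)
qed (use assms in \<open>auto intro: finite_alive alive_div\<close>)

lemma card_alive_refine_hole:
  assumes c: "c > 0" and L': "L' > 0"
    and hole: "\<And>B0. \<exists>B. (\<chi> a. B $ a div int c) = B0 \<and> B \<notin> alive \<epsilon> N L Z (L' * c)"
  shows "real (card (alive \<epsilon> N L (Z :: int ^ 'n ^ 'm) (L' * c))) \<le> real (card (alive \<epsilon> N L Z L')) * (real (c ^ CARD('m)) - 1)"
proof (rule card_subdivision[OF c])
  fix B0 :: "int ^ 'm"
  obtain B where B: "(\<chi> a. B $ a div int c) = B0" "B \<notin> alive \<epsilon> N L Z (L' * c)" using hole by blast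
  have "{B \<in> alive \<epsilon> N L Z (L' * c). (\<chi> a. B $ a div int c) = B0} \<subset> {B :: int ^ 'm. (\<chi> a. B $ a div int c) = B0}"
    using B by blast
  then have "card {B \<in> alive \<epsilon> N L Z (L' * c). (\<chi> a. B $ a div int c) = B0} < card {B :: int ^ 'm. (\<chi> a. B $ a div int c) = B0}"
    by (rule psubset_card_mono[OF card_subboxes(1)[OF c]])
  then have "card {B \<in> alive \<epsilon> N L Z (L' * c). (\<chi> a. B $ a div int c) = B0} < c ^ CARD('m)"
    by (simp only: card_subboxes(2)[OF c])
  then show "real (card {B \<in> alive \<epsilon> N L Z (L' * c). (\<chi> a. B $ a div int c) = B0}) \<le> real (c ^ CARD('m)) - 1"
    by linarith
qed (use c L' in \<open>auto intro: finite_alive alive_div\<close>)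

lemma parent_funpow_nth:
  assumes "M > 0"
  shows "(parent M ^^ j) Z $ a $ b = Z $ a $ b div int (M ^ j)"
proof (induction j)
  case (Suc j)
  then show ?case by (simp add: parent_def zdiv_zmult2_eq[symmetric] mult.commute)
qed simp

lemma grid_ancestor_close:
  assumes M: "M > 0" and "i \<le> k"
  shows "\<bar>grid M k Z $ a $ b - grid M i ((parent M ^^ (k - i)) Z) $ a $ b\<bar> \<le> 1 / real M ^ i"
proof -
  define x where "x = Z $ a $ b"
  define c where "c = int (M ^ (k - i))"
  have c0: "c > 0" using M by (simp add: c_def)
  have Mk: "real M ^ k = real M ^ i * of_int c" using assms(2) by (simp add: c_def flip: power_add)
  have Mi: "real M ^ i > 0" using M by simp
  have "x = c * (x div c) + x mod c" "0 \<le> x mod c" "x mod c < c" using c0 by auto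
  then have "real_of_int x = of_int c * of_int (x div c) + of_int (x mod c)" by (metis of_int_add of_int_mult)
  then have "grid M k Z $ a $ b - grid M i ((parent M ^^ (k - i)) Z) $ a $ b = of_int (x mod c) / of_int c / real M ^ i"
    using c0 Mi M by (simp add: grid_def parent_funpow_nth Mk x_def[symmetric] c_def[symmetric] field_simps del: of_nat_power)
  moreover have "0 \<le> of_int (x mod c) / real_of_int c" "of_int (x mod c) / real_of_int c \<le> 1"
    using \<open>0 \<le> x mod c\<close> \<open>x mod c < c\<close> c0 by (auto simp: divide_le_eq_1 less_imp_le)
  ultimately show ?thesis using divide_right_mono[of "of_int (x mod c) / real_of_int c" 1 "real M ^ i"] Mi
    by (simp only: abs_of_nonneg zero_le_divide_iff less_imp_le simp_thms)
qed

lemma mat_cell_close: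
  assumes L: "L > 0" and "mat_cell L A = Z"
  shows "\<bar>A $ a $ c - of_int (Z $ a $ c) / real L\<bar> \<le> 1 / real L"
proof -
  have "\<lfloor>real L * A $ a $ c\<rfloor> = Z $ a $ c" using assms(2) by (auto simp: mat_cell_def)
  then have "\<bar>real L * A $ a $ c - of_int (Z $ a $ c)\<bar> \<le> 1" by linarith
  moreover have "A $ a $ c - of_int (Z $ a $ c) / real L = (real L * A $ a $ c - of_int (Z $ a $ c)) / real L"
    using L by (simp add: field_simps)
  ultimately show ?thesis using L by (simp add: divide_right_mono)
qed

lemma vec_cell_close:
  assumes L: "L > 0" and "vec_cell L b = B"
  shows "\<bar>b $ a - of_int (B $ a) / real L\<bar> \<le> 1 / real L"
proof -
  have "\<lfloor>real L * b $ a\<rfloor> = B $ a" using assms(2) by (auto simp: vec_cell_def)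
  then have "\<bar>real L * b $ a - of_int (B $ a)\<bar> \<le> 1" by linarith
  moreover have "b $ a - of_int (B $ a) / real L = (real L * b $ a - of_int (B $ a)) / real L"
    using L by (simp add: field_simps)
  ultimately show ?thesis using L by (simp add: divide_right_mono)
qed

text \<open>Every good level of the box \<open>Z\<close> removes a fixed proportion of the boxes for \<open>b\<close>. The constant \<open>\<tau>\<close>
does not depend on \<open>N\<close>; only the factor \<open>C\<close> does.\<close>

lemma slice_decay:
  fixes \<epsilon> :: real
  assumes W: "2 \<le> W" and M: "M = W ^ (CARD('m) + CARD('n))" and \<epsilon>: "0 < \<epsilon>"
  shows "\<exists>\<tau>. 0 < \<tau> \<and> \<tau> < 1 \<and> (\<forall>N. \<exists>C\<ge>0. \<forall>k (Z :: int ^ 'n ^ 'm).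
     real (card (alive \<epsilon> N (M ^ k) Z (W ^ (CARD('n) * k))))
       \<le> C * \<tau> ^ card (good_levels W M (real K) k Z) * real W ^ (CARD('n) * CARD('m) * k))"
proof -
  define n where "n = CARD('n)"
  define m where "m = CARD('m)"
  have n0: "n > 0" and m0: "m > 0" by (auto simp: n_def m_def)
  have W0: "W > 0" using W by simp
  have M0: "M > 0" using W0 by (simp add: M)
  have "\<exists>h\<ge>1. \<forall>i (A0 :: real ^ 'n ^ 'm) A1 (B :: int ^ 'm).
     h \<le> i \<longrightarrow> short_count W i A0 \<le> real K \<longrightarrow>
     (\<forall>a b. \<bar>A1 $ a $ b - A0 $ a $ b\<bar> \<le> 1 / real M ^ i) \<longrightarrow>
     (\<exists>B'. (\<forall>a. B' $ a div int (W ^ (n * (2 * h))) = B $ a) \<and>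
        (\<forall>A b. (\<forall>a c. \<bar>A $ a $ c - A1 $ a $ c\<bar> \<le> 1 / real M ^ (i + h)) \<longrightarrow>
               (\<forall>a. \<lfloor>real W ^ (n * (i + h)) * b $ a\<rfloor> = B' $ a) \<longrightarrow>
            (\<exists>q. real W ^ (m * i) \<le> norm (rvec q) \<and>
                 norm (rvec q) powr (real CARD('n) / real CARD('m)) * dist_to_int (A *v rvec q - b) < \<epsilon>)))"
    unfolding m_def n_def by (rule dead_subbox[OF W M \<epsilon>])
  then obtain h where h1: "h \<ge> 1" and dead: "\<And>i (A0 :: real ^ 'n ^ 'm) A1 (B :: int ^ 'm).
     h \<le> i \<Longrightarrow> short_count W i A0 \<le> real K \<Longrightarrow>
     (\<And>a b. \<bar>A1 $ a $ b - A0 $ a $ b\<bar> \<le> 1 / real M ^ i) \<Longrightarrow>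
     (\<exists>B'. (\<forall>a. B' $ a div int (W ^ (n * (2 * h))) = B $ a) \<and>
        (\<forall>A b. (\<forall>a c. \<bar>A $ a $ c - A1 $ a $ c\<bar> \<le> 1 / real M ^ (i + h)) \<longrightarrow>
               (\<forall>a. \<lfloor>real W ^ (n * (i + h)) * b $ a\<rfloor> = B' $ a) \<longrightarrow>
            (\<exists>q. real W ^ (m * i) \<le> norm (rvec q) \<and>
                 norm (rvec q) powr (real CARD('n) / real CARD('m)) * dist_to_int (A *v rvec q - b) < \<epsilon>)))"
    by blast
  define c where "c = W ^ (n * (2 * h))"
  have c0: "c > 0" using W0 by (simp add: c_def)
  define \<theta> where "\<theta> = 1 - 1 / real c ^ m"
  have \<theta>: "0 < \<theta>" "\<theta> < 1"
  proof -
    have "2 ^ 1 \<le> c"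
    proof -
      have "(2::nat) ^ 1 \<le> 2 ^ (n * (2 * h))" using n0 h1 by (intro power_increasing) auto
      also have "\<dots> \<le> c" unfolding c_def using W by (intro power_mono) auto
      finally show ?thesis .
    qed
    then have "(2::real) ^ 1 \<le> real c ^ 1" by simp
    also have "\<dots> \<le> real c ^ m" using m0 c0 by (intro power_increasing) auto
    finally have "1 < real c ^ m" by simp
    then have "1 / real c ^ m < 1" by (subst divide_less_eq_1_pos) linarith+
    then show "0 < \<theta>" by (simp add: \<theta>_def)
    show "\<theta> < 1" using c0 by (simp add: \<theta>_def)
  qed
  define \<tau> where "\<tau> = \<theta> powr (1 / real (2 * h))"
  have \<tau>: "0 < \<tau>" "\<tau> < 1"
  proof -
    show "0 < \<tau>" using \<theta> by (simp add: \<tau>_def)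
    have "\<theta> powr (1 / real (2 * h)) < 1 powr (1 / real (2 * h))" using \<theta> h1 by (intro powr_less_mono2) auto
    then show "\<tau> < 1" by (simp add: \<tau>_def)
  qed
  have \<tau>\<theta>: "\<tau> ^ (2 * h) = \<theta>"
    using \<theta> h1 by (simp add: \<tau>_def powr_powr flip: powr_realpow)
  have "\<exists>C\<ge>0. \<forall>k (Z :: int ^ 'n ^ 'm).
     real (card (alive \<epsilon> N (M ^ k) Z (W ^ (n * k))))
       \<le> C * \<tau> ^ card (good_levels W M (real K) k Z) * real W ^ (n * m * k)" for N
  proof -
    have "\<exists>i0. real N < 2 ^ i0" by (rule real_arch_pow) simp
    then obtain i0 where i0: "real N < 2 ^ i0" by blast
    define C where "C = \<tau> powr (- real (3 * h + i0))"
    have "real (card (alive \<epsilon> N (M ^ k) Z (W ^ (n * k))))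
       \<le> C * \<tau> ^ card (good_levels W M (real K) k Z) * real W ^ (n * m * k)" for k and Z :: "int ^ 'n ^ 'm"
    proof -
      define G where "G = good_levels W M (real K) k Z"
      define y where "y j = real (card (alive \<epsilon> N (M ^ k) Z (W ^ (n * j)))) / real W ^ (n * m * j)" for j
      have Wp: "real W ^ j > 0" for j using W0 by simp
      have "y k \<le> \<tau> powr (real (card G) - real (3 * h + i0))"
      proof (rule decay_of_sequence)
        fix j
        have "real (card (alive \<epsilon> N (M ^ k) Z (W ^ (n * j) * W ^ n)))
            \<le> real (card (alive \<epsilon> N (M ^ k) Z (W ^ (n * j)))) * real ((W ^ n) ^ CARD('m))"
          using W0 by (intro card_alive_refine) auto
        also have "W ^ (n * j) * W ^ n = W ^ (n * Suc j)" by (simp add: power_add mult.commute)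
        finally have *: "real (card (alive \<epsilon> N (M ^ k) Z (W ^ (n * Suc j))))
            \<le> real (card (alive \<epsilon> N (M ^ k) Z (W ^ (n * j)))) * real W ^ (n * m)"
          by (simp add: m_def power_mult)
        have "real W ^ (n * m * Suc j) = real W ^ (n * m * j) * real W ^ (n * m)" by (simp add: power_add)
        then have e: "y (Suc j) = real (card (alive \<epsilon> N (M ^ k) Z (W ^ (n * Suc j)))) / (real W ^ (n * m * j) * real W ^ (n * m))"
          by (simp only: y_def)
        have "y (Suc j) \<le> real (card (alive \<epsilon> N (M ^ k) Z (W ^ (n * j)))) * real W ^ (n * m) / (real W ^ (n * m * j) * real W ^ (n * m))"
          unfolding e using * by (rule divide_right_mono) simp
        also have "\<dots> = y j" unfolding y_def using W0 by simp
        finally show "y (Suc j) \<le> y j" .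
      next
        have "card (alive \<epsilon> N (M ^ k) Z (W ^ (n * 0))) \<le> card (int_box 1 :: (int ^ 'm) set)"
          using alive_subset[of 1 \<epsilon> N "M ^ k" Z] by (intro card_mono) auto
        then show "y 0 \<le> 1" by (simp add: y_def card_int_box)
      next
        fix i assume i: "i \<in> G" "i0 \<le> i" "h \<le> i" "i + h \<le> k"
        have good: "short_count W i (grid M i ((parent M ^^ (k - i)) Z)) \<le> real K"
          using i(1) by (simp add: G_def good_levels_def)
        have close: "\<bar>grid M k Z $ a $ b - grid M i ((parent M ^^ (k - i)) Z) $ a $ b\<bar> \<le> 1 / real M ^ i" for a b
          using i by (intro grid_ancestor_close M0) auto
        have e1: "W ^ (n * (i + h)) = W ^ (n * (i - h)) * c"
        proof -
          have "n * (i + h) = n * (i - h) + n * (2 * h)" using i by (simp add: algebra_simps diff_mult_distrib2)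
          then show ?thesis by (simp add: c_def power_add)
        qed
        have "real (card (alive \<epsilon> N (M ^ k) Z (W ^ (n * (i - h)) * c)))
            \<le> real (card (alive \<epsilon> N (M ^ k) Z (W ^ (n * (i - h))))) * (real (c ^ CARD('m)) - 1)"
        proof (rule card_alive_refine_hole[OF c0])
          show "0 < W ^ (n * (i - h))" using W0 by simp
          fix B :: "int ^ 'm"
          obtain B' where B': "\<And>a. B' $ a div int (W ^ (n * (2 * h))) = B $ a"
            and hole: "\<And>A b. (\<forall>a c. \<bar>A $ a $ c - grid M k Z $ a $ c\<bar> \<le> 1 / real M ^ (i + h)) \<longrightarrow>
               (\<forall>a. \<lfloor>real W ^ (n * (i + h)) * b $ a\<rfloor> = B' $ a) \<longrightarrow>
            (\<exists>q. real W ^ (m * i) \<le> norm (rvec q) \<and>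
                 norm (rvec q) powr (real CARD('n) / real CARD('m)) * dist_to_int (A *v rvec q - b) < \<epsilon>)"
            using dead[OF i(3) good close, of B] by blast
          have "B' \<notin> alive \<epsilon> N (M ^ k) Z (W ^ (n * (i + h)))"
          proof
            assume "B' \<in> alive \<epsilon> N (M ^ k) Z (W ^ (n * (i + h)))"
            then obtain A b where Ab: "(A, b) \<in> uniformly_bad \<epsilon> N" "mat_cell (M ^ k) A = Z" "vec_cell (W ^ (n * (i + h))) b = B'"
              unfolding alive_def by blast
            have "\<bar>A $ a $ c - grid M k Z $ a $ c\<bar> \<le> 1 / real M ^ (i + h)" for a c
            proof -
              have "\<bar>A $ a $ c - grid M k Z $ a $ c\<bar> \<le> 1 / real (M ^ k)"
                using mat_cell_close[OF _ Ab(2), of a c] M0 by (simp add: grid_def)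
              also have "\<dots> \<le> 1 / real M ^ (i + h)"
                using M0 i(4) by (simp add: frac_le power_increasing)
              finally show ?thesis .
            qed
            moreover have "\<lfloor>real W ^ (n * (i + h)) * b $ a\<rfloor> = B' $ a" for a
              using Ab(3) by (auto simp: vec_cell_def)
            ultimately obtain q where q: "real W ^ (m * i) \<le> norm (rvec q)"
                "norm (rvec q) powr (real CARD('n) / real CARD('m)) * dist_to_int (A *v rvec q - b) < \<epsilon>"
              using hole by blast
            have "real N \<le> real W ^ (m * i)"
            proof -
              have "real N \<le> 2 ^ i0" using i0 by simp
              also have "\<dots> \<le> 2 ^ (m * i)" using i(2) m0 by (intro power_increasing) (auto intro: order_trans[of i0 i])
              also have "\<dots> \<le> real W ^ (m * i)" using W by (intro power_mono) auto
              finally show ?thesis .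
            qed
            then have "real N \<le> norm (rvec q)" using q(1) by (rule order_trans)
            then have "\<epsilon> \<le> norm (rvec q) powr (real CARD('n) / real CARD('m)) * dist_to_int (A *v rvec q - b)"
              using Ab(1) unfolding uniformly_bad_def by blast
            then show False using q(2) by simp
          qed
          moreover have "(\<chi> a. B' $ a div int c) = B" using B' by (simp add: c_def vec_eq_iff)
          ultimately show "\<exists>B'. (\<chi> a. B' $ a div int c) = B \<and> B' \<notin> alive \<epsilon> N (M ^ k) Z (W ^ (n * (i - h)) * c)"
            unfolding e1 by blast
        qed
        then have *: "real (card (alive \<epsilon> N (M ^ k) Z (W ^ (n * (i + h)))))
            \<le> real (card (alive \<epsilon> N (M ^ k) Z (W ^ (n * (i - h))))) * (real c ^ m - 1)"
          by (simp only: e1 m_def of_nat_power)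
        have e2: "real W ^ (n * m * (i + h)) = real W ^ (n * m * (i - h)) * real c ^ m"
        proof -
          have "n * m * (i + h) = n * m * (i - h) + n * (2 * h) * m" using i by (simp add: algebra_simps diff_mult_distrib2)
          then show ?thesis by (simp add: c_def power_add flip: power_mult)
        qed
        have cm: "real c ^ m > 0" using c0 by simp
        have "y (i + h) \<le> real (card (alive \<epsilon> N (M ^ k) Z (W ^ (n * (i - h))))) * (real c ^ m - 1) / real W ^ (n * m * (i + h))"
          unfolding y_def using * Wp by (intro divide_right_mono) auto
        also have "\<dots> = \<theta> * y (i - h)"
          unfolding e2 y_def \<theta>_def using cm Wp by (simp add: field_simps)
        finally show "y (i + h) \<le> \<tau> ^ (2 * h) * y (i - h)" by (simp only: \<tau>\<theta>)
      next
        show "G \<subseteq> {..<k}" by (auto simp: G_def good_levels_def)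
      qed (use \<tau> h1 in auto)
      also have "\<tau> powr (real (card G) - real (3 * h + i0)) = C * \<tau> ^ card G"
        using \<tau>(1) by (simp only: C_def diff_conv_add_uminus powr_add powr_realpow mult.commute)
      finally have "y k \<le> C * \<tau> ^ card G" .
      then show ?thesis unfolding y_def G_def by (simp only: pos_divide_le_eq[OF Wp])
    qed
    moreover have "C \<ge> 0" by (simp add: C_def)
    ultimately show ?thesis by blast
  qed
  then show ?thesis using \<tau> unfolding n_def m_def by blast
qed

lemma norm_le_card_mult_mat:
  fixes v :: "real ^ 'n ^ 'm"
  assumes "\<And>a c. \<bar>v $ a $ c\<bar> \<le> r"
  shows "norm v \<le> real (CARD('m) * CARD('n)) * r"
proof -
  have "norm v \<le> (\<Sum>a\<in>UNIV. norm (v $ a))"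
    unfolding norm_vec_def[of v] by (rule L2_set_le_sum) simp
  also have "\<dots> \<le> (\<Sum>a\<in>(UNIV::'m set). real CARD('n) * r)"
    by (rule sum_mono) (rule norm_le_card_mult, rule assms)
  finally show ?thesis by simp
qed

text \<open>The boxes for \<open>b\<close> of level \<open>k\<close> are larger than those for \<open>A\<close>; cutting them into \<open>W ^ (m k)\<close> pieces in each direction
gives a cover by cubes of side \<open>1 / M ^ k\<close>, with exponentially fewer members than the whole unit cube requires.\<close>

lemma uniformly_bad_covers:
  fixes \<epsilon> :: real
  assumes W: "2 \<le> W" and M: "M = W ^ (CARD('m) + CARD('n))" and \<epsilon>: "0 < \<epsilon>" and D: "1 \<le> D"
    and cusp: "\<And>i (A :: real ^ 'n ^ 'm). K < short_count W i A \<Longrightarrow>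
       (\<Sum>E\<in>mat_box M. short_count W (Suc i) (perturb M (Suc i) A E))
         \<le> real M ^ (CARD('m) * CARD('n)) * (short_count W i A / 2)"
    and thick: "\<And>i (A :: real ^ 'n ^ 'm) E. E \<in> mat_box M \<Longrightarrow>
       short_count W (Suc i) (perturb M (Suc i) A E) \<le> D * short_count W i A"
  shows "\<exists>\<mu>. 0 < \<mu> \<and> \<mu> < 1 \<and> (\<forall>N. \<exists>C\<ge>0. \<forall>k. \<exists>F. finite F \<and>
     real (card F) \<le> C * (\<mu> * real M ^ (CARD('m) * CARD('n) + CARD('m))) ^ k \<and>
     (uniformly_bad \<epsilon> N :: ((real ^ 'n ^ 'm) \<times> (real ^ 'm)) set)
       \<subseteq> (\<Union>x\<in>F. cball x (real (CARD('m) * CARD('n) + CARD('m)) / real M ^ k)))"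
proof -
  define n where "n = CARD('n)"
  define m where "m = CARD('m)"
  have W0: "W > 0" using W by simp
  have M0: "M > 0" using W0 by (simp add: M)
  have Mk0: "M ^ k > 0" for k using M0 by simp
  define K' where "K' = nat \<lceil>K\<rceil>"
  have cusp': "(\<Sum>E\<in>mat_box M. short_count W (Suc i) (perturb M (Suc i) A E))
         \<le> real M ^ (CARD('m) * CARD('n)) * (short_count W i A / 2)"
    if "real K' < short_count W i A" for i and A :: "real ^ 'n ^ 'm"
  proof (rule cusp)
    have "K \<le> real K'" unfolding K'_def by linarith
    then show "K < short_count W i A" using that by simp
  qed
  obtain \<tau> where \<tau>: "0 < \<tau>" "\<tau> < 1" and slice: "\<And>N. \<exists>C\<ge>0. \<forall>k (Z :: int ^ 'n ^ 'm).
     real (card (alive \<epsilon> N (M ^ k) Z (W ^ (n * k))))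
       \<le> C * \<tau> ^ card (good_levels W M (real K') k Z) * real W ^ (n * m * k)"
    using slice_decay[OF W M \<epsilon>, of K'] unfolding n_def m_def by blast
  obtain \<mu> C0 where \<mu>: "0 < \<mu>" "\<mu> < 1" and C0: "0 \<le> C0"
    and rare: "\<And>k. (\<Sum>Z\<in>(mat_box (M ^ k) :: (int ^ 'n ^ 'm) set). \<tau> ^ card (good_levels W M (real K') k Z))
        \<le> C0 * \<mu> ^ k * (real M ^ (m * n)) ^ k"
    using few_good_levels_rare[OF W0 M0 D \<tau> cusp' thick] unfolding n_def m_def by blast
  have "\<exists>C\<ge>0. \<forall>k. \<exists>F. finite F \<and>
     real (card F) \<le> C * (\<mu> * real M ^ (m * n + m)) ^ k \<and>
     (uniformly_bad \<epsilon> N :: ((real ^ 'n ^ 'm) \<times> (real ^ 'm)) set)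
       \<subseteq> (\<Union>x\<in>F. cball x (real (m * n + m) / real M ^ k))" for N
  proof -
    obtain C where C: "C \<ge> 0" and sl: "\<And>k (Z :: int ^ 'n ^ 'm).
       real (card (alive \<epsilon> N (M ^ k) Z (W ^ (n * k))))
         \<le> C * \<tau> ^ card (good_levels W M (real K') k Z) * real W ^ (n * m * k)"
      using slice[of N] by blast
    have "\<exists>F. finite F \<and> real (card F) \<le> C * C0 * (\<mu> * real M ^ (m * n + m)) ^ k \<and>
       (uniformly_bad \<epsilon> N :: ((real ^ 'n ^ 'm) \<times> (real ^ 'm)) set)
       \<subseteq> (\<Union>x\<in>F. cball x (real (m * n + m) / real M ^ k))" for k
    proof -
      define c where "c = W ^ (m * k)"
      have c0: "c > 0" using W0 by (simp add: c_def)
      have Mk: "M ^ k = W ^ (n * k) * c"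
      proof -
        have "(m + n) * k = n * k + m * k" by (simp add: algebra_simps)
        then have "W ^ ((m + n) * k) = W ^ (n * k) * W ^ (m * k)" by (simp add: power_add)
        then show ?thesis by (simp add: M m_def n_def c_def power_mult)
      qed
      define J :: "int ^ 'n ^ 'm \<Rightarrow> (int ^ 'm) set" where
        "J Z = {B \<in> int_box (M ^ k). (\<chi> a. B $ a div int c) \<in> alive \<epsilon> N (M ^ k) Z (W ^ (n * k))}" for Z
      define pt :: "(int ^ 'n ^ 'm) \<times> (int ^ 'm) \<Rightarrow> (real ^ 'n ^ 'm) \<times> (real ^ 'm)" where
        "pt = (\<lambda>(Z, B). (grid M k Z, \<chi> a. of_int (B $ a) / real (M ^ k)))"
      define F where "F = pt ` (SIGMA Z:mat_box (M ^ k). J Z)"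
      have finJ: "finite (J Z)" for Z by (simp add: J_def)
      have cardJ: "real (card (J Z)) \<le> real (card (alive \<epsilon> N (M ^ k) Z (W ^ (n * k)))) * real (c ^ m)" for Z
      proof (rule card_subdivision[OF c0 finJ])
        show "finite (alive \<epsilon> N (M ^ k) Z (W ^ (n * k)))" using W0 by (simp add: finite_alive)
        show "(\<chi> a. B $ a div int c) \<in> alive \<epsilon> N (M ^ k) Z (W ^ (n * k))" if "B \<in> J Z" for B
          using that by (simp add: J_def)
        fix B0
        have "card {B \<in> J Z. (\<chi> a. B $ a div int c) = B0} \<le> card {B :: int ^ 'm. (\<chi> a. B $ a div int c) = B0}"
          by (intro card_mono card_subboxes c0) auto
        then show "real (card {B \<in> J Z. (\<chi> a. B $ a div int c) = B0}) \<le> real (c ^ m)"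
          by (simp only: card_subboxes(2)[OF c0] of_nat_le_iff m_def)
      qed
      have "card F \<le> card (SIGMA Z:mat_box (M ^ k). J Z)" unfolding F_def by (intro card_image_le) (simp add: finJ)
      also have "\<dots> = (\<Sum>Z\<in>mat_box (M ^ k). card (J Z))" by (simp add: card_SigmaI finJ)
      finally have "real (card F) \<le> (\<Sum>Z\<in>mat_box (M ^ k). real (card (J Z)))" by (simp flip: of_nat_sum)
      also have "\<dots> \<le> (\<Sum>Z\<in>(mat_box (M ^ k) :: (int ^ 'n ^ 'm) set).
          (C * \<tau> ^ card (good_levels W M (real K') k Z) * real W ^ (n * m * k)) * real (c ^ m))"
        by (intro sum_mono order_trans[OF cardJ] mult_right_mono sl) simp
      also have "\<dots> = C * real W ^ (n * m * k) * real (c ^ m)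
          * (\<Sum>Z\<in>(mat_box (M ^ k) :: (int ^ 'n ^ 'm) set). \<tau> ^ card (good_levels W M (real K') k Z))"
        by (simp add: sum_distrib_left mult_ac)
      also have "\<dots> \<le> C * real W ^ (n * m * k) * real (c ^ m) * (C0 * \<mu> ^ k * (real M ^ (m * n)) ^ k)"
        using C by (intro mult_left_mono rare) auto
      also have "\<dots> = C * C0 * (\<mu> * real M ^ (m * n + m)) ^ k"
      proof -
        have "real W ^ (n * m * k) * real (c ^ m) = (real (M ^ k)) ^ m"
          unfolding Mk by (simp add: power_mult_distrib mult_ac flip: power_mult)
        also have "\<dots> = (real M ^ m) ^ k" by (simp add: mult.commute flip: power_mult)
        finally have "C * (real W ^ (n * m * k) * real (c ^ m)) * (C0 * \<mu> ^ k * (real M ^ (m * n)) ^ k)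
            = C * (real M ^ m) ^ k * (C0 * \<mu> ^ k * (real M ^ (m * n)) ^ k)" by simp
        then show ?thesis by (simp add: power_mult_distrib power_add mult_ac)
      qed
      finally have cardF: "real (card F) \<le> C * C0 * (\<mu> * real M ^ (m * n + m)) ^ k" .
      have "uniformly_bad \<epsilon> N \<subseteq> (\<Union>x\<in>F. cball x (real (m * n + m) / real M ^ k))"
      proof
        fix x :: "(real ^ 'n ^ 'm) \<times> (real ^ 'm)" assume x: "x \<in> uniformly_bad \<epsilon> N"
        obtain A b where Ab: "x = (A, b)" by (cases x)
        have unit: "\<forall>a c. 0 \<le> A $ a $ c \<and> A $ a $ c < 1" "\<forall>a. 0 \<le> b $ a \<and> b $ a < 1"
          using x by (auto simp: uniformly_bad_def Ab)
        define Z where "Z = mat_cell (M ^ k) A"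
        define B where "B = vec_cell (M ^ k) b"
        have "Z \<in> mat_box (M ^ k)" unfolding Z_def by (rule mat_cell_in_mat_box[OF unit(1) Mk0])
        moreover have "B \<in> J Z"
        proof -
          have "B \<in> int_box (M ^ k)" unfolding B_def by (rule vec_cell_in_int_box[OF unit(2) Mk0])
          moreover have "(\<chi> a. B $ a div int c) = vec_cell (W ^ (n * k)) b"
            unfolding B_def Mk by (rule vec_cell_div[OF c0])
          moreover have "vec_cell (W ^ (n * k)) b \<in> alive \<epsilon> N (M ^ k) Z (W ^ (n * k))"
            using x unfolding alive_def Ab Z_def by blast
          ultimately show ?thesis by (simp add: J_def)
        qed
        ultimately have ptF: "pt (Z, B) \<in> F" unfolding F_def by (intro imageI) auto
        have "dist (pt (Z, B)) x \<le> real (m * n + m) / real M ^ k"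
        proof -
          have "dist (pt (Z, B)) x = dist x (pt (Z, B))" by (rule dist_commute)
          also have "\<dots> = norm (A - grid M k Z, b - (\<chi> a. of_int (B $ a) / real (M ^ k)))"
            by (simp add: dist_norm pt_def Ab)
          also have "\<dots> \<le> norm (A - grid M k Z) + norm (b - (\<chi> a. of_int (B $ a) / real (M ^ k)))"
            by (rule norm_Pair_le)
          also have "\<dots> \<le> real (m * n) * (1 / real (M ^ k)) + real m * (1 / real (M ^ k))"
          proof (rule add_mono)
            show "norm (A - grid M k Z) \<le> real (m * n) * (1 / real (M ^ k))"
              unfolding m_def n_def
              by (rule norm_le_card_mult_mat) (use mat_cell_close[OF Mk0 Z_def[symmetric]] in \<open>simp add: grid_def\<close>)
            show "norm (b - (\<chi> a. of_int (B $ a) / real (M ^ k))) \<le> real m * (1 / real (M ^ k))"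
              unfolding m_def
              by (rule norm_le_card_mult) (use vec_cell_close[OF Mk0 B_def[symmetric]] in simp)
          qed
          also have "\<dots> = real (m * n + m) / real M ^ k" by (simp add: add_divide_distrib)
          finally show ?thesis .
        qed
        then show "x \<in> (\<Union>x\<in>F. cball x (real (m * n + m) / real M ^ k))" using ptF by (intro UN_I[of "pt (Z, B)"]) auto
      qed
      moreover have "finite F" unfolding F_def by (simp add: finJ)
      ultimately show ?thesis using cardF by blast
    qed
    moreover have "0 \<le> C * C0" using C C0 by simp
    ultimately show ?thesis by blast
  qed
  then show ?thesis using \<mu> unfolding m_def n_def by blast
qed

section \<open>Hausdorff null sets\<close>

text \<open>The existence of covers, by sets of arbitrarily small diameter, of arbitrarily small total
\<open>s\<close>-dimensional weight. It says that the \<open>s\<close>-dimensional Hausdorff measure vanishes.\<close>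

definition null_covers :: "real \<Rightarrow> 'a::metric_space set \<Rightarrow> bool" where
  "null_covers s S \<longleftrightarrow> (\<forall>r>0. \<forall>e>0. \<exists>U :: nat \<Rightarrow> 'a set. S \<subseteq> (\<Union>i. U i) \<and>
     (\<forall>i. bounded (U i) \<and> diameter (U i) \<le> r) \<and> (\<Sum>i. hausdorff_weight s (U i)) \<le> ennreal e)"

lemma hausdorff_measure_zero:
  assumes "null_covers s S"
  shows "hausdorff_measure s S = 0"
proof -
  have "hausdorff_premeasure s r S = 0" if "r > 0" for r
  proof -
    have le: "hausdorff_premeasure s r S \<le> 0 + ennreal e" if e: "e > 0" for e
    proof -
      obtain U where U: "S \<subseteq> (\<Union>i. U i)" "\<forall>i. bounded (U i) \<and> diameter (U i) \<le> r"
          "(\<Sum>i. hausdorff_weight s (U i)) \<le> ennreal e"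
        using assms \<open>r > 0\<close> e unfolding null_covers_def by blast
      have "hausdorff_premeasure s r S \<le> (\<Sum>i. hausdorff_weight s (U i))"
        unfolding hausdorff_premeasure_def using U by (intro INF_lower) auto
      then show ?thesis using U(3) by simp
    qed
    have "hausdorff_premeasure s r S \<le> 0" by (rule ennreal_le_epsilon) (rule le)
    then show ?thesis by simp
  qed
  then show ?thesis by (simp add: hausdorff_measure_def)
qed

lemma null_covers_mono: "null_covers s T \<Longrightarrow> S \<subseteq> T \<Longrightarrow> null_covers s S"
  unfolding null_covers_def by (meson subset_trans)

lemma null_covers_UN:
  fixes T :: "nat \<Rightarrow> 'a::metric_space set"
  assumes "\<And>j. null_covers s (T j)"
  shows "null_covers s (\<Union>j. T j)"
  unfolding null_covers_def
proof (intro allI impI)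
  fix r e :: real assume r: "r > 0" and e: "e > 0"
  have "\<exists>U :: nat \<Rightarrow> 'a set. T j \<subseteq> (\<Union>i. U i) \<and>
     (\<forall>i. bounded (U i) \<and> diameter (U i) \<le> r) \<and> (\<Sum>i. hausdorff_weight s (U i)) \<le> ennreal (e * (1/2) ^ Suc j)" for j
    using assms[of j] r e unfolding null_covers_def by simp
  then obtain U :: "nat \<Rightarrow> nat \<Rightarrow> 'a set" where U: "\<And>j. T j \<subseteq> (\<Union>i. U j i)"
     "\<And>j i. bounded (U j i) \<and> diameter (U j i) \<le> r"
     "\<And>j. (\<Sum>i. hausdorff_weight s (U j i)) \<le> ennreal (e * (1/2) ^ Suc j)" by metis
  define V where "V i = (case prod_decode i of (j, i') \<Rightarrow> U j i')" for i
  have "(\<Union>j. T j) \<subseteq> (\<Union>i. V i)"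
  proof
    fix x assume "x \<in> (\<Union>j. T j)"
    then obtain j i where "x \<in> U j i" using U(1) by blast
    then have "x \<in> V (prod_encode (j, i))" by (simp add: V_def)
    then show "x \<in> (\<Union>i. V i)" by blast
  qed
  moreover have "\<forall>i. bounded (V i) \<and> diameter (V i) \<le> r"
    using U(2) by (simp add: V_def split: prod.split)
  moreover have "(\<Sum>i. hausdorff_weight s (V i)) \<le> ennreal e"
  proof -
    have "(\<Sum>i. hausdorff_weight s (V i)) = (\<Sum>i. (\<lambda>(j, i'). hausdorff_weight s (U j i')) (prod_decode i))"
      by (simp add: V_def case_prod_beta)
    also have "\<dots> = (\<Sum>j. \<Sum>i. hausdorff_weight s (U j i))"
      by (rule suminf_ennreal_2dimen) simp
    also have "\<dots> \<le> (\<Sum>j. ennreal (e * (1/2) ^ Suc j))"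
      by (intro suminf_le U(3)) auto
    also have "\<dots> = ennreal (\<Sum>j. e * (1/2) ^ Suc j)"
      using e power_half_series by (intro suminf_ennreal2) (auto intro!: summable_mult dest: sums_summable)
    also have "(\<Sum>j. e * (1/2) ^ Suc j) = e"
      using sums_mult[OF power_half_series, of e] by (simp add: sums_iff)
    finally show ?thesis .
  qed
  ultimately show "\<exists>V :: nat \<Rightarrow> 'a set. (\<Union>j. T j) \<subseteq> (\<Union>i. V i) \<and>
     (\<forall>i. bounded (V i) \<and> diameter (V i) \<le> r) \<and> (\<Sum>i. hausdorff_weight s (V i)) \<le> ennreal e" by blast
qed

lemma diameter_cball_le:
  fixes x :: "'a::metric_space"
  assumes "0 \<le> r"
  shows "diameter (cball x r) \<le> 2 * r"
proof -
  have "dist y z \<le> 2 * r" if "y \<in> cball x r" "z \<in> cball x r" for y z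
    using that dist_triangle2[of y z x] by (simp add: dist_commute)
  then show ?thesis
    using assms unfolding diameter_def by (auto intro!: cSUP_least)
qed

lemma null_covers_of_balls:
  fixes S :: "'a::metric_space set"
  assumes s: "0 < s" and C: "0 \<le> C" and R: "0 < R" and M: "1 < M"
    and cov: "\<And>k. \<exists>F. finite F \<and> real (card F) \<le> C * q ^ k \<and> S \<subseteq> (\<Union>x\<in>F. cball x (R / M ^ k))"
    and q: "0 < q" "q < M powr s"
  shows "null_covers s S"
  unfolding null_covers_def
proof (intro allI impI)
  fix r e :: real assume r: "r > 0" and e: "e > 0"
  have lim1: "(\<lambda>k. 2 * R * (1 / M) ^ k) \<longlonglongrightarrow> 2 * R * 0"
    using M by (intro tendsto_mult_left LIMSEQ_realpow_zero) auto
  have "q / M powr s < 1" using q by (subst divide_less_eq_1_pos) auto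
  then have lim2: "(\<lambda>k. C * (2 * R) powr s * (q / M powr s) ^ k) \<longlonglongrightarrow> C * (2 * R) powr s * 0"
    using q by (intro tendsto_mult_left LIMSEQ_realpow_zero) auto
  have "\<forall>\<^sub>F k in sequentially. 2 * R * (1 / M) ^ k < r \<and> C * (2 * R) powr s * (q / M powr s) ^ k < e"
    using order_tendstoD(2)[OF lim1, of r] order_tendstoD(2)[OF lim2, of e] r e by (simp add: eventually_conj)
  then obtain k where k: "2 * R * (1 / M) ^ k < r" "C * (2 * R) powr s * (q / M powr s) ^ k < e"
    by (auto simp: eventually_sequentially)
  define \<rho> where "\<rho> = R / M ^ k"
  have \<rho>0: "\<rho> > 0" using R M by (simp add: \<rho>_def)
  obtain F where F: "finite F" "real (card F) \<le> C * q ^ k" "S \<subseteq> (\<Union>x\<in>F. cball x \<rho>)"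
    using cov[of k] by (auto simp: \<rho>_def)
  obtain f where f: "bij_betw f {0..<card F} F" using ex_bij_betw_nat_finite[OF F(1)] by blast
  define U where "U i = (if i < card F then cball (f i) \<rho> else {})" for i
  have U_diam: "diameter (U i) \<le> 2 * \<rho>" for i
    using diameter_cball_le[of \<rho> "f i"] \<rho>0 by (auto simp: U_def diameter_def)
  have "S \<subseteq> (\<Union>i. U i)"
  proof
    fix x assume "x \<in> S"
    then obtain y where "y \<in> F" "x \<in> cball y \<rho>" using F(3) by blast
    moreover have "y \<in> f ` {0..<card F}" using f \<open>y \<in> F\<close> by (simp add: bij_betw_def)
    then obtain i where "i < card F" "f i = y" by auto
    ultimately have "x \<in> U i" by (simp add: U_def)
    then show "x \<in> (\<Union>i. U i)" by blast
  qed
  moreover have "\<forall>i. bounded (U i) \<and> diameter (U i) \<le> r"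
  proof (intro allI conjI)
    fix i
    show "bounded (U i)" by (simp add: U_def)
    have "2 * \<rho> \<le> r" using k(1) by (simp add: \<rho>_def power_one_over field_simps)
    then show "diameter (U i) \<le> r" using U_diam[of i] by simp
  qed
  moreover have "(\<Sum>i. hausdorff_weight s (U i)) \<le> ennreal e"
  proof -
    have "(\<Sum>i. hausdorff_weight s (U i)) = (\<Sum>i<card F. hausdorff_weight s (U i))"
      by (rule suminf_finite) (auto simp: U_def hausdorff_weight_def)
    also have "\<dots> \<le> (\<Sum>i<card F. ennreal ((2 * \<rho>) powr s))"
    proof (rule sum_mono)
      fix i
      have "diameter (U i) powr s \<le> (2 * \<rho>) powr s"
        using U_diam[of i] s by (intro powr_mono2 diameter_ge_0) (auto simp: U_def)
      then show "hausdorff_weight s (U i) \<le> ennreal ((2 * \<rho>) powr s)"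
        using s by (simp add: hausdorff_weight_def ennreal_leI)
    qed
    also have "\<dots> = ennreal (real (card F) * (2 * \<rho>) powr s)"
      by (simp add: ennreal_mult ennreal_of_nat_eq_real_of_nat)
    also have "\<dots> \<le> ennreal e"
    proof (rule ennreal_leI)
      have pw: "(2 * \<rho>) powr s = (2 * R) powr s / (M powr s) ^ k"
        using R M by (simp add: \<rho>_def powr_divide powr_power powr_powr mult.commute flip: powr_realpow)
      have "real (card F) * (2 * \<rho>) powr s \<le> C * q ^ k * (2 * \<rho>) powr s"
        using F(2) by (intro mult_right_mono) auto
      then have "real (card F) * (2 * \<rho>) powr s \<le> C * q ^ k * ((2 * R) powr s / (M powr s) ^ k)"
        unfolding pw .
      also have "C * q ^ k * ((2 * R) powr s / (M powr s) ^ k) = C * (2 * R) powr s * (q / M powr s) ^ k"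
        by (simp add: power_divide)
      finally show "real (card F) * (2 * \<rho>) powr s \<le> e" using k(2) by simp
    qed
    finally show ?thesis .
  qed
  ultimately show "\<exists>U :: nat \<Rightarrow> 'a set. S \<subseteq> (\<Union>i. U i) \<and>
     (\<forall>i. bounded (U i) \<and> diameter (U i) \<le> r) \<and> (\<Sum>i. hausdorff_weight s (U i)) \<le> ennreal e" by blast
qed

section \<open>Dimension of the set of bad pairs\<close>

lemma dist_to_int_add_rvec: "dist_to_int (v + rvec p) = dist_to_int v"
proof -
  have le: "dist_to_int (v + rvec p) \<le> dist_to_int v" for v and p :: "int ^ 'k"
    unfolding dist_to_int_def[of v]
  proof (rule cINF_greatest)
    show "int_vectors \<noteq> {}" using rvec_in_int_vectors by blast
    fix u :: "real ^ 'k" assume "u \<in> int_vectors"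
    then have "u = rvec (\<chi> i. \<lfloor>u $ i\<rfloor>)"
      by (auto simp: int_vectors_def vec_eq_iff elim: Ints_cases)
    then have u: "v + rvec p - rvec ((\<chi> i. \<lfloor>u $ i\<rfloor>) + p) = v - u" by (simp add: rvec_add)
    show "dist_to_int (v + rvec p) \<le> norm (v - u)"
      using dist_to_int_le[of "v + rvec p" "(\<chi> i. \<lfloor>u $ i\<rfloor>) + p"] by (simp only: u)
  qed
  have "(v + rvec p) + rvec (- p) = v" by (simp add: vec_eq_iff)
  then have "dist_to_int v \<le> dist_to_int (v + rvec p)" using le[of "v + rvec p" "- p"] by (simp only:)
  then show ?thesis using le[of v p] by simp
qed

lemma eps_bad_eventually:
  fixes A :: "real ^ 'n ^ 'm"
  assumes "eps_bad \<epsilon> A b" "\<epsilon>' < \<epsilon>"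
  shows "\<exists>N::nat. \<forall>q :: int ^ 'n. real N \<le> norm (rvec q) \<longrightarrow>
     \<epsilon>' \<le> norm (rvec q) powr (real CARD('n) / real CARD('m)) * dist_to_int (A *v rvec q - b)"
proof -
  have "ereal \<epsilon>' < Liminf (inf at_infinity (principal int_vectors))
       (\<lambda>q. ereal (norm q powr (real CARD('n) / real CARD('m)) * dist_to_int (A *v q - b)))"
    using assms unfolding eps_bad_def by (meson ereal_less_eq(3) less_ereal.simps(1) less_le_trans)
  then have "\<forall>\<^sub>F q in inf at_infinity (principal int_vectors).
     ereal \<epsilon>' < ereal (norm q powr (real CARD('n) / real CARD('m)) * dist_to_int (A *v q - b))"
    by (rule less_LiminfD)
  then obtain N0 where N0: "\<And>q. N0 \<le> norm q \<Longrightarrow> q \<in> int_vectors \<Longrightarrow>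
     \<epsilon>' < norm q powr (real CARD('n) / real CARD('m)) * dist_to_int (A *v q - b)"
    unfolding eventually_inf_principal eventually_at_infinity by auto
  have "\<epsilon>' \<le> norm (rvec q) powr (real CARD('n) / real CARD('m)) * dist_to_int (A *v rvec q - b)"
    if "real (nat \<lceil>N0\<rceil>) \<le> norm (rvec q)" for q :: "int ^ 'n"
  proof -
    have "N0 \<le> norm (rvec q)" using that by linarith
    then show ?thesis using N0[OF _ rvec_in_int_vectors, of q] by simp
  qed
  then show ?thesis by blast
qed

text \<open>The element of the product space with the integer entries \<open>P\<close> and \<open>p\<close>.\<close>

definition int_shift :: "int ^ 'n ^ 'm \<Rightarrow> int ^ 'm \<Rightarrow> (real ^ 'n ^ 'm) \<times> (real ^ 'm)" where
  "int_shift P p = ((\<chi> a c. of_int (P $ a $ c)), rvec p)"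

lemma Bad_subset_shifts:
  assumes "0 < \<epsilon>"
  shows "(Bad \<epsilon> :: ((real ^ 'n ^ 'm) \<times> (real ^ 'm)) set)
    \<subseteq> (\<Union>(N, P, p). (\<lambda>x. int_shift P p + x) ` uniformly_bad (\<epsilon> / 2) N)"
proof clarify
  fix A :: "real ^ 'n ^ 'm" and b :: "real ^ 'm"
  assume "(A, b) \<in> Bad \<epsilon>"
  then have "eps_bad \<epsilon> A b" by (simp add: Bad_def)
  then obtain N where N: "\<And>q :: int ^ 'n. real N \<le> norm (rvec q) \<Longrightarrow>
     \<epsilon> / 2 \<le> norm (rvec q) powr (real CARD('n) / real CARD('m)) * dist_to_int (A *v rvec q - b)"
    using eps_bad_eventually[of \<epsilon> A b "\<epsilon> / 2"] assms by auto
  define P :: "int ^ 'n ^ 'm" where "P = (\<chi> a c. \<lfloor>A $ a $ c\<rfloor>)"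
  define p :: "int ^ 'm" where "p = (\<chi> a. \<lfloor>b $ a\<rfloor>)"
  define A' :: "real ^ 'n ^ 'm" where "A' = (\<chi> a c. frac (A $ a $ c))"
  define b' :: "real ^ 'm" where "b' = (\<chi> a. frac (b $ a))"
  have "dist_to_int (A' *v rvec q - b') = dist_to_int (A *v rvec q - b)" for q :: "int ^ 'n"
  proof -
    define u :: "int ^ 'm" where "u = (\<chi> a. (\<Sum>c\<in>UNIV. P $ a $ c * q $ c) - p $ a)"
    have "A *v rvec q - b = (A' *v rvec q - b') + rvec u"
      by (simp add: vec_eq_iff matrix_vector_mult_def u_def A'_def b'_def P_def p_def frac_def
          sum_subtractf algebra_simps)
    then show ?thesis by (simp add: dist_to_int_add_rvec)
  qed
  then have "(A', b') \<in> uniformly_bad (\<epsilon> / 2) N"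
    using N by (simp add: uniformly_bad_def A'_def b'_def frac_lt_1)
  moreover have "(A, b) = int_shift P p + (A', b')"
    by (simp add: int_shift_def vec_eq_iff P_def p_def A'_def b'_def frac_def)
  ultimately show "(A, b) \<in> (\<Union>(N, P, p). (\<lambda>x. int_shift P p + x) ` uniformly_bad (\<epsilon> / 2) N)"
    by (intro UN_I[of "(N, P, p)"]) auto
qed

theorem corollary1p3:
  fixes \<epsilon> :: real
  assumes "\<epsilon> > 0"
  shows "\<exists>\<delta>>0. hausdorff_dim (Bad \<epsilon> :: ((real ^ 'n ^ 'm) \<times> (real ^ 'm)) set)
           < ereal (real (CARD('m) * CARD('n) + CARD('m)) - \<delta>)"
proof -
  define d where "d = CARD('m) * CARD('n) + CARD('m)"
  have d1: "2 \<le> d"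
  proof -
    have "1 \<le> CARD('m)" "1 \<le> CARD('n)" by (auto simp: Suc_le_eq)
    then have "1 * 1 \<le> CARD('m) * CARD('n)" by (intro mult_mono) auto
    then show ?thesis using \<open>1 \<le> CARD('m)\<close> unfolding d_def by linarith
  qed
  obtain W :: nat and K D :: real where W: "2 \<le> W" and D: "1 \<le> D"
    and cusp: "\<And>i (A :: real ^ 'n ^ 'm). K < short_count W i A \<Longrightarrow>
       (\<Sum>E\<in>mat_box (W ^ (CARD('m) + CARD('n))).
          short_count W (Suc i) (perturb (W ^ (CARD('m) + CARD('n))) (Suc i) A E))
       \<le> real (W ^ (CARD('m) + CARD('n))) ^ (CARD('m) * CARD('n)) * (short_count W i A / 2)"
    and thick: "\<And>i (A :: real ^ 'n ^ 'm) E. E \<in> mat_box (W ^ (CARD('m) + CARD('n))) \<Longrightarrow>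
       short_count W (Suc i) (perturb (W ^ (CARD('m) + CARD('n))) (Suc i) A E) \<le> D * short_count W i A"
    using drift_constants[where 'n = 'n and 'm = 'm] by blast
  define M where "M = W ^ (CARD('m) + CARD('n))"
  have M2: "2 \<le> M"
  proof -
    have "W ^ 1 \<le> M" unfolding M_def using W by (intro power_increasing) (auto simp: Suc_le_eq)
    then show ?thesis using W by simp
  qed
  have "0 < \<epsilon> / 2" using assms by simp
  have "\<exists>\<mu>. 0 < \<mu> \<and> \<mu> < 1 \<and> (\<forall>N. \<exists>C\<ge>0. \<forall>k. \<exists>F. finite F \<and>
     real (card F) \<le> C * (\<mu> * real M ^ d) ^ k \<and>
     (uniformly_bad (\<epsilon> / 2) N :: ((real ^ 'n ^ 'm) \<times> (real ^ 'm)) set) \<subseteq> (\<Union>x\<in>F. cball x (real d / real M ^ k)))"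
    unfolding d_def
    by (rule uniformly_bad_covers[OF W M_def \<open>0 < \<epsilon> / 2\<close> D cusp[folded M_def] thick[folded M_def]])
  then obtain \<mu> where "0 < \<mu> \<and> \<mu> < 1 \<and> (\<forall>N. \<exists>C\<ge>0. \<forall>k. \<exists>F. finite F \<and>
     real (card F) \<le> C * (\<mu> * real M ^ d) ^ k \<and>
     (uniformly_bad (\<epsilon> / 2) N :: ((real ^ 'n ^ 'm) \<times> (real ^ 'm)) set) \<subseteq> (\<Union>x\<in>F. cball x (real d / real M ^ k)))" ..
  then have \<mu>: "0 < \<mu>" "\<mu> < 1" and cov: "\<And>N. \<exists>C\<ge>0. \<forall>k. \<exists>F. finite F \<and>
     real (card F) \<le> C * (\<mu> * real M ^ d) ^ k \<and>
     (uniformly_bad (\<epsilon> / 2) N :: ((real ^ 'n ^ 'm) \<times> (real ^ 'm)) set) \<subseteq> (\<Union>x\<in>F. cball x (real d / real M ^ k))"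
    by simp_all
  \<comment> \<open>Half of the exponent gained in the counting, so that the inequality \<open>q\<close> below is strict; it is
    capped by \<open>1\<close> to keep \<open>s\<close> positive.\<close>
  define \<eta> where "\<eta> = min 1 (- ln \<mu> / (2 * ln (real M)))"
  have lnM: "ln (real M) > 0" using M2 by simp
  have \<eta>: "0 < \<eta>" "\<eta> \<le> 1" using \<mu> lnM by (auto simp: \<eta>_def divide_less_0_iff)
  define s where "s = real d - \<eta>"
  have s0: "0 < s" using \<eta> d1 by (simp add: s_def)
  have q: "\<mu> * real M ^ d < real M powr s"
  proof -
    have "\<eta> * ln (real M) \<le> - ln \<mu> / (2 * ln (real M)) * ln (real M)"
      using lnM by (intro mult_right_mono) (auto simp: \<eta>_def)
    also have "\<dots> < - ln \<mu>" using lnM \<mu> by simp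
    finally have "ln \<mu> < - \<eta> * ln (real M)" by simp
    then have "exp (ln \<mu>) < exp (- \<eta> * ln (real M))" by (simp only: exp_less_cancel_iff)
    then have "\<mu> < real M powr (- \<eta>)" using \<mu> M2 by (simp add: powr_def)
    then have "\<mu> * real M ^ d < real M powr (- \<eta>) * real M ^ d" using M2 by (intro mult_strict_right_mono) auto
    also have "\<dots> = real M powr s" using M2 by (simp add: s_def powr_realpow[symmetric] flip: powr_add)
    finally show ?thesis .
  qed
  have shift_null: "null_covers s ((\<lambda>x. int_shift P p + x) ` (uniformly_bad (\<epsilon> / 2) N :: ((real ^ 'n ^ 'm) \<times> (real ^ 'm)) set))"
    for N and P :: "int ^ 'n ^ 'm" and p :: "int ^ 'm"
  proof -
    obtain C where C: "C \<ge> 0" and F: "\<And>k. \<exists>F. finite F \<and> real (card F) \<le> C * (\<mu> * real M ^ d) ^ k \<and>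
       (uniformly_bad (\<epsilon> / 2) N :: ((real ^ 'n ^ 'm) \<times> (real ^ 'm)) set) \<subseteq> (\<Union>x\<in>F. cball x (real d / real M ^ k))"
      using cov[of N] by blast
    show ?thesis
    proof (rule null_covers_of_balls[OF s0 C, of "real d" "real M" "\<mu> * real M ^ d"])
      fix k
      obtain F where F: "finite F" "real (card F) \<le> C * (\<mu> * real M ^ d) ^ k"
       "(uniformly_bad (\<epsilon> / 2) N :: ((real ^ 'n ^ 'm) \<times> (real ^ 'm)) set) \<subseteq> (\<Union>x\<in>F. cball x (real d / real M ^ k))"
        using F[of k] by blast
      let ?F = "(\<lambda>x. int_shift P p + x) ` F"
      have "real (card ?F) \<le> C * (\<mu> * real M ^ d) ^ k" using F(2) by (simp add: card_image)
      moreover have "(\<lambda>x. int_shift P p + x) ` (uniformly_bad (\<epsilon> / 2) N) \<subseteq> (\<Union>x\<in>?F. cball x (real d / real M ^ k))"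
      proof (rule image_subsetI)
        fix x :: "(real ^ 'n ^ 'm) \<times> (real ^ 'm)" assume "x \<in> uniformly_bad (\<epsilon> / 2) N"
        then obtain y where "y \<in> F" "x \<in> cball y (real d / real M ^ k)" using F(3) by blast
        then show "int_shift P p + x \<in> (\<Union>x\<in>?F. cball x (real d / real M ^ k))"
          by (intro UN_I[of "int_shift P p + y"]) (auto simp: dist_norm)
      qed
      ultimately show "\<exists>F. finite F \<and> real (card F) \<le> C * (\<mu> * real M ^ d) ^ k \<and>
          (\<lambda>x. int_shift P p + x) ` (uniformly_bad (\<epsilon> / 2) N) \<subseteq> (\<Union>x\<in>F. cball x (real d / real M ^ k))"
        using F(1) by blast
    qed (use d1 M2 \<mu> q in auto)
  qed
  define T where "T j = (case from_nat j of (N, P, p) \<Rightarrow>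
     (\<lambda>x. int_shift P p + x) ` (uniformly_bad (\<epsilon> / 2) N :: ((real ^ 'n ^ 'm) \<times> (real ^ 'm)) set))" for j :: nat
  have "null_covers s (\<Union>j. T j)"
    by (rule null_covers_UN) (simp add: T_def shift_null split: prod.split)
  moreover have "Bad \<epsilon> \<subseteq> (\<Union>j. T j)"
  proof
    fix x :: "(real ^ 'n ^ 'm) \<times> (real ^ 'm)" assume "x \<in> Bad \<epsilon>"
    then obtain N P p where "x \<in> (\<lambda>x. int_shift P p + x) ` uniformly_bad (\<epsilon> / 2) N"
      using Bad_subset_shifts[OF assms] by fast
    then have "x \<in> T (to_nat (N, P, p))" by (simp add: T_def)
    then show "x \<in> (\<Union>j. T j)" by blast
  qed
  ultimately have "hausdorff_measure s (Bad \<epsilon> :: ((real ^ 'n ^ 'm) \<times> (real ^ 'm)) set) = 0"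
    by (intro hausdorff_measure_zero) (rule null_covers_mono)
  then have "hausdorff_dim (Bad \<epsilon> :: ((real ^ 'n ^ 'm) \<times> (real ^ 'm)) set) \<le> ereal s"
    unfolding hausdorff_dim_def using s0 by (intro INF_lower) auto
  also have "ereal s < ereal (real d - \<eta> / 2)" using \<eta> by (simp add: s_def)
  finally show ?thesis using \<eta> unfolding d_def by (intro exI[of _ "\<eta> / 2"]) auto
qed

end
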